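(* Let $X$, $D$ and $\partial X$ be complex Banach spaces with $D$ continuously embedded into $X$, and let $\overline D$ be the closure of $D$ in $X$ (with the norm of $X$). Let $A:D\to X$, $B:D\to\partial X$ and $\Phi:\overline D\to\partial X$ be continuous linear maps such that (a) $B$ is surjective; (b) $\Phi$ is compact; (c) the operator $A_0:=A|_{\ker B}$ generates a holomorphic semigroup on $X$ and $\overline{D(A_0)}=\overline D$ (closures in $X$). Define $A_\Phi$ on $X$ by $D(A_\Phi)=\{u\in D:Bu=\Phi u\}$, $A_\Phi u=Au$. Then $A_\Phi$ generates a holomorphic semigroup on $X$ which restricts to a strongly continuous and holomorphic semigroup on $\overline D$.
   Context: $D(A_0)=\ker B\subset D\subset X$. A semigroup on a Banach space $X$ is a strongly continuous map $T:(0,\infty)\to\mathscr L(X)$ with $T(t+s)=T(t)T(s)$, $\|T(t)\|\le Me^{\omega t}$ for some $M>0,\omega\in\mathbb{R}$, and such that $T(t)x=0$ for all $t>0$ implies $x=0$. Its generator is the unique operator $G$ with $(\omega,\infty)\subset\rho(G)$ and $R(\lambda,G)x=\int_0^\infty e^{-\lambda t}T(t)x\,\mathrm dt$ for $\lambda>\omega$, $x\in X$. It is called strongly continuous if moreover $T(t)x\to x$ as $t\to0$ for all $x\in X$. It is holomorphic if for some $\theta\in(0,\pi/2]$ it extends holomorphically to $\Sigma_\theta=\{re^{i\varphi}:r>0,|\varphi|<\theta\}$, with the extension bounded on $\Sigma_\theta\cap\{|z|\le1\}$. Generators need not be densely defined. *)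

theory Defs
  imports "HOL-Analysis.Analysis"
begin

section \<open>Complex Banach spaces\<close>

class complex_normed_vector = real_normed_vector +
  fixes scaleC :: "complex \<Rightarrow> 'a \<Rightarrow> 'a"  (infixr \<open>*\<^sub>C\<close> 75)
  assumes scaleC_add_right: "c *\<^sub>C (x + y) = c *\<^sub>C x + c *\<^sub>C y"
    and scaleC_add_left: "(c + d) *\<^sub>C x = c *\<^sub>C x + d *\<^sub>C x"
    and scaleC_scaleC: "c *\<^sub>C (d *\<^sub>C x) = (c * d) *\<^sub>C x"
    and scaleR_scaleC: "r *\<^sub>R x = complex_of_real r *\<^sub>C x"
    and norm_scaleC: "norm (c *\<^sub>C x) = cmod c * norm x"

class complex_banach = complex_normed_vector + complete_space

subclass (in complex_banach) banach ..

instantiation complex :: complex_banach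
begin

definition "scaleC = (*)" for c :: complex

instance
  by standard (auto simp: scaleC_complex_def algebra_simps norm_mult scaleR_conv_of_real)

end

global_interpretation complex_vector:
  vector_space "scaleC :: complex \<Rightarrow> 'a \<Rightarrow> 'a::complex_normed_vector"
proof
  fix x :: 'a
  have "1 *\<^sub>C x = (1::real) *\<^sub>R x"
    by (simp only: scaleR_scaleC of_real_1)
  then show "1 *\<^sub>C x = x"
    by simp
qed (simp_all add: scaleC_add_right scaleC_add_left scaleC_scaleC)


section \<open>Bounded operators between subspaces\<close>

text \<open>Subspaces are carrier sets in a type; operators on them are total functions of which
  only the values on the carrier matter.  The whole space is the carrier \<^term>\<open>UNIV\<close>.\<close>

definition clinear_on ::
    "'a::complex_normed_vector set \<Rightarrow> 'b::complex_normed_vector set \<Rightarrow> ('a \<Rightarrow> 'b) \<Rightarrow> bool" where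
  "clinear_on V W f \<longleftrightarrow> f ` V \<subseteq> W \<and>
     (\<forall>x\<in>V. \<forall>y\<in>V. f (x + y) = f x + f y) \<and> (\<forall>c. \<forall>x\<in>V. f (c *\<^sub>C x) = c *\<^sub>C f x)"

definition bounded_clinear_on ::
    "'a::complex_normed_vector set \<Rightarrow> 'b::complex_normed_vector set \<Rightarrow> ('a \<Rightarrow> 'b) \<Rightarrow> bool" where
  "bounded_clinear_on V W f \<longleftrightarrow>
     clinear_on V W f \<and> (\<exists>K. \<forall>x\<in>V. norm (f x) \<le> norm x * K)"

text \<open>Relative version of \<^const>\<open>onorm\<close>, which is the case \<open>V = UNIV\<close>.  It is
  meaningful only for operators that are bounded on \<open>V\<close>.\<close>

definition onorm_on ::
    "'a::complex_normed_vector set \<Rightarrow> ('a \<Rightarrow> 'b::complex_normed_vector) \<Rightarrow> real" where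
  "onorm_on V f = (SUP x\<in>V. norm (f x) / norm x)"

definition compact_operator_on ::
    "'a::complex_normed_vector set \<Rightarrow> ('a \<Rightarrow> 'b::complex_normed_vector) \<Rightarrow> bool" where
  "compact_operator_on V f \<longleftrightarrow>
     bounded_clinear_on V UNIV f \<and> compact (closure (f ` (V \<inter> cball 0 1)))"


section \<open>Unbounded operators and resolvents\<close>

text \<open>An unbounded operator is given by its domain \<open>E\<close> and a function \<open>G\<close> whose values
  outside \<open>E\<close> are irrelevant.\<close>

definition unbounded_operator_on ::
    "'a::complex_normed_vector set \<Rightarrow> 'a set \<Rightarrow> ('a \<Rightarrow> 'a) \<Rightarrow> bool" where
  "unbounded_operator_on V E G \<longleftrightarrow>
     complex_vector.subspace E \<and> E \<subseteq> V \<and> clinear_on E V G"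

definition resolvent ::
    "'a::complex_normed_vector set \<Rightarrow> ('a \<Rightarrow> 'a) \<Rightarrow> complex \<Rightarrow> 'a \<Rightarrow> 'a" where
  "resolvent E G \<mu> = inv_into E (\<lambda>u. \<mu> *\<^sub>C u - G u)"

definition resolvent_set ::
    "'a::complex_normed_vector set \<Rightarrow> 'a set \<Rightarrow> ('a \<Rightarrow> 'a) \<Rightarrow> complex set" where
  "resolvent_set V E G =
     {\<mu>. bij_betw (\<lambda>u. \<mu> *\<^sub>C u - G u) E V \<and> bounded_clinear_on V V (resolvent E G \<mu>)}"


section \<open>Semigroups and generators\<close>

text \<open>Semigroups on the Banach space \<open>V\<close>, indexed by \<open>t > 0\<close>; the values for \<open>t \<le> 0\<close> are
  irrelevant, and strong continuity at \<open>0\<close> is not part of the notion.\<close>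

definition growth_bound_on ::
    "'a::complex_banach set \<Rightarrow> (real \<Rightarrow> 'a \<Rightarrow> 'a) \<Rightarrow> real \<Rightarrow> bool" where
  "growth_bound_on V T \<omega> \<longleftrightarrow> (\<exists>M>0. \<forall>t>0. onorm_on V (T t) \<le> M * exp (\<omega> * t))"

definition semigroup_on :: "'a::complex_banach set \<Rightarrow> (real \<Rightarrow> 'a \<Rightarrow> 'a) \<Rightarrow> bool" where
  "semigroup_on V T \<longleftrightarrow>
     complex_vector.subspace V \<and> closed V \<and>
     (\<forall>t>0. bounded_clinear_on V V (T t)) \<and>
     (\<forall>x\<in>V. continuous_on {0<..} (\<lambda>t. T t x)) \<and>
     (\<forall>t>0. \<forall>s>0. \<forall>x\<in>V. T (t + s) x = T t (T s x)) \<and>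
     (\<exists>\<omega>. growth_bound_on V T \<omega>) \<and>
     (\<forall>x\<in>V. (\<forall>t>0. T t x = 0) \<longrightarrow> x = 0)"

text \<open>The gauge integral is used because the Bochner integral of the library requires a
  separable space.  Here the integrand is continuous on the open half line and dominated by a
  decaying exponential, so both integrals coincide with the improper Riemann integral.\<close>

definition generator_on ::
    "'a::complex_banach set \<Rightarrow> 'a set \<Rightarrow> ('a \<Rightarrow> 'a) \<Rightarrow> (real \<Rightarrow> 'a \<Rightarrow> 'a) \<Rightarrow> bool" where
  "generator_on V E G T \<longleftrightarrow>
     unbounded_operator_on V E G \<and>
     (\<exists>\<omega>. growth_bound_on V T \<omega> \<and>
       (\<forall>\<mu>>\<omega>. complex_of_real \<mu> \<in> resolvent_set V E G \<and>
         (\<forall>x\<in>V. ((\<lambda>t. exp (- \<mu> * t) *\<^sub>R T t x) has_integral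
                  resolvent E G (complex_of_real \<mu>) x) {0<..})))"

definition strongly_continuous_on ::
    "'a::complex_banach set \<Rightarrow> (real \<Rightarrow> 'a \<Rightarrow> 'a) \<Rightarrow> bool" where
  "strongly_continuous_on V T \<longleftrightarrow> (\<forall>x\<in>V. ((\<lambda>t. T t x) \<longlongrightarrow> x) (at_right 0))"

definition sector :: "real \<Rightarrow> complex set" where
  "sector \<theta> = {rcis r \<phi> |r \<phi>. r > 0 \<and> \<bar>\<phi>\<bar> < \<theta>}"

text \<open>Complex differentiability with respect to the operator norm of the bounded operators
  on \<open>V\<close>, on an open set \<open>U\<close>.\<close>

definition operator_holomorphic_on ::
    "'a::complex_banach set \<Rightarrow> (complex \<Rightarrow> 'a \<Rightarrow> 'a) \<Rightarrow> complex set \<Rightarrow> bool" where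
  "operator_holomorphic_on V S U \<longleftrightarrow>
     (\<forall>z\<in>U. bounded_clinear_on V V (S z)) \<and>
     (\<forall>z\<in>U. \<exists>L. bounded_clinear_on V V L \<and>
        ((\<lambda>w. onorm_on V (\<lambda>x. inverse (w - z) *\<^sub>C (S w x - S z x) - L x)) \<longlongrightarrow> 0) (at z))"

definition holomorphic_semigroup_on ::
    "'a::complex_banach set \<Rightarrow> (real \<Rightarrow> 'a \<Rightarrow> 'a) \<Rightarrow> bool" where
  "holomorphic_semigroup_on V T \<longleftrightarrow>
     semigroup_on V T \<and>
     (\<exists>\<theta> S. 0 < \<theta> \<and> \<theta> \<le> pi / 2 \<and>
        (\<forall>t>0. \<forall>x\<in>V. S (complex_of_real t) x = T t x) \<and>
        operator_holomorphic_on V S (sector \<theta>) \<and>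
        (\<exists>C. \<forall>z\<in>sector \<theta> \<inter> cball 0 1. onorm_on V (S z) \<le> C))"

end

theory Submission
  imports Defs "HOL-Complex_Analysis.Cauchy_Integral_Formula"
begin

text \<open>A generator \<open>G\<close> of a holomorphic semigroup is characterised, without any density, by
  \<open>norm (l R(l)) \<le> M\<close> on a right half plane.  For the implication from the semigroup to the
  estimate it is enough to know that \<open>T\<close>, \<open>t T'\<close> and \<open>t^2 T''\<close> are bounded near \<open>0\<close> on
  the real axis: the Laplace integral is integrated by parts twice beyond \<open>1 / |l|\<close>.  Conversely
  a Neumann series extends the estimate beyond the imaginary axis, and the semigroup is the inverse
  Laplace integral over the two legs of a wedge; all statements about this contour reduce to scalar
  primitives through norming functionals.

  For the boundary condition \<open>B u = \<Phi> u\<close>, let \<open>D(l)\<close> map \<open>g\<close> to the solution \<open>d\<close> of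
  \<open>A d = l d\<close>, \<open>B d = g\<close>.  Since \<open>D(l)\<close> is uniformly bounded and tends to \<open>0\<close> strongly as
  \<open>l\<close> goes to infinity, compactness of \<open>\<Phi>\<close> gives \<open>norm (D(l) \<Phi>) \<longlongrightarrow> 0\<close>.  Hence
  \<open>1 - D(l) \<Phi>\<close> is invertible on the closure of \<open>D\<close> for large \<open>l\<close>, and
  \<open>(1 - D(l) \<Phi>)\<^sup>-\<^sup>1 R(l, A\<^sub>0)\<close> is the resolvent of the perturbed operator, with the same
  kind of estimate.\<close>

section \<open>Bounded operators\<close>

text \<open>Identities that would rest on them are proved behind an injective resolvent, on whose
  range convergence at time 0 is known. In the perturbation, the uniform bound on
  \<open>D(l)\<close> comes from the open mapping theorem, which supplies a preimage under
  \<open>B\<close> of controlled norm; the strong convergence of \<open>D(l)\<close> to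
  \<open>0\<close> rests on the equality of the closures of \<open>D(A\<^sub>0)\<close> and
  \<open>D\<close>. The two halves of the argument communicate through
  \<open>resolvent_estimate\<close>, that is solvability together with an a priori bound for
  \<open>l u - G u\<close>; this form passes through perturbations without any handling of inverse
  maps. The embedding of \<open>D\<close> is an injective map \<open>J\<close>, so the unbounded
  operators on \<open>X\<close> are written as \<open>A \<circ> inv J\<close> on images under
  \<open>J\<close>.\<close>

lemma scaleC_of_real: "complex_of_real r *\<^sub>C x = r *\<^sub>R x"
  by (simp add: scaleR_scaleC)

lemma bounded_bilinear_scaleC: "bounded_bilinear (scaleC :: complex \<Rightarrow> 'a::complex_normed_vector \<Rightarrow> 'a)"
proof
  show "\<exists>K. \<forall>a (b::'a). norm (a *\<^sub>C b) \<le> norm a * norm b * K"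
    by (rule exI[of _ 1]) (simp add: norm_scaleC)
next
  fix r :: real and a and b :: 'a
  show "(r *\<^sub>R a) *\<^sub>C b = r *\<^sub>R (a *\<^sub>C b)"
    by (simp add: scaleR_conv_of_real scaleR_scaleC[where 'a = 'a] scaleC_scaleC)
  show "a *\<^sub>C r *\<^sub>R b = r *\<^sub>R (a *\<^sub>C b)"
    by (simp add: scaleR_scaleC[where 'a = 'a] scaleC_scaleC mult.commute)
qed (simp_all add: scaleC_add_left scaleC_add_right)

interpretation scaleC: bounded_bilinear "scaleC :: complex \<Rightarrow> 'a::complex_normed_vector \<Rightarrow> 'a"
  by (fact bounded_bilinear_scaleC)

text \<open>Bridge to the real-linear notion \<open>bounded_linear\<close>, whose rules for limits,
  derivatives and integrals are used throughout; complex homogeneity is carried along as a separate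
  fact.\<close>

lemma bounded_clinear_on_UNIV_iff:
  "bounded_clinear_on UNIV UNIV f \<longleftrightarrow> bounded_linear f \<and> (\<forall>c x. f (c *\<^sub>C x) = c *\<^sub>C f x)"
proof
  assume f: "bounded_clinear_on UNIV UNIV f"
  then obtain K where K: "\<And>x. norm (f x) \<le> norm x * K"
    by (auto simp: bounded_clinear_on_def)
  have "bounded_linear f"
    using f by (intro bounded_linear_intro[of f K] K)
      (auto simp: bounded_clinear_on_def clinear_on_def scaleR_scaleC)
  then show "bounded_linear f \<and> (\<forall>c x. f (c *\<^sub>C x) = c *\<^sub>C f x)"
    using f by (auto simp: bounded_clinear_on_def clinear_on_def)
next
  assume f: "bounded_linear f \<and> (\<forall>c x. f (c *\<^sub>C x) = c *\<^sub>C f x)"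
  then interpret bounded_linear f by simp
  show "bounded_clinear_on UNIV UNIV f"
    using f bounded by (auto simp: bounded_clinear_on_def clinear_on_def add)
qed

lemma bounded_clinear_onI:
  assumes "\<And>x y. f (x + y) = f x + f y" "\<And>c x. f (c *\<^sub>C x) = c *\<^sub>C f x"
    "\<And>x. norm (f x) \<le> K * norm x"
  shows "bounded_clinear_on UNIV UNIV f"
  using assms by (auto simp: bounded_clinear_on_def clinear_on_def mult.commute intro!: exI[of _ K])

lemma norm_le_onorm_on:
  assumes "bounded_clinear_on V W f" "x \<in> V"
  shows "norm (f x) \<le> onorm_on V f * norm x"
proof (cases "x = 0")
  case True
  have "f (0 *\<^sub>C x) = 0 *\<^sub>C f x"
    using assms unfolding bounded_clinear_on_def clinear_on_def by blast
  then show ?thesis using True by simp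
next
  case False
  obtain K where K: "\<And>x. x \<in> V \<Longrightarrow> norm (f x) \<le> norm x * K"
    using assms by (auto simp: bounded_clinear_on_def)
  have "norm (f y) / norm y \<le> \<bar>K\<bar>" if "y \<in> V" for y
  proof (cases "y = 0")
    case False
    have "norm (f y) \<le> norm y * \<bar>K\<bar>"
      using K[OF that] by (smt (verit) mult_left_mono norm_ge_zero)
    then show ?thesis using False by (simp add: field_simps)
  qed simp
  then have "bdd_above ((\<lambda>x. norm (f x) / norm x) ` V)"
    by (auto intro!: bdd_aboveI)
  then have "norm (f x) / norm x \<le> onorm_on V f"
    unfolding onorm_on_def using assms(2) by (intro cSUP_upper)
  then show ?thesis using False by (simp add: field_simps)
qed

lemma onorm_on_le:
  assumes "V \<noteq> {}" "0 \<le> K" "\<And>x. x \<in> V \<Longrightarrow> norm (f x) \<le> K * norm x"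
  shows "onorm_on V f \<le> K"
  unfolding onorm_on_def
proof (rule cSUP_least)
  fix x assume "x \<in> V"
  then show "norm (f x) / norm x \<le> K"
    using assms(3)[of x] assms(2) by (cases "x = 0") (auto simp: field_simps)
qed fact

lemma onorm_on_nonneg:
  assumes "bounded_clinear_on V W f" "V \<noteq> {}"
  shows "0 \<le> onorm_on V f"
proof (cases "V \<subseteq> {0}")
  case True
  \<comment> \<open>The only quotient is \<open>norm (f 0) / norm 0\<close>, which is
    \<open>0\<close> by the convention for division.\<close>
  then have "V = {0}" using assms by auto
  then show ?thesis by (simp add: onorm_on_def)
next
  case False
  then obtain x where "x \<in> V" "x \<noteq> 0" by auto
  then show ?thesis
    using norm_le_onorm_on[OF assms(1), of x]
    by (smt (verit) mult_neg_pos norm_ge_zero zero_less_norm_iff)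
qed

section \<open>Bounded linear functionals\<close>

definition sublinear :: "('a::real_vector \<Rightarrow> real) \<Rightarrow> bool" where
  "sublinear q \<longleftrightarrow> (\<forall>x y. q (x + y) \<le> q x + q y) \<and> (\<forall>r>0. \<forall>x. q (r *\<^sub>R x) = r * q x) \<and> q 0 = 0"

lemma sublinearI:
  assumes "\<And>x y. q (x + y) \<le> q x + q y" "\<And>r x. r > 0 \<Longrightarrow> q (r *\<^sub>R x) \<le> r * q x" "q 0 = 0"
  shows "sublinear q"
proof -
  have "q (r *\<^sub>R x) = r * q x" if "r > 0" for r x
    using assms(2)[OF that, of x] assms(2)[of "inverse r" "r *\<^sub>R x"] that
    by (simp add: field_simps)
  with assms show ?thesis by (auto simp: sublinear_def)
qed

text \<open>The infimum over \<open>t \<ge> 0\<close> of \<open>m (x + t y) - t m y\<close> is again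
  sublinear, since the parameters add under sums and scale under dilations. Taking
  \<open>t = 0\<close> and \<open>t = 1\<close> gives the two upper bounds; subadditivity keeps
  every term above \<open>- m (- x)\<close>, so the infimum is finite.\<close>

lemma sublinear_tilt:
  assumes m: "sublinear m"
  shows "\<exists>q. sublinear q \<and> q \<le> m \<and> (\<forall>x. q x \<le> m (x + y) - m y)"
proof -
  define h where "h x t = m (x + t *\<^sub>R y) - t * m y" for x t
  define q where "q x = (INF t\<in>{0..}. h x t)" for x
  have m_add: "m (x + z) \<le> m x + m z" and m_sc: "r > 0 \<Longrightarrow> m (r *\<^sub>R x) = r * m x"
    and m0: "m 0 = 0" for x z r
    using m by (auto simp: sublinear_def)
  have m_sc0: "r \<ge> 0 \<Longrightarrow> m (r *\<^sub>R x) = r * m x" for r x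
    using m_sc m0 by (cases "r = 0") auto
  have low: "- m (- x) \<le> h x t" if "t \<ge> 0" for x t
    using m_add[of "x + t *\<^sub>R y" "- x"] m_sc0[OF that, of y] by (simp add: h_def)
  have bdd: "bdd_below (h x ` {0..})" for x
    using low by (intro bdd_belowI2[of _ "- m (- x)"]) auto
  have qle: "q x \<le> h x t" if "t \<ge> 0" for x t
    unfolding q_def using that by (intro cINF_lower bdd) auto
  have qge: "c \<le> q x" if "\<And>t. t \<ge> 0 \<Longrightarrow> c \<le> h x t" for c x
    unfolding q_def using that by (intro cINF_greatest) auto
  have "sublinear q"
  proof (rule sublinearI)
    fix x z
    have *: "q (x + z) \<le> h x t + h z s" if "t \<ge> 0" "s \<ge> 0" for t s
    proof -
      have "q (x + z) \<le> h (x + z) (t + s)" using that by (intro qle) auto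
      also have "\<dots> \<le> h x t + h z s"
        using m_add[of "x + t *\<^sub>R y" "z + s *\<^sub>R y"] by (simp add: h_def algebra_simps)
      finally show ?thesis .
    qed
    have "q (x + z) - h x t \<le> q z" if "t \<ge> 0" for t
      using *[OF that] by (intro qge) (simp add: algebra_simps)
    then have "q (x + z) - q z \<le> q x"
      by (intro qge) (simp add: algebra_simps)
    then show "q (x + z) \<le> q x + q z" by simp
  next
    fix r :: real and x assume r: "r > 0"
    have "q (r *\<^sub>R x) / r \<le> q x"
    proof (rule qge)
      fix t :: real assume "t \<ge> 0"
      then have "q (r *\<^sub>R x) \<le> h (r *\<^sub>R x) (r * t)" using r by (intro qle) auto
      also have "\<dots> = r * h x t"
        using m_sc[OF r, of "x + t *\<^sub>R y"] by (simp add: h_def algebra_simps)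
      finally show "q (r *\<^sub>R x) / r \<le> h x t" using r by (simp add: field_simps)
    qed
    then show "q (r *\<^sub>R x) \<le> r * q x" using r by (simp add: field_simps)
  next
    have "h 0 t = 0" if "t \<ge> 0" for t using m_sc0[OF that] by (simp add: h_def)
    then show "q 0 = 0" using qle[of 0 0] qge[of 0 0] by force
  qed
  moreover have "q \<le> m" using qle[of 0] by (auto simp: le_fun_def h_def)
  moreover have "q x \<le> m (x + y) - m y" for x using qle[of 1 x] by (simp add: h_def)
  ultimately show ?thesis by blast
qed

text \<open>Zorn's lemma below \<open>p\<close>. The pointwise infimum of a chain is finite because
  \<open>q x \<ge> - q (- x) \<ge> - p (- x)\<close>, and subadditive because two members of a chain
  can be replaced by the smaller one.\<close>

lemma minimal_sublinear_exists:
  assumes p: "sublinear p"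
  shows "\<exists>m. sublinear m \<and> m \<le> p \<and> (\<forall>q. sublinear q \<longrightarrow> q \<le> m \<longrightarrow> q = m)"
proof -
  define S where "S = {q. sublinear q \<and> q \<le> p}"
  have "\<exists>m\<in>S. \<forall>q\<in>S. q \<le> m \<longrightarrow> q = m"
  proof (rule predicate_Zorn)
    \<comment> \<open>The order is reversed: a maximal element of the reversed relation is a minimal
      functional.\<close>
    show "partial_order_on S (relation_of (\<lambda>a b. b \<le> a) S)"
      by (auto simp: partial_order_on_relation_ofI)
  next
    fix C assume C: "C \<in> Chains (relation_of (\<lambda>a b. b \<le> a) S)"
    then have sub: "sublinear q" "q \<le> p" if "q \<in> C" for q
      using that by (auto simp: Chains_def relation_of_def S_def)
    have chain: "q \<le> q' \<or> q' \<le> q" if "q \<in> C" "q' \<in> C" for q q'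
      using C that by (auto simp: Chains_def relation_of_def)
    show "\<exists>u\<in>S. \<forall>a\<in>C. u \<le> a"
    proof (cases "C = {}")
      case True
      then show ?thesis using p by (auto simp: S_def)
    next
      case False
      define u where "u x = (INF q\<in>C. q x)" for x
      have bdd: "bdd_below ((\<lambda>q. q x) ` C)" for x
      proof (rule bdd_belowI2)
        fix q assume q: "q \<in> C"
        have "q 0 \<le> q x + q (- x)" "q 0 = 0"
          using sub(1)[OF q] unfolding sublinear_def by (metis add.right_inverse) (use sub(1)[OF q] in \<open>simp add: sublinear_def\<close>)
        then show "- p (- x) \<le> q x"
          using sub(2)[OF q] by (smt (verit) le_funE)
      qed
      have ule: "u x \<le> q x" if "q \<in> C" for x q
        unfolding u_def using that by (intro cINF_lower bdd)
      have uge: "c \<le> u x" if "\<And>q. q \<in> C \<Longrightarrow> c \<le> q x" for c x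
        unfolding u_def using that False by (intro cINF_greatest) auto
      have "sublinear u"
      proof (rule sublinearI)
        fix x y
        have *: "u (x + y) \<le> q x + q' y" if q: "q \<in> C" "q' \<in> C" for q q'
        proof -
          obtain r where r: "r \<in> C" "r \<le> q" "r \<le> q'" using chain[OF q] q by auto
          have "u (x + y) \<le> r (x + y)" using r by (intro ule)
          also have "\<dots> \<le> r x + r y" using sub(1)[OF r(1)] by (auto simp: sublinear_def)
          also have "\<dots> \<le> q x + q' y" using r by (intro add_mono) (auto simp: le_fun_def)
          finally show ?thesis .
        qed
        have "u (x + y) - q x \<le> u y" if "q \<in> C" for q
          using *[OF that] by (intro uge) (simp add: algebra_simps)
        then have "u (x + y) - u y \<le> u x"
          by (intro uge) (simp add: algebra_simps)
        then show "u (x + y) \<le> u x + u y" by simp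
      next
        fix r :: real and x assume r: "r > 0"
        have "u (r *\<^sub>R x) / r \<le> u x"
        proof (rule uge)
          fix q assume q: "q \<in> C"
          have "u (r *\<^sub>R x) \<le> q (r *\<^sub>R x)" using q by (rule ule)
          also have "\<dots> = r * q x" using sub(1)[OF q] r by (auto simp: sublinear_def)
          finally show "u (r *\<^sub>R x) / r \<le> q x" using r by (simp add: field_simps)
        qed
        then show "u (r *\<^sub>R x) \<le> r * u x" using r by (simp add: field_simps)
      next
        have "q 0 = 0" if "q \<in> C" for q using sub(1)[OF that] by (auto simp: sublinear_def)
        then have "u 0 = (INF q\<in>C. 0)" unfolding u_def by (intro INF_cong) auto
        then show "u 0 = 0" using False by simp
      qed
      moreover have "u \<le> p"
        using False ule sub(2) by (meson all_not_in_conv le_funD le_funI order_trans)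
      ultimately show ?thesis using ule by (auto simp: S_def le_fun_def intro!: bexI[of _ u])
    qed
  qed
  then obtain m where m: "m \<in> S" "\<And>q. q \<in> S \<Longrightarrow> q \<le> m \<Longrightarrow> q = m" by auto
  show ?thesis
  proof (intro exI[of _ m] conjI allI impI)
    fix q assume "sublinear q" "q \<le> m"
    then show "q = m" using m by (auto simp: S_def)
  qed (use m in \<open>auto simp: S_def\<close>)
qed

text \<open>A minimal functional equals its own tilt in every direction \<open>y\<close>, so
  \<open>m x \<le> m (x + y) - m y\<close>; together with subadditivity this is additivity.\<close>

lemma minimal_sublinear_linear:
  assumes m: "sublinear m" and min: "\<And>q. sublinear q \<Longrightarrow> q \<le> m \<Longrightarrow> q = m"
  shows "linear m"
proof -
  have m_add: "m (x + z) \<le> m x + m z" and m_sc: "r > 0 \<Longrightarrow> m (r *\<^sub>R x) = r * m x"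
    and m0: "m 0 = 0" for x z r
    using m by (auto simp: sublinear_def)
  have add: "m (x + y) = m x + m y" for x y
  proof -
    obtain q where "sublinear q" "q \<le> m" "\<And>x. q x \<le> m (x + y) - m y"
      using sublinear_tilt[OF m] by blast
    with min have "m x \<le> m (x + y) - m y" by metis
    with m_add[of x y] show ?thesis by simp
  qed
  have neg: "m (- x) = - m x" for x using add[of x "- x"] m0 by simp
  have "m (r *\<^sub>R x) = r * m x" for r x
  proof (cases "r > 0")
    case False
    show ?thesis
    proof (cases "r = 0")
      case False
      then show ?thesis using \<open>\<not> r > 0\<close> m_sc[of "- r" x] neg[of "r *\<^sub>R x"] by simp
    qed (simp add: m0)
  qed (simp add: m_sc)
  then show ?thesis using add by (intro linearI) auto
qed

text \<open>Minimising below the tilt \<open>p\<close> of the norm in direction \<open>y\<close>,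
  rather than below the norm itself, forces \<open>m (- y) \<le> p (- y) \<le> - norm y\<close>, so
  the linear functional found norms \<open>y\<close>.\<close>

lemma real_norming_functional:
  fixes y :: "'a::real_normed_vector"
  shows "\<exists>f. linear f \<and> (\<forall>x. f x \<le> norm x) \<and> norm y \<le> f y"
proof -
  have "sublinear (norm :: 'a \<Rightarrow> real)"
    by (auto simp: sublinear_def norm_triangle_ineq)
  then obtain p where p: "sublinear p" "p \<le> norm" "\<And>x. p x \<le> norm (x + y) - norm y"
    using sublinear_tilt by blast
  then obtain m where m: "sublinear m" "m \<le> p" "\<And>q. sublinear q \<Longrightarrow> q \<le> m \<Longrightarrow> q = m"
    using minimal_sublinear_exists by metis
  then have lin: "linear m" by (intro minimal_sublinear_linear)
  have "m (- y) \<le> - norm y" using m(2) p(3)[of "- y"] by (auto simp: le_fun_def intro: order_trans)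
  then have "norm y \<le> m y" by (simp add: linear_neg[OF lin])
  moreover have "m x \<le> norm x" for x using m(2) p(2) by (auto simp: le_fun_def intro: order_trans)
  ultimately show ?thesis using lin by blast
qed

text \<open>The usual complexification \<open>f x - \<i> f (\<i> x)\<close> of a real functional:
  its real part is \<open>f\<close>, which keeps the lower bound at \<open>y\<close>, and the factor
  \<open>2\<close> comes from adding the moduli of real and imaginary part.\<close>

lemma norming_functional:
  fixes y :: "'a::complex_normed_vector"
  obtains l :: "'a \<Rightarrow> complex" where "bounded_clinear_on UNIV UNIV l"
    "\<And>x. cmod (l x) \<le> 2 * norm x" "norm y \<le> cmod (l y)"
proof -
  obtain f where f: "linear f" "\<And>x. f x \<le> norm x" "norm y \<le> f y"
    using real_norming_functional by blast
  interpret f: linear f by fact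
  have fabs: "\<bar>f x\<bar> \<le> norm x" for x using f(2)[of x] f(2)[of "- x"] f.neg[of x] by auto
  define l where "l x = Complex (f x) (- f (\<i> *\<^sub>C x))" for x
  have ii: "\<i> *\<^sub>C \<i> *\<^sub>C x = - x" for x :: 'a
    using scaleC_of_real[of "-1" x] by (simp add: scaleC_scaleC)
  have l_add: "l (x + z) = l x + l z" for x z
    by (simp add: l_def complex_eq_iff f.add scaleC_add_right)
  have l_bd: "cmod (l x) \<le> 2 * norm x" for x
    using cmod_le[of "l x"] fabs[of x] fabs[of "\<i> *\<^sub>C x"] by (simp add: l_def norm_scaleC)
  have l_sc: "l (c *\<^sub>C x) = c *\<^sub>C l x" for c x
  proof -
    have "c *\<^sub>C x = Re c *\<^sub>R x + Im c *\<^sub>R (\<i> *\<^sub>C x)"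
      by (subst complex_eq[of c]) (simp add: scaleC_add_left scaleR_scaleC scaleC_scaleC mult.commute)
    moreover have "\<i> *\<^sub>C c *\<^sub>C x = Re c *\<^sub>R (\<i> *\<^sub>C x) - Im c *\<^sub>R x"
      unfolding calculation
      by (simp add: scaleC_add_right ii scaleC.scaleR_right)
    ultimately show ?thesis
      by (simp add: l_def complex_eq_iff f.add f.diff f.scaleR scaleC_complex_def)
  qed
  have "bounded_clinear_on UNIV UNIV l" using l_add l_sc l_bd by (rule bounded_clinear_onI)
  moreover have "norm y \<le> cmod (l y)"
    using f(3) complex_Re_le_cmod[of "l y"] by (simp add: l_def)
  ultimately show ?thesis using l_bd that by blast
qed

text \<open>Lets identities between vector-valued contour integrals be checked for scalar
  holomorphic functions.\<close>

lemma functional_separates: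
  fixes x y :: "'a::complex_normed_vector"
  assumes "\<And>l :: 'a \<Rightarrow> complex. bounded_clinear_on UNIV UNIV l \<Longrightarrow> l x = l y"
  shows "x = y"
proof -
  obtain l :: "'a \<Rightarrow> complex" where l: "bounded_clinear_on UNIV UNIV l" "norm (x - y) \<le> cmod (l (x - y))"
    using norming_functional by blast
  then interpret bounded_linear l by (simp add: bounded_clinear_on_UNIV_iff)
  have "l (x - y) = 0"
    using assms[OF l(1)] by (simp add: diff)
  with l show ?thesis by simp
qed

text \<open>Cauchy's inequality for \<open>l \<circ> f\<close>, where \<open>l\<close> norms the
  single vector \<open>f' z\<close>.\<close>

lemma Cauchy_derivative_bound:
  fixes f :: "complex \<Rightarrow> 'a::complex_normed_vector"
  assumes r: "r > 0"
    and der: "\<And>w. w \<in> ball z r \<Longrightarrow> ((\<lambda>v. inverse (v - w) *\<^sub>C (f v - f w)) \<longlongrightarrow> f' w) (at w)"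
    and bd: "\<And>w. w \<in> ball z r \<Longrightarrow> norm (f w) \<le> C"
  shows "norm (f' z) \<le> 4 * C / r"
proof -
  obtain l :: "'a \<Rightarrow> complex" where l: "bounded_clinear_on UNIV UNIV l"
    "\<And>x. cmod (l x) \<le> 2 * norm x" "norm (f' z) \<le> cmod (l (f' z))"
    using norming_functional by blast
  have lin: "bounded_linear l" and lsc: "\<And>c x. l (c *\<^sub>C x) = c * l x"
    using l(1) by (auto simp: bounded_clinear_on_UNIV_iff scaleC_complex_def)
  have d: "((\<lambda>v. l (f v)) has_field_derivative l (f' w)) (at w)" if "w \<in> ball z r" for w
    using bounded_linear.tendsto[OF lin der[OF that]]
    by (simp add: has_field_derivative_iff lsc linear_diff[OF bounded_linear.linear[OF lin]] divide_inverse mult.commute)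
  have hol: "(\<lambda>v. l (f v)) holomorphic_on ball z r"
    unfolding holomorphic_on_open[OF open_ball] using d by blast
  \<comment> \<open>Radius \<open>r / 2\<close> keeps the closed disc inside the ball of definition;
    with the factor \<open>2\<close> from \<open>l\<close> this is the source of the
    \<open>4\<close>.\<close>
  have "norm ((deriv ^^ 1) (\<lambda>v. l (f v)) z) \<le> fact 1 * (2 * C) / (r/2) ^ 1"
  proof (rule Cauchy_inequality)
    show "(\<lambda>v. l (f v)) holomorphic_on ball z (r/2)"
      by (rule holomorphic_on_subset[OF hol]) (use r in auto)
    show "continuous_on (cball z (r/2)) (\<lambda>v. l (f v))"
      by (rule continuous_on_subset[OF holomorphic_on_imp_continuous_on[OF hol]]) (use r in auto)
    fix x assume x: "norm (z - x) = r/2"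
    have "cmod (l (f x)) \<le> 2 * norm (f x)" by (rule l(2))
    also have "norm (f x) \<le> C" using x r by (intro bd) (auto simp: dist_norm)
    finally show "cmod (l (f x)) \<le> 2 * C" by simp
  qed (use r in auto)
  moreover have "deriv (\<lambda>v. l (f v)) z = l (f' z)"
    using d[of z] r by (intro DERIV_imp_deriv) auto
  ultimately show ?thesis using l(3) by (simp add: field_simps)
qed

section \<open>Integrals over the half line\<close>

lemma filterlim_neg_mult_at_bot: "e > 0 \<Longrightarrow> filterlim (\<lambda>t::real. - e * t) at_bot at_top"
  by (intro filterlim_tendsto_neg_mult_at_bot[OF tendsto_const _ filterlim_ident]) auto

lemma exp_decay_tendsto_0: "e > 0 \<Longrightarrow> ((\<lambda>t::real. K * exp (- e * t)) \<longlongrightarrow> 0) at_top"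
  using tendsto_mult[OF tendsto_const filterlim_compose[OF exp_at_bot filterlim_neg_mult_at_bot], of e K] by simp

text \<open>Improper integrals are controlled by such pairs: \<open>G\<close> is a scalar primitive
  of a majorant, and its increments bound those of the vector primitive \<open>F\<close> on the open
  half line.\<close>

lemma vector_mean_value:
  fixes F :: "real \<Rightarrow> 'a::real_normed_vector"
  assumes "\<And>t. t > 0 \<Longrightarrow> (F has_vector_derivative f t) (at t)"
    and "\<And>t. t > 0 \<Longrightarrow> (G has_real_derivative g t) (at t)"
    and "\<And>t. t > 0 \<Longrightarrow> norm (f t) \<le> g t"
    and "0 < s" "s \<le> t"
  shows "norm (F t - F s) \<le> G t - G s"
proof (cases "s = t")
  case False
  then have "s < t" using assms by simp
  then show ?thesis
  proof (rule differentiable_bound_general[where f' = f and \<phi>' = g])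
    show "continuous_on {s..t} F" using assms
      by (meson atLeastAtMost_iff continuous_at_imp_continuous_on has_vector_derivative_continuous
          order.strict_trans2)
    show "continuous_on {s..t} G" using assms
      by (meson atLeastAtMost_iff continuous_at_imp_continuous_on DERIV_isCont order.strict_trans2)
  qed (use assms in \<open>auto simp: has_real_derivative_iff_has_vector_derivative\<close>)
qed simp

lemma limit_at_top_dominated:
  fixes F :: "real \<Rightarrow> 'a::banach"
  assumes FG: "\<And>s t. 0 < s \<Longrightarrow> s \<le> t \<Longrightarrow> norm (F t - F s) \<le> G t - G s"
    and G: "(G \<longlongrightarrow> b) at_top"
  obtains L where "(F \<longlongrightarrow> L) at_top" "\<And>t. t > 0 \<Longrightarrow> norm (L - F t) \<le> b - G t"
proof -
  have le: "\<bar>G t - G s\<bar> \<ge> norm (F t - F s)" if "s > 0" "t > 0" for s t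
    using FG[of s t] FG[of t s] that by (cases "s \<le> t") (auto simp: norm_minus_commute)
  \<comment> \<open>Sampling at \<open>Suc n\<close> keeps the arguments positive, where the
    domination holds.\<close>
  define X where "X n = F (real (Suc n))" for n
  have Gn: "(\<lambda>n. G (real (Suc n))) \<longlonglongrightarrow> b"
    using filterlim_compose[OF G filterlim_compose[OF filterlim_real_sequentially filterlim_Suc]] .
  have "Cauchy X"
  proof (rule CauchyI)
    fix e :: real assume "e > 0"
    with CauchyD[OF LIMSEQ_imp_Cauchy[OF Gn]] obtain N where
      "\<And>m n. m \<ge> N \<Longrightarrow> n \<ge> N \<Longrightarrow> norm (G (real (Suc m)) - G (real (Suc n))) < e"
      by blast
    then show "\<exists>N. \<forall>m\<ge>N. \<forall>n\<ge>N. norm (X m - X n) < e"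
      using le unfolding X_def by (intro exI[of _ N]) (smt (verit) of_nat_0_less_iff real_norm_def zero_less_Suc)
  qed
  then obtain L where L: "X \<longlonglongrightarrow> L" by (auto simp: Cauchy_convergent_iff convergent_def)
  have bd: "norm (L - F t) \<le> b - G t" if t: "t > 0" for t
  proof (rule LIMSEQ_le)
    show "(\<lambda>n. norm (X n - F t)) \<longlonglongrightarrow> norm (L - F t)"
      by (intro tendsto_intros L)
    show "(\<lambda>n. G (real (Suc n)) - G t) \<longlonglongrightarrow> b - G t"
      by (intro tendsto_intros Gn)
    obtain N where "t \<le> real N" using real_arch_simple by blast
    then show "\<exists>N. \<forall>n\<ge>N. norm (X n - F t) \<le> G (real (Suc n)) - G t"
      unfolding X_def using t by (intro exI[of _ N] allI impI FG) auto
  qed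
  have "(F \<longlongrightarrow> L) at_top"
  proof (rule Lim_null_comparison[THEN Lim_null[THEN iffD2]])
    show "\<forall>\<^sub>F t in at_top. norm (F t - L) \<le> b - G t"
      using eventually_gt_at_top[of 0] by eventually_elim (use bd in \<open>auto simp: norm_minus_commute\<close>)
    show "((\<lambda>t. b - G t) \<longlongrightarrow> 0) at_top"
      using tendsto_diff[OF tendsto_const[of b] G] by simp
  qed
  with bd that show ?thesis by blast
qed

text \<open>Substituting \<open>inverse t\<close> for \<open>t\<close> turns the endpoint
  \<open>0\<close> into infinity; the minus sign in front of \<open>G\<close> restores the
  orientation.\<close>

lemma limit_at_right_0_dominated:
  fixes F :: "real \<Rightarrow> 'a::banach"
  assumes FG: "\<And>s t. 0 < s \<Longrightarrow> s \<le> t \<Longrightarrow> norm (F t - F s) \<le> G t - G s"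
    and G: "(G \<longlongrightarrow> a) (at_right 0)"
  obtains l where "(F \<longlongrightarrow> l) (at_right 0)" "\<And>t. t > 0 \<Longrightarrow> norm (F t - l) \<le> G t - a"
proof -
  have 1: "norm (F (inverse t) - F (inverse s)) \<le> - G (inverse t) - - G (inverse s)"
    if "0 < s" "s \<le> t" for s t
    using FG[of "inverse t" "inverse s"] that by (simp add: norm_minus_commute)
  have 2: "((\<lambda>t. - G (inverse t)) \<longlongrightarrow> - a) at_top"
    by (intro tendsto_minus filterlim_compose[OF G filterlim_inverse_at_right_top])
  obtain l where l: "((\<lambda>t. F (inverse t)) \<longlongrightarrow> l) at_top"
    "\<And>t. t > 0 \<Longrightarrow> norm (l - F (inverse t)) \<le> - a - - G (inverse t)"
    using limit_at_top_dominated[OF 1 2] by blast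
  have "(F \<longlongrightarrow> l) (at_right 0)"
    using filterlim_compose[OF l(1) filterlim_inverse_at_top_right] by simp
  moreover have "norm (F t - l) \<le> G t - a" if "t > 0" for t
    using l(2)[of "inverse t"] that by (simp add: norm_minus_commute)
  ultimately show ?thesis using that by blast
qed

text \<open>Fundamental theorem on the open half line. Only the endpoint limits of the primitive
  enter, so \<open>f\<close> itself may be singular at \<open>0\<close>.\<close>

lemma has_integral_half_line:
  fixes F :: "real \<Rightarrow> 'a::banach"
  assumes der: "\<And>t. t > 0 \<Longrightarrow> (F has_vector_derivative f t) (at t)"
    and l: "(F \<longlongrightarrow> l) (at_right 0)" and L: "(F \<longlongrightarrow> L) at_top"
  shows "(f has_integral (L - l)) {0<..}"
proof (subst has_integral', intro allI impI)
  fix e :: real assume "e > 0"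
  with tendstoD[OF L] obtain B0 where B0: "\<And>t. t \<ge> B0 \<Longrightarrow> dist (F t) L < e"
    unfolding eventually_at_top_linorder by blast
  \<comment> \<open>At least \<open>1\<close>, so that any interval containing the ball has a
    positive right end beyond \<open>B0\<close>.\<close>
  define B where "B = max B0 1"
  have "\<exists>z. ((\<lambda>x. if x \<in> {0<..} then f x else 0) has_integral z) (cbox a b) \<and> norm (z - (L - l)) < e"
    if ab: "ball 0 B \<subseteq> cbox a b" for a b :: real
  proof -
    have "0 < B" by (simp add: B_def)
    have "{-B<..<B} \<subseteq> {a..b}"
      using ab by (auto simp: subset_iff dist_norm)
    then have "a \<le> - B \<and> B \<le> b"
      using \<open>0 < B\<close> by (simp add: greaterThanLessThan_subseteq_atLeastAtMost_iff)
    then have a: "a \<le> - B" and b: "B \<le> b" by auto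
    have b0: "b > 0" "b \<ge> B0" using b \<open>0 < B\<close> by (auto simp: B_def)
    \<comment> \<open>Filling in the limit \<open>l\<close> makes the primitive continuous on the
      closed interval \<open>{0..b}\<close>.\<close>
    define H where "H t = (if t \<le> 0 then l else F t)" for t
    have "(f has_integral (H b - H 0)) {0..b}"
    proof (rule fundamental_theorem_of_calculus_interior)
      have Hd: "(H has_vector_derivative f t) (at t)" if "t > 0" for t
        by (rule has_vector_derivative_transform_within_open[OF der[OF that], of "{0<..}"])
          (use that in \<open>auto simp: H_def\<close>)
      then show "(H has_vector_derivative f x) (at x)" if "x \<in> {0<..<b}" for x using that by auto
      show "continuous_on {0..b} H"
        unfolding continuous_on_eq_continuous_within
      proof
        fix x assume x: "x \<in> {0..b}"
        show "continuous (at x within {0..b}) H"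
        proof (cases "x = 0")
          case True
          have "(H \<longlongrightarrow> l) (at_right 0)"
            by (rule Lim_transform_eventually[OF l])
              (auto simp: eventually_at_right[of 0 1] H_def intro!: exI[of _ 1])
          then have "(H \<longlongrightarrow> l) (at 0 within {0..b})"
            using b0 by (simp add: at_within_Icc_at_right)
          then show ?thesis using True by (simp add: continuous_within H_def)
        next
          case False
          with x have "isCont H x"
            by (intro has_vector_derivative_continuous[OF Hd]) auto
          then show ?thesis by (rule continuous_at_imp_continuous_at_within)
        qed
      qed
    qed (use b0 in auto)
    then have "(f has_integral (F b - l)) {0..b}" using b0 by (simp add: H_def)
    then have "((\<lambda>x. if x \<in> {0<..} then f x else 0) has_integral (F b - l)) {0..b}"
      by (rule has_integral_spike[of "{0}", rotated 2]) auto
    moreover have "((\<lambda>x. if x \<in> {0<..} then f x else 0) has_integral 0) {a..0}"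
      by (rule has_integral_is_0) auto
    ultimately have "((\<lambda>x. if x \<in> {0<..} then f x else 0) has_integral (F b - l)) {a..b}"
      using has_integral_combine[of a 0 b "\<lambda>x. if x \<in> {0<..} then f x else 0" 0 "F b - l"]
        a b0 \<open>0 < B\<close> by simp
    moreover have "norm ((F b - l) - (L - l)) < e"
      using B0[OF b0(2)] by (simp add: dist_norm)
    ultimately show ?thesis by auto
  qed
  moreover have "B > 0" by (simp add: B_def)
  ultimately show "\<exists>B>0. \<forall>a b. ball 0 B \<subseteq> cbox a b \<longrightarrow>
      (\<exists>z. ((\<lambda>x. if x \<in> {0<..} then f x else 0) has_integral z) (cbox a b) \<and> norm (z - (L - l)) < e)"
    by blast
qed

lemma half_line_primitive:
  fixes f :: "real \<Rightarrow> 'a::banach"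
  assumes f: "continuous_on {0<..} f"
  obtains F where "\<And>t. t > 0 \<Longrightarrow> (F has_vector_derivative f t) (at t)"
proof -
  define F where "F t = (if 1 \<le> t then integral {1..t} f else - integral {t..1} f)" for t
  have int: "f integrable_on {a..b}" if "a > 0" for a b
    by (intro integrable_continuous_interval continuous_on_subset[OF f]) (use that in auto)
  have "(F has_vector_derivative f t) (at t)" if t: "t > 0" for t
  proof -
    \<comment> \<open>The window contains both \<open>t\<close> and the base point \<open>1\<close>,
      so on it \<open>F\<close> differs from the integral starting at \<open>a\<close> by a
      constant.\<close>
    define a b where "a = min (t/2) (1/2)" and "b = max (2*t) 2"
    have ab: "0 < a" "a < t" "t < b" "a < 1" "1 < b" using t by (auto simp: a_def b_def)
    have "((\<lambda>u. integral {a..u} f) has_vector_derivative f t) (at t within {a..b})"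
      by (intro integral_has_vector_derivative continuous_on_subset[OF f]) (use ab in auto)
    then have "((\<lambda>u. integral {a..u} f - integral {a..1} f) has_vector_derivative f t) (at t)"
      using ab by (auto intro!: derivative_eq_intros simp: at_within_Icc_at)
    then show ?thesis
    proof (rule has_vector_derivative_transform_within_open)
      fix u assume u: "u \<in> {a<..<b}"
      show "integral {a..u} f - integral {a..1} f = F u"
      proof (cases "1 \<le> u")
        case True
        then show ?thesis using Henstock_Kurzweil_Integration.integral_combine[of a 1 u f] int ab
          by (simp add: F_def algebra_simps)
      next
        case False
        then show ?thesis using Henstock_Kurzweil_Integration.integral_combine[of a u 1 f] int ab u
          by (simp add: F_def algebra_simps)
      qed
    qed (use ab in auto)
  qed
  then show ?thesis by (rule that)
qed

lemma has_integral_half_line_dominated: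
  fixes f :: "real \<Rightarrow> 'a::banach"
  assumes f: "continuous_on {0<..} f" and bd: "\<And>t. t > 0 \<Longrightarrow> norm (f t) \<le> g t"
    and G: "\<And>t. t > 0 \<Longrightarrow> (G has_real_derivative g t) (at t)"
    and a: "(G \<longlongrightarrow> a) (at_right 0)" and b: "(G \<longlongrightarrow> b) at_top"
  obtains I where "(f has_integral I) {0<..}" "norm I \<le> b - a"
proof -
  obtain F where F: "\<And>t. t > 0 \<Longrightarrow> (F has_vector_derivative f t) (at t)"
    using half_line_primitive[OF f] by blast
  have FG: "norm (F t - F s) \<le> G t - G s" if "0 < s" "s \<le> t" for s t
    using vector_mean_value[OF F G bd] that by blast
  obtain l where l: "(F \<longlongrightarrow> l) (at_right 0)" "\<And>t. t > 0 \<Longrightarrow> norm (F t - l) \<le> G t - a"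
    using limit_at_right_0_dominated[OF FG a] by blast
  obtain L where L: "(F \<longlongrightarrow> L) at_top" "\<And>t. t > 0 \<Longrightarrow> norm (L - F t) \<le> b - G t"
    using limit_at_top_dominated[OF FG b] by blast
  have "norm (L - l) \<le> norm (L - F 1) + norm (F 1 - l)"
    using norm_triangle_ineq[of "L - F 1" "F 1 - l"] by simp
  also have "\<dots> \<le> b - a" using l(2)[of 1] L(2)[of 1] by simp
  finally show ?thesis using has_integral_half_line[OF F l(1) L(1)] that by blast
qed

text \<open>The majorant has the primitive \<open>- K / e * exp (- e * t)\<close>, whose total
  increment over the half line is \<open>K / e\<close>.\<close>

lemma has_integral_half_line_exp:
  fixes f :: "real \<Rightarrow> 'a::banach"
  assumes f: "continuous_on {0<..} f" and e: "e > 0"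
    and bd: "\<And>t. t > 0 \<Longrightarrow> norm (f t) \<le> K * exp (- e * t)"
  obtains I where "(f has_integral I) {0<..}" "norm I \<le> K / e"
proof (rule has_integral_half_line_dominated[OF f bd])
  show "((\<lambda>t. - K / e * exp (- e * t)) has_real_derivative K * exp (- e * t)) (at t)" for t
    using e by (auto intro!: derivative_eq_intros)
  have "((\<lambda>t. - K / e * exp (- e * t)) \<longlongrightarrow> - K / e * exp (- e * 0)) (at_right 0)"
    by (intro tendsto_intros)
  then show "((\<lambda>t. - K / e * exp (- e * t)) \<longlongrightarrow> - K / e) (at_right 0)" by simp
  show "((\<lambda>t. - K / e * exp (- e * t)) \<longlongrightarrow> 0) at_top" by (rule exp_decay_tendsto_0[OF e])
qed (use that in auto)

section \<open>Contour integrals over a wedge\<close>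

text \<open>For \<open>d > 0\<close> the open sector around the positive axis of half-angle
  \<open>pi / 2 + arctan d\<close>: it reaches beyond the imaginary axis and omits
  \<open>0\<close>.\<close>

definition wedge_domain :: "real \<Rightarrow> complex set" where
  "wedge_domain d = {l. Re l > - d * \<bar>Im l\<bar>}"

definition leg :: "real \<Rightarrow> real \<Rightarrow> complex" where
  "leg a \<sigma> = Complex (- a) \<sigma>"

definition ray_has_integral ::
    "complex \<Rightarrow> complex \<Rightarrow> (complex \<Rightarrow> 'x::complex_banach) \<Rightarrow> 'x \<Rightarrow> bool" where
  "ray_has_integral c w f I \<longleftrightarrow>
     ((\<lambda>s. w *\<^sub>C f (c + of_real s * w)) has_integral I) {0<..}"

text \<open>The inverse Laplace contour: in from infinity along the lower leg to the vertex
  \<open>c\<close>, out along the upper leg. A relation keeps existence apart from uniqueness and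
  lets linear operations carry over directly.\<close>

definition wedge_has_integral ::
    "real \<Rightarrow> real \<Rightarrow> (complex \<Rightarrow> 'x::complex_banach) \<Rightarrow> 'x \<Rightarrow> bool" where
  "wedge_has_integral a c f I \<longleftrightarrow>
     (\<exists>I1 I2. ray_has_integral c (leg a 1) f I1 \<and> ray_has_integral c (leg a (- 1)) f I2 \<and>
       I = inverse (2 * pi * \<i>) *\<^sub>C (I1 - I2))"

definition wedge_dominated ::
    "real \<Rightarrow> real \<Rightarrow> real \<Rightarrow> real \<Rightarrow> (complex \<Rightarrow> 'x::complex_banach) \<Rightarrow> bool" where
  "wedge_dominated a c K e f \<longleftrightarrow>
     (\<forall>\<sigma>\<in>{1, -1}. continuous_on {0<..} (\<lambda>s. f (of_real c + of_real s * leg a \<sigma>)) \<and>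
        (\<forall>s>0. norm (f (of_real c + of_real s * leg a \<sigma>)) \<le> K * exp (- e * s)))"

lemma ray_has_integral_unique:
  "ray_has_integral c w f I \<Longrightarrow> ray_has_integral c w f I' \<Longrightarrow> I = I'"
  unfolding ray_has_integral_def by (rule has_integral_unique)

lemma wedge_has_integral_unique:
  assumes "wedge_has_integral a c f I" "wedge_has_integral a c f I'"
  shows "I = I'"
  using assms unfolding wedge_has_integral_def by (metis ray_has_integral_unique)

lemma wedge_has_integral_add:
  assumes "wedge_has_integral a c f I" "wedge_has_integral a c g I'"
  shows "wedge_has_integral a c (\<lambda>l. f l + g l) (I + I')"
proof -
  obtain I1 I2 I1' I2' where 1: "ray_has_integral c (leg a 1) f I1" "ray_has_integral c (leg a (- 1)) f I2"
    "ray_has_integral c (leg a 1) g I1'" "ray_has_integral c (leg a (- 1)) g I2'"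
    "I = inverse (2 * pi * \<i>) *\<^sub>C (I1 - I2)" "I' = inverse (2 * pi * \<i>) *\<^sub>C (I1' - I2')"
    using assms by (auto simp: wedge_has_integral_def)
  have "ray_has_integral c w (\<lambda>l. f l + g l) (J + J')"
    if "ray_has_integral c w f J" "ray_has_integral c w g J'" for w J J'
    using that by (auto simp: ray_has_integral_def scaleC_add_right intro: has_integral_add)
  moreover have "I + I' = inverse (2 * pi * \<i>) *\<^sub>C ((I1 + I1') - (I2 + I2'))"
    by (simp only: 1(5,6) scaleC_add_right scaleC.diff_right) simp
  ultimately show ?thesis using 1(1-4) unfolding wedge_has_integral_def by blast
qed

lemma wedge_has_integral_clinear:
  assumes f: "wedge_has_integral a c f I" and L: "bounded_clinear_on UNIV UNIV L"
  shows "wedge_has_integral a c (\<lambda>l. L (f l)) (L I)"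
proof -
  have L': "bounded_linear L" "\<And>c x. L (c *\<^sub>C x) = c *\<^sub>C L x"
    using L by (auto simp: bounded_clinear_on_UNIV_iff)
  obtain I1 I2 where 1: "ray_has_integral c (leg a 1) f I1" "ray_has_integral c (leg a (- 1)) f I2"
    "I = inverse (2 * pi * \<i>) *\<^sub>C (I1 - I2)"
    using f by (auto simp: wedge_has_integral_def)
  have "ray_has_integral c w (\<lambda>l. L (f l)) (L J)" if "ray_has_integral c w f J" for w J
    using has_integral_linear[OF that[unfolded ray_has_integral_def] L'(1)]
    by (simp add: ray_has_integral_def o_def L'(2))
  moreover have "L I = inverse (2 * pi * \<i>) *\<^sub>C (L I1 - L I2)"
    by (simp only: 1(3) L'(2) linear_diff[OF bounded_linear.linear[OF L'(1)]])
  ultimately show ?thesis using 1(1,2) unfolding wedge_has_integral_def by blast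
qed

lemma wedge_has_integral_cong:
  assumes "wedge_has_integral a c f I"
    and "\<And>s \<sigma>. s > 0 \<Longrightarrow> \<sigma> \<in> {1, -1} \<Longrightarrow>
      f (of_real c + of_real s * leg a \<sigma>) = g (of_real c + of_real s * leg a \<sigma>)"
  shows "wedge_has_integral a c g I"
proof -
  have "ray_has_integral c (leg a \<sigma>) g J" if "ray_has_integral c (leg a \<sigma>) f J" "\<sigma> \<in> {1, -1}" for J \<sigma>
    using that assms(2) unfolding ray_has_integral_def
    by (elim has_integral_eq[rotated]) auto
  then show ?thesis using assms(1) unfolding wedge_has_integral_def by blast
qed

lemma bounded_clinear_scaleC: "bounded_clinear_on UNIV UNIV (\<lambda>x. k *\<^sub>C x)"
  by (rule bounded_clinear_onI[where K = "cmod k"])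
    (simp_all add: scaleC_add_right scaleC_scaleC mult.commute norm_scaleC)

lemma bounded_clinear_scaleC_left: "bounded_clinear_on UNIV UNIV (\<lambda>k. k *\<^sub>C x)"
  by (rule bounded_clinear_onI[where K = "norm x"])
    (simp_all add: scaleC_add_left scaleC_scaleC scaleC_complex_def mult.commute norm_scaleC)

lemma norm_leg_le: "a \<ge> 0 \<Longrightarrow> \<sigma> \<in> {1, -1} \<Longrightarrow> cmod (leg a \<sigma>) \<le> 1 + a"
  using cmod_le[of "leg a \<sigma>"] by (auto simp: leg_def)

text \<open>Speed at most \<open>1 + a\<close> and decay rate \<open>e\<close> bound each leg by
  \<open>(1 + a) * K / e\<close>; two legs against \<open>1 / (2 pi)\<close> leave a factor
  \<open>1 / pi\<close>, which is at most \<open>1\<close>.\<close>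

lemma wedge_has_integral_exists:
  assumes a: "a \<ge> 0" and e: "e > 0" and f: "wedge_dominated a c K e f"
  obtains I where "wedge_has_integral a c f I" "norm I \<le> (1 + a) * K / e"
proof -
  have "\<exists>I. ray_has_integral c (leg a \<sigma>) f I \<and> norm I \<le> (1 + a) * K / e" if s: "\<sigma> \<in> {1, -1}" for \<sigma>
  proof -
    have "continuous_on {0<..} (\<lambda>s. f (of_real c + of_real s * leg a \<sigma>))"
      and b: "\<And>s. s > 0 \<Longrightarrow> norm (f (of_real c + of_real s * leg a \<sigma>)) \<le> K * exp (- e * s)"
      using f s by (auto simp: wedge_dominated_def)
    then have c: "continuous_on {0<..} (\<lambda>s. leg a \<sigma> *\<^sub>C f (of_real c + of_real s * leg a \<sigma>))"
      by (intro scaleC.continuous_on continuous_intros)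
    have "norm (leg a \<sigma> *\<^sub>C f (of_real c + of_real s * leg a \<sigma>)) \<le> ((1 + a) * K) * exp (- e * s)"
      if "s > 0" for s
      using mult_mono[OF norm_leg_le[OF a s] b[OF that]] a by (simp add: norm_scaleC mult.assoc)
    from has_integral_half_line_exp[OF c e this] show ?thesis
      unfolding ray_has_integral_def by metis
  qed
  then obtain I1 I2 where I: "ray_has_integral c (leg a 1) f I1" "norm I1 \<le> (1 + a) * K / e"
    "ray_has_integral c (leg a (- 1)) f I2" "norm I2 \<le> (1 + a) * K / e"
    by (metis insertCI)
  show ?thesis
  proof (rule that)
    show "wedge_has_integral a c f (inverse (2 * pi * \<i>) *\<^sub>C (I1 - I2))"
      using I by (auto simp: wedge_has_integral_def)
    have "norm (I1 - I2) \<le> (1 + a) * K / e + (1 + a) * K / e"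
      by (rule order_trans[OF norm_triangle_ineq4 add_mono[OF I(2,4)]])
    then have "norm (I1 - I2) \<le> 2 * ((1 + a) * K / e)" by (simp only: mult_2)
    then have "inverse (2 * pi) * norm (I1 - I2) \<le> inverse (2 * pi) * (2 * ((1 + a) * K / e))"
      by (intro mult_left_mono) auto
    also have "\<dots> = inverse pi * ((1 + a) * K / e)" by simp
    also have "\<dots> \<le> 1 * ((1 + a) * K / e)"
      using pi_gt3 order_trans[OF norm_ge_zero I(2)] by (intro mult_right_mono) (simp_all add: field_simps)
    finally show "norm (inverse (2 * pi * \<i>) *\<^sub>C (I1 - I2)) \<le> (1 + a) * K / e"
      by (simp add: norm_scaleC norm_mult norm_inverse)
  qed
qed

section \<open>Primitives along rays and independence of the vertex\<close>

lemma primitive_ray_limit: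
  fixes F f :: "complex \<Rightarrow> complex"
  assumes "open H" and seg: "\<And>s. s \<ge> 0 \<Longrightarrow> c + of_real s * w \<in> H"
    and F: "\<And>x. x \<in> H \<Longrightarrow> (F has_field_derivative f x) (at x)"
    and e: "e > 0" and bd: "\<And>s. s > 0 \<Longrightarrow> cmod (f (c + of_real s * w)) \<le> K * exp (- e * s)"
  obtains L where "((\<lambda>s. F (c + of_real s * w)) \<longlongrightarrow> L) at_top" "ray_has_integral c w f (L - F c)"
proof -
  have d: "((\<lambda>s. F (c + of_real s * w)) has_vector_derivative w * f (c + of_real s * w)) (at s)"
    if "s \<ge> 0" for s :: real
  proof -
    have "((\<lambda>s. c + of_real s * w) has_vector_derivative w) (at s)"
      by (auto intro!: derivative_eq_intros)
    from field_vector_diff_chain_at[OF this F[OF seg[OF that]]] show ?thesis by (simp add: o_def)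
  qed
  have "isCont (\<lambda>s. F (c + of_real s * w)) 0"
    by (rule has_vector_derivative_continuous[OF d]) simp
  then have 0: "((\<lambda>s. F (c + of_real s * w)) \<longlongrightarrow> F c) (at_right 0)"
    by (auto simp: isCont_def intro: tendsto_within_subset)
  have G: "((\<lambda>t. - (cmod w * K) / e * exp (- e * t)) has_real_derivative cmod w * K * exp (- e * t)) (at t)" for t
    using e by (auto intro!: derivative_eq_intros)
  have b: "norm (w * f (c + of_real s * w)) \<le> cmod w * K * exp (- e * s)" if "s > 0" for s
    using mult_left_mono[OF bd[OF that] norm_ge_zero[of w]] by (simp add: norm_mult mult.assoc)
  from limit_at_top_dominated[OF vector_mean_value[OF d G b] exp_decay_tendsto_0[OF e]]
  obtain L where "((\<lambda>s. F (c + of_real s * w)) \<longlongrightarrow> L) at_top" by auto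
  with has_integral_half_line[OF d 0 this] show ?thesis
    by (intro that[of L]) (auto simp: ray_has_integral_def scaleC_complex_def)
qed

lemma open_half_plane: "open {l. Re l + d * Im l > 0}"
  by (intro open_Collect_less continuous_intros)

lemma convex_half_plane: "convex {l. Re l + d * Im l > 0}"
  using convex_halfspace_gt[of 0 "Complex 1 d"] by (simp add: inner_complex_def)

text \<open>The wedge domain is not convex but is the union of these two half planes. Each is
  convex, so a holomorphic function has a primitive on it, and each leg of a contour stays in one of
  them.\<close>

lemma half_plane_subset: "\<sigma> \<in> {1, -1} \<Longrightarrow> d > 0 \<Longrightarrow> {l. Re l + (\<sigma> * d) * Im l > 0} \<subseteq> wedge_domain d"
proof
  fix l assume *: "\<sigma> \<in> {1, -1}" "d > 0" "l \<in> {l. Re l + (\<sigma> * d) * Im l > 0}"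
  have "d * (\<sigma> * Im l) \<le> d * \<bar>Im l\<bar>" using * by (intro mult_left_mono) auto
  moreover have "\<sigma> * d * Im l = d * (\<sigma> * Im l)" by simp
  ultimately have "- (d * \<bar>Im l\<bar>) < Re l" using * unfolding mem_Collect_eq by linarith
  then show "l \<in> wedge_domain d" by (simp add: wedge_domain_def)
qed

lemma leg_in_half_plane:
  assumes "0 < a" "a < d" "c > 0" "s \<ge> 0" "\<sigma> \<in> {1, -1}"
  shows "of_real c + of_real s * leg a \<sigma> \<in> {l. Re l + (\<sigma> * d) * Im l > 0}"
proof -
  have "0 \<le> s * (d - a)" using assms by (intro mult_nonneg_nonneg) auto
  then have "c + (s * d - s * a) > 0" using assms by (simp add: algebra_simps)
  then show ?thesis using assms by (auto simp: leg_def algebra_simps)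
qed

lemma leg_in_wedge_domain:
  assumes "0 < a" "a < d" "c > 0" "s \<ge> 0" "\<sigma> \<in> {1, -1}"
  shows "of_real c + of_real s * leg a \<sigma> \<in> wedge_domain d"
  using leg_in_half_plane[OF assms] half_plane_subset[of \<sigma> d] assms by (meson less_trans subsetD)

text \<open>The primitives on the two half planes differ by a constant on their intersection, so the
  two legs contribute opposite boundary terms at the vertices.\<close>
lemma wedge_integral_vertex_independent:
  fixes f :: "complex \<Rightarrow> complex"
  assumes a: "0 < a" "a < d" and c: "0 < c1" "c1 \<le> c2"
    and hol: "f holomorphic_on wedge_domain d"
    and e: "e > 0"
    and bd: "\<And>c s \<sigma>. c1 \<le> c \<Longrightarrow> c \<le> c2 \<Longrightarrow> s > 0 \<Longrightarrow> \<sigma> \<in> {1, -1} \<Longrightarrow>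
        cmod (f (of_real c + of_real s * leg a \<sigma>)) \<le> K * exp (- e * s)"
    and I: "wedge_has_integral a c1 f I1" "wedge_has_integral a c2 f I2"
  shows "I1 = I2"
proof -
  define H where "H \<sigma> = {l. Re l + (\<sigma> * d) * Im l > 0}" for \<sigma> :: real
  have oH: "open (H \<sigma>)" and cH: "convex (H \<sigma>)" for \<sigma>
    unfolding H_def by (rule open_half_plane convex_half_plane)+
  have "\<exists>F. \<forall>x\<in>H \<sigma>. (F has_field_derivative f x) (at x)" if "\<sigma> \<in> {1, -1}" for \<sigma>
  proof -
    have "f holomorphic_on H \<sigma>"
      using hol half_plane_subset[OF that, of d] a unfolding H_def by (auto intro: holomorphic_on_subset)
    from holomorphic_convex_primitive'[OF cH oH this] obtain F
      where "\<And>x. x \<in> H \<sigma> \<Longrightarrow> (F has_field_derivative f x) (at x within H \<sigma>)" by blast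
    then show ?thesis using at_within_open[OF _ oH] by metis
  qed
  then obtain F where F: "\<And>\<sigma> x. \<sigma> \<in> {1, -1} \<Longrightarrow> x \<in> H \<sigma> \<Longrightarrow> (F \<sigma> has_field_derivative f x) (at x)"
    by metis
  have leg: "of_real c + of_real s * leg a \<sigma> \<in> H \<sigma>" if "c > 0" "s \<ge> 0" "\<sigma> \<in> {1, -1}" for c s \<sigma>
    unfolding H_def by (rule leg_in_half_plane) (use that a in auto)
  have diff: "\<exists>I I'. ray_has_integral c1 (leg a \<sigma>) f I \<and> ray_has_integral c2 (leg a \<sigma>) f I' \<and>
      I - I' = F \<sigma> c2 - F \<sigma> c1" if s: "\<sigma> \<in> {1, -1}" for \<sigma>
  proof -
    have b1: "cmod (f (of_real c1 + of_real s * leg a \<sigma>)) \<le> K * exp (- e * s)" if "s > 0" for s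
      using bd[of c1] c s that by auto
    have b2: "cmod (f (of_real c2 + of_real s * leg a \<sigma>)) \<le> K * exp (- e * s)" if "s > 0" for s
      using bd[of c2] c s that by auto
    obtain L1 where L1: "((\<lambda>s. F \<sigma> (c1 + of_real s * leg a \<sigma>)) \<longlongrightarrow> L1) at_top"
      "ray_has_integral c1 (leg a \<sigma>) f (L1 - F \<sigma> c1)"
      using primitive_ray_limit[OF oH leg[OF _ _ s] F[OF s] e b1] c by auto
    obtain L2 where L2: "((\<lambda>s. F \<sigma> (c2 + of_real s * leg a \<sigma>)) \<longlongrightarrow> L2) at_top"
      "ray_has_integral c2 (leg a \<sigma>) f (L2 - F \<sigma> c2)"
      using primitive_ray_limit[OF oH leg[OF _ _ s] F[OF s] e b2] c by auto
    \<comment> \<open>Corresponding points of the two legs are joined by a segment of fixed length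
      \<open>c2 - c1\<close>, on which \<open>f\<close> decays uniformly; hence the two limits at
      infinity agree.\<close>
    have "((\<lambda>s. F \<sigma> (c2 + of_real s * leg a \<sigma>) - F \<sigma> (c1 + of_real s * leg a \<sigma>)) \<longlongrightarrow> 0) at_top"
    proof (rule Lim_null_comparison)
      show "\<forall>\<^sub>F s in at_top. norm (F \<sigma> (c2 + of_real s * leg a \<sigma>) - F \<sigma> (c1 + of_real s * leg a \<sigma>))
          \<le> K * exp (- e * s) * (c2 - c1)"
        using eventually_gt_at_top[of 0]
      proof eventually_elim
        fix s :: real assume s0: "s > 0"
        let ?p = "\<lambda>c. of_real c + of_real s * leg a \<sigma>"
        have p: "\<exists>c. c1 \<le> c \<and> c \<le> c2 \<and> x = ?p c" if x: "x \<in> closed_segment (?p c1) (?p c2)" for x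
        proof -
          obtain u where u: "0 \<le> u" "u \<le> 1" "x = (1 - u) *\<^sub>R ?p c1 + u *\<^sub>R ?p c2"
            using x by (auto simp: closed_segment_def)
          have "x = ?p ((1 - u) * c1 + u * c2)"
            unfolding u(3) by (simp add: scaleR_conv_of_real algebra_simps)
          moreover have "c1 \<le> (1 - u) * c1 + u * c2" "(1 - u) * c1 + u * c2 \<le> c2"
          proof -
            have "0 \<le> u * (c2 - c1)" "0 \<le> (1 - u) * (c2 - c1)"
              using u c by (auto intro!: mult_nonneg_nonneg)
            then show "c1 \<le> (1 - u) * c1 + u * c2" "(1 - u) * c1 + u * c2 \<le> c2"
              by (auto simp: algebra_simps)
          qed
          ultimately show ?thesis by blast
        qed
        have "norm (F \<sigma> (?p c2) - F \<sigma> (?p c1)) \<le> K * exp (- e * s) * norm (?p c2 - ?p c1)"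
        proof (rule field_differentiable_bound[of "closed_segment (?p c1) (?p c2)" "F \<sigma>" f])
          fix x assume "x \<in> closed_segment (?p c1) (?p c2)"
          then obtain c where cc: "c1 \<le> c" "c \<le> c2" "x = ?p c" using p by blast
          then have "x \<in> H \<sigma>" using leg[of c s \<sigma>] c s s0 by auto
          then show "(F \<sigma> has_field_derivative f x) (at x within closed_segment (?p c1) (?p c2))"
            by (rule has_field_derivative_at_within[OF F[OF s]])
          show "norm (f x) \<le> K * exp (- e * s)" unfolding cc(3) by (rule bd) (use cc s s0 in auto)
        qed auto
        also have "norm (?p c2 - ?p c1) = c2 - c1"
          using c by (simp flip: of_real_diff)
        finally show "norm (F \<sigma> (?p c2) - F \<sigma> (?p c1)) \<le> K * exp (- e * s) * (c2 - c1)" .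
      qed
      have "((\<lambda>s. K * exp (- e * s) * (c2 - c1)) \<longlongrightarrow> 0 * (c2 - c1)) at_top"
        by (intro tendsto_mult tendsto_const exp_decay_tendsto_0 e)
      then show "((\<lambda>s. K * exp (- e * s) * (c2 - c1)) \<longlongrightarrow> 0) at_top" by simp
    qed
    then have "L2 - L1 = 0"
      using tendsto_unique[OF _ tendsto_diff[OF L2(1) L1(1)]] by auto
    then show ?thesis using L1(2) L2(2)
      by (intro exI[of _ "L1 - F \<sigma> c1"] exI[of _ "L2 - F \<sigma> c2"]) auto
  qed
  obtain A1 A2 where A: "ray_has_integral c1 (leg a 1) f A1" "ray_has_integral c2 (leg a 1) f A2"
      "A1 - A2 = F 1 c2 - F 1 c1" using diff[of 1] by auto
  obtain B1 B2 where B: "ray_has_integral c1 (leg a (-1)) f B1" "ray_has_integral c2 (leg a (-1)) f B2"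
      "B1 - B2 = F (-1) c2 - F (-1) c1" using diff[of "-1"] by auto
  have "\<exists>k. \<forall>x\<in>H 1 \<inter> H (-1). F 1 x - F (-1) x = k"
  proof (rule has_field_derivative_zero_constant)
    show "convex (H 1 \<inter> H (-1))" by (intro convex_Int cH)
    show "((\<lambda>x. F 1 x - F (-1) x) has_field_derivative 0) (at x within H 1 \<inter> H (-1))"
      if "x \<in> H 1 \<inter> H (-1)" for x
      using that DERIV_diff[OF F[of 1 x] F[of "-1" x]] by (auto intro: has_field_derivative_at_within)
  qed
  moreover have "of_real c1 \<in> H 1 \<inter> H (-1)" "of_real c2 \<in> H 1 \<inter> H (-1)" using c by (auto simp: H_def)
  ultimately have "F 1 c1 - F (-1) c1 = F 1 c2 - F (-1) c2" by metis
  then have "(A1 - A2) - (B1 - B2) = 0" unfolding A(3) B(3) by (simp add: algebra_simps)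
  then have "A1 - B1 = A2 - B2" by (simp add: algebra_simps)
  then show ?thesis using I A(1,2) B(1,2)
    unfolding wedge_has_integral_def ray_has_integral_def by (metis has_integral_unique)
qed

section \<open>The semigroup of a sectorial pseudo-resolvent\<close>

lemma norm_exp_minus_linear_le:
  fixes u :: complex
  shows "cmod (exp u - 1 - u) \<le> (cmod u)^2 * exp (cmod u)"
proof -
  have "cmod (exp u - (\<Sum>i\<le>1. u ^ i / fact i)) \<le> exp \<bar>Re u\<bar> * (cmod u) ^ Suc 1 / fact 1"
    by (rule Taylor_exp)
  also have "\<dots> \<le> exp (cmod u) * (cmod u)^2"
    using abs_Re_le_cmod[of u] by (auto intro!: mult_right_mono simp: numeral_2_eq_2)
  finally show ?thesis by (simp add: mult.commute diff_diff_eq)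
qed

text \<open>This bound and the next one pay for a polynomial factor in \<open>l\<close> with an
  arbitrarily small share of the exponential decay along the legs.\<close>

lemma le_exp_scaled:
  assumes "e > 0" shows "(y::real) \<le> (1 / e) * exp (e * y)"
proof -
  have "e * y \<le> exp (e * y)" using exp_ge_add_one_self[of "e * y"] by linarith
  then show ?thesis using assms by (simp add: field_simps)
qed

lemma square_le_exp_scaled:
  assumes "e > 0" "y \<ge> 0" shows "(y::real)^2 \<le> (2 / e^2) * exp (e * y)"
proof -
  have "(e * y)^2 / 2 \<le> exp (e * y)"
    using exp_lower_Taylor_quadratic[of "e * y"] assms mult_nonneg_nonneg[of e y] by linarith
  then show ?thesis using assms by (simp add: field_simps)
qed

text \<open>The generator does not appear: an injective resolvent family on the wedge with the
  sectorial bound is all that the construction of the semigroup starts from.\<close>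

locale sectorial =
  fixes R :: "complex \<Rightarrow> 'x::complex_banach \<Rightarrow> 'x" and d M :: real
  assumes d: "d > 0" and M: "M > 0"
    and clinear: "l \<in> wedge_domain d \<Longrightarrow> bounded_clinear_on UNIV UNIV (R l)"
    and bound: "l \<in> wedge_domain d \<Longrightarrow> norm (R l x) \<le> M / cmod l * norm x"
    and resolvent_identity: "l \<in> wedge_domain d \<Longrightarrow> m \<in> wedge_domain d \<Longrightarrow>
      R l x - R m x = (m - l) *\<^sub>C R l (R m x)"
    and injective: "l \<in> wedge_domain d \<Longrightarrow> R l x = 0 \<Longrightarrow> x = 0"
begin

text \<open>Half of \<open>d\<close>, so that the legs of every contour lie strictly inside the
  domain of \<open>R\<close>.\<close>

definition slope where "slope = d / 2"

lemma slope: "0 < slope" "slope < d"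
  using d by (auto simp: slope_def)

abbreviation "\<Omega> \<equiv> wedge_domain d"

lemma zero_notin: "0 \<notin> \<Omega>"
  by (simp add: wedge_domain_def)

lemma pos_in: "r > 0 \<Longrightarrow> of_real r \<in> \<Omega>"
  by (simp add: wedge_domain_def)

lemma open_domain: "open \<Omega>"
  unfolding wedge_domain_def by (intro open_Collect_less continuous_intros)

lemma R_linear: "l \<in> \<Omega> \<Longrightarrow> bounded_linear (R l)"
  and R_scaleC: "l \<in> \<Omega> \<Longrightarrow> R l (c *\<^sub>C x) = c *\<^sub>C R l x"
  using clinear by (auto simp: bounded_clinear_on_UNIV_iff)

lemma R_diff: "l \<in> \<Omega> \<Longrightarrow> R l (x - y) = R l x - R l y"
  and R_add: "l \<in> \<Omega> \<Longrightarrow> R l (x + y) = R l x + R l y"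
  using R_linear by (auto simp: linear_diff linear_add bounded_linear.linear)

lemma R_commute:
  assumes "l \<in> \<Omega>" "m \<in> \<Omega>" shows "R l (R m x) = R m (R l x)"
proof (cases "l = m")
  case False
  have "(m - l) *\<^sub>C R l (R m x) = - (R m x - R l x)"
    using resolvent_identity[OF assms, of x] by simp
  also have "\<dots> = (m - l) *\<^sub>C R m (R l x)"
    using resolvent_identity[OF assms(2,1), of x]
    by (simp add: scaleC.minus_left[symmetric])
  finally show ?thesis using False by simp
qed simp

lemma R_tendsto:
  assumes u: "u \<in> \<Omega>" shows "((\<lambda>v. R v y) \<longlongrightarrow> R u y) (at u)"
proof (rule Lim_null_comparison[THEN Lim_null[THEN iffD2]])
  have "\<forall>\<^sub>F v in at u. v \<in> \<Omega>"
    using open_domain u by (rule eventually_at_in_open')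
  then show "\<forall>\<^sub>F v in at u. norm (R v y - R u y) \<le> cmod (u - v) * (M / cmod v * norm (R u y))"
  proof eventually_elim
    case (elim v)
    have "norm (R v y - R u y) = cmod (u - v) * norm (R v (R u y))"
      using elim by (simp add: resolvent_identity u norm_scaleC)
    also have "\<dots> \<le> cmod (u - v) * (M / cmod v * norm (R u y))"
      by (intro mult_left_mono bound elim) simp
    finally show ?case .
  qed
  have "u \<noteq> 0" using u zero_notin by auto
  then have "((\<lambda>v. cmod (u - v) * (M / cmod v * norm (R u y))) \<longlongrightarrow> cmod (u - u) * (M / cmod u * norm (R u y))) (at u)"
    by (intro tendsto_intros) auto
  then show "((\<lambda>v. cmod (u - v) * (M / cmod v * norm (R u y))) \<longlongrightarrow> 0) (at u)" by simp
qed

lemma R_continuous: "continuous_on \<Omega> (\<lambda>v. R v y)"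
  using R_tendsto by (auto simp: continuous_on_def intro: tendsto_within_subset)

text \<open>By the resolvent identity the difference quotient of \<open>R v x\<close> at
  \<open>u\<close> is \<open>- R v (R u x)\<close>, so the derivative is
  \<open>- R u (R u x)\<close>.\<close>

lemma R_holomorphic:
  assumes l: "bounded_clinear_on UNIV UNIV (l :: 'x \<Rightarrow> complex)"
  shows "(\<lambda>v. l (R v x)) holomorphic_on \<Omega>"
proof -
  have lin: "bounded_linear l" and lsc: "\<And>c x. l (c *\<^sub>C x) = c * l x"
    using l by (auto simp: bounded_clinear_on_UNIV_iff scaleC_complex_def)
  have "((\<lambda>v. l (R v x)) has_field_derivative - l (R u (R u x))) (at u)" if u: "u \<in> \<Omega>" for u
    unfolding has_field_derivative_iff
  proof (rule Lim_transform_eventually)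
    show "((\<lambda>v. - l (R v (R u x))) \<longlongrightarrow> - l (R u (R u x))) (at u)"
      by (intro tendsto_minus bounded_linear.tendsto[OF lin] R_tendsto u)
    have "\<forall>\<^sub>F v in at u. v \<in> \<Omega>"
      using open_domain u by (rule eventually_at_in_open')
    then show "\<forall>\<^sub>F v in at u. - l (R v (R u x)) = (l (R v x) - l (R u x)) / (v - u)"
      using eventually_neq_at_within[of u]
    proof eventually_elim
      case (elim v)
      have "l (R v x) - l (R u x) = (u - v) * l (R v (R u x))"
        using elim by (simp add: linear_diff[OF bounded_linear.linear[OF lin], symmetric]
          resolvent_identity u lsc)
      then show ?case using elim by (simp add: field_simps)
    qed
  qed
  then show ?thesis unfolding holomorphic_on_open[OF open_domain] by blast
qed

lemma on_leg: "c > 0 \<Longrightarrow> s \<ge> 0 \<Longrightarrow> \<sigma> \<in> {1, -1} \<Longrightarrow> of_real c + of_real s * leg slope \<sigma> \<in> \<Omega>"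
  using slope by (intro leg_in_wedge_domain) auto

text \<open>For the modulus \<open>n\<close>, the real part gives
  \<open>c - slope * s \<le> n\<close> and the imaginary part \<open>s \<le> n\<close>; eliminating
  \<open>s\<close> keeps the leg away from the origin in proportion to \<open>c\<close>.\<close>

lemma norm_leg_ge:
  assumes "c > 0" "s \<ge> 0" "\<sigma> \<in> {1, -1}"
  shows "c / (1 + slope) \<le> cmod (of_real c + of_real s * leg slope \<sigma>)"
proof -
  define n where "n = cmod (of_real c + of_real s * leg slope \<sigma>)"
  have "c - slope * s \<le> n"
    using complex_Re_le_cmod[of "of_real c + of_real s * leg slope \<sigma>"]
    by (simp add: leg_def mult.commute n_def)
  moreover have "s \<le> n"
    using abs_Im_le_cmod[of "of_real c + of_real s * leg slope \<sigma>"] assms by (auto simp: leg_def n_def)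
  then have "slope * s \<le> slope * n" using slope by (intro mult_left_mono) auto
  ultimately have "c \<le> (1 + slope) * n" by (simp add: algebra_simps)
  then show ?thesis using slope by (simp add: field_simps n_def)
qed

text \<open>The lower bound \<open>m\<close> makes the estimate uniform over a range of vertices, as
  the shift of the vertex in \<open>S_at\<close> requires.\<close>

lemma R_on_leg:
  assumes "0 < m" "m \<le> c" "s \<ge> 0" "\<sigma> \<in> {1, -1}"
  shows "norm (R (of_real c + of_real s * leg slope \<sigma>) x) \<le> (1 + slope) * M / m * norm x"
proof -
  let ?p = "of_real c + of_real s * leg slope \<sigma>"
  have "norm (R ?p x) \<le> M / cmod ?p * norm x"
    by (rule bound, rule on_leg) (use assms in auto)
  also have "\<dots> \<le> M / (m / (1 + slope)) * norm x"
  proof (intro mult_right_mono divide_left_mono mult_pos_pos)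
    have m: "0 < m / (1 + slope)" using assms slope by simp
    have "m / (1 + slope) \<le> c / (1 + slope)" using assms slope by (intro divide_right_mono) auto
    also have "\<dots> \<le> cmod ?p" using norm_leg_ge[of c s \<sigma>] assms by auto
    finally show le: "m / (1 + slope) \<le> cmod ?p" .
    show "0 < cmod ?p" using m le by (rule less_le_trans)
    show "0 < m / (1 + slope)" by (fact m)
  qed (use M in auto)
  finally show ?thesis by (simp add: mult.commute)
qed

lemma norm_leg_upper:
  assumes "c > 0" "s \<ge> 0" "\<sigma> \<in> {1, -1}"
  shows "cmod (of_real c + of_real s * leg slope \<sigma>) \<le> c + (1 + slope) * s"
  using norm_triangle_ineq[of "of_real c" "of_real s * leg slope \<sigma>"] assms
    mult_left_mono[OF norm_leg_le[of slope \<sigma>], of s] slope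
  by (simp add: norm_mult mult.commute)

abbreviation "kernel_bounded c K e k \<equiv> wedge_dominated slope c K e (k :: complex \<Rightarrow> complex)"

text \<open>One factor \<open>1 + slope\<close> is the speed of the legs, the other comes from their
  distance to the origin.\<close>

definition resolvent_bound where "resolvent_bound = (1 + slope) ^ 2 * M"

lemma resolvent_bound_pos: "resolvent_bound > 0"
  using slope M by (simp add: resolvent_bound_def)

text \<open>Decay rate and vertex enter the bound through the product \<open>e * c\<close>: a rate
  proportional to time and a vertex proportional to its inverse give estimates uniform in
  time.\<close>

lemma kernel_integral_exists:
  assumes c: "c > 0" and e: "e > 0" and k: "kernel_bounded c K e k"
  obtains I where "wedge_has_integral slope c (\<lambda>l. k l *\<^sub>C R l x) I"
    "norm I \<le> resolvent_bound * K / (e * c) * norm x"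
proof -
  have "wedge_dominated slope c (K * ((1 + slope) * M / c) * norm x) e (\<lambda>l. k l *\<^sub>C R l x)"
    unfolding wedge_dominated_def
  proof (intro ballI conjI allI impI)
    fix \<sigma> :: real assume s: "\<sigma> \<in> {1, -1}"
    let ?p = "\<lambda>s. of_real c + of_real s * leg slope \<sigma>"
    have "continuous_on {0<..} (\<lambda>s. R (?p s) x)"
      by (rule continuous_on_compose2[OF R_continuous]) (use on_leg c s in \<open>auto intro!: continuous_intros\<close>)
    then show "continuous_on {0<..} (\<lambda>s. k (?p s) *\<^sub>C R (?p s) x)"
      using k s unfolding wedge_dominated_def by (intro scaleC.continuous_on) auto
    fix t :: real assume t: "t > 0"
    have k': "cmod (k (?p t)) \<le> K * exp (- e * t)"
      using k s t unfolding wedge_dominated_def by blast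
    have "norm (R (?p t) x) \<le> (1 + slope) * M / c * norm x"
      using R_on_leg[OF c order_refl _ s, of t] t by simp
    from mult_mono[OF k' this] order_trans[OF norm_ge_zero k']
    show "norm (k (?p t) *\<^sub>C R (?p t) x) \<le> K * ((1 + slope) * M / c) * norm x * exp (- e * t)"
      by (simp add: norm_scaleC mult_ac)
  qed
  from wedge_has_integral_exists[OF _ e this] slope obtain I
    where I: "wedge_has_integral slope c (\<lambda>l. k l *\<^sub>C R l x) I"
      "norm I \<le> (1 + slope) * (K * ((1 + slope) * M / c) * norm x) / e" by auto
  then show ?thesis
    by (intro that[OF I(1)]) (simp add: resolvent_bound_def power2_eq_square mult_ac)
qed

section \<open>Inverse Laplace integral and its holomorphy on a sector\<close>

definition sectorW where "sectorW = {z. \<bar>Im z\<bar> < slope / 2 * Re z}"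

lemma sectorW_Re: "z \<in> sectorW \<Longrightarrow> Re z > 0"
proof -
  assume "z \<in> sectorW"
  then have "0 < slope / 2 * Re z"
    by (auto simp: sectorW_def intro: le_less_trans[OF abs_ge_zero])
  then show "Re z > 0" using slope by (simp add: zero_less_mult_iff)
qed

lemma open_sectorW: "open sectorW"
  unfolding sectorW_def by (intro open_Collect_less continuous_intros)

lemma real_in_sectorW: "t > 0 \<Longrightarrow> of_real t \<in> sectorW"
  using slope by (simp add: sectorW_def)

text \<open>Along a leg the real part of the exponent changes by
  \<open>- slope * Re z - \<sigma> * Im z\<close> per unit of \<open>s\<close>; in
  \<open>sectorW\<close> the second term uses up at most half of the first, and half remains as
  decay.\<close>

lemma exp_on_leg:
  assumes z: "z \<in> sectorW" and c: "c > 0" and s: "s \<ge> 0" "\<sigma> \<in> {1, -1}"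
  shows "cmod (exp (z * (of_real c + of_real s * leg slope \<sigma>))) \<le> exp (Re z * c) * exp (- (slope / 2 * Re z) * s)"
proof -
  have "- \<sigma> * Im z \<le> slope / 2 * Re z" using z s by (auto simp: sectorW_def)
  then have "s * (- \<sigma> * Im z) \<le> s * (slope / 2 * Re z)" using s by (intro mult_left_mono)
  then have "Re (z * (of_real c + of_real s * leg slope \<sigma>)) \<le> Re z * c + - (slope / 2 * Re z) * s"
    by (simp add: leg_def algebra_simps)
  then show ?thesis by (simp add: exp_add[symmetric])
qed

lemma kernel_boundedI:
  assumes "c > 0" "continuous_on \<Omega> k"
    and "\<And>s \<sigma>. s > 0 \<Longrightarrow> \<sigma> \<in> {1, -1} \<Longrightarrow> cmod (k (of_real c + of_real s * leg slope \<sigma>)) \<le> K * exp (- e * s)"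
  shows "kernel_bounded c K e k"
  unfolding wedge_dominated_def
proof (intro ballI conjI allI impI)
  fix \<sigma> :: real assume "\<sigma> \<in> {1, -1}"
  then show "continuous_on {0<..} (\<lambda>s. k (of_real c + of_real s * leg slope \<sigma>))"
    by (intro continuous_on_compose2[OF assms(2)]) (use on_leg assms(1) in \<open>auto intro!: continuous_intros\<close>)
qed (use assms in auto)

lemma kernel_exp:
  assumes "z \<in> sectorW" "c > 0"
  shows "kernel_bounded c (exp (Re z * c)) (slope / 2 * Re z) (\<lambda>l. exp (z * l))"
  using assms by (intro kernel_boundedI exp_on_leg continuous_intros) auto

text \<open>Inverse Laplace transform of the resolvent, the candidate for \<open>exp (z G)\<close>.
  The vertex is fixed at \<open>1\<close> here and freed in \<open>S_at\<close>; \<open>S'\<close>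
  has the formally differentiated kernel.\<close>

definition S where "S z x = (THE I. wedge_has_integral slope 1 (\<lambda>l. exp (z * l) *\<^sub>C R l x) I)"

definition S' where "S' z x = (THE I. wedge_has_integral slope 1 (\<lambda>l. (l * exp (z * l)) *\<^sub>C R l x) I)"

lemma S_at_1:
  assumes z: "z \<in> sectorW"
  shows "wedge_has_integral slope 1 (\<lambda>l. exp (z * l) *\<^sub>C R l x) (S z x)"
proof -
  have "slope / 2 * Re z > 0" using slope sectorW_Re[OF z] by simp
  then obtain I where "wedge_has_integral slope 1 (\<lambda>l. exp (z * l) *\<^sub>C R l x) I"
    using kernel_integral_exists[OF zero_less_one _ kernel_exp[OF z zero_less_one]] by blast
  then show ?thesis unfolding S_def by (metis theI wedge_has_integral_unique)
qed

lemma S_at: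
  assumes z: "z \<in> sectorW" and c: "c > 0"
  shows "wedge_has_integral slope c (\<lambda>l. exp (z * l) *\<^sub>C R l x) (S z x)"
proof -
  define e where "e = slope / 2 * Re z"
  have e: "e > 0" using slope sectorW_Re[OF z] by (simp add: e_def)
  obtain I where I: "wedge_has_integral slope c (\<lambda>l. exp (z * l) *\<^sub>C R l x) I"
    using kernel_integral_exists[OF c _ kernel_exp[OF z c]] e unfolding e_def by blast
  have "I = S z x"
  proof (rule functional_separates)
    fix \<phi> :: "'x \<Rightarrow> complex" assume \<phi>: "bounded_clinear_on UNIV UNIV \<phi>"
    define f where "f l = exp (z * l) * \<phi> (R l x)" for l
    have "(\<lambda>l. \<phi> (exp (z * l) *\<^sub>C R l x)) = f"
      using \<phi> by (auto simp: bounded_clinear_on_UNIV_iff scaleC_complex_def f_def)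
    then have J: "wedge_has_integral slope c f (\<phi> I)" "wedge_has_integral slope 1 f (\<phi> (S z x))"
      using wedge_has_integral_clinear[OF I \<phi>] wedge_has_integral_clinear[OF S_at_1[OF z] \<phi>] by auto
    have hol: "f holomorphic_on \<Omega>"
      unfolding f_def by (intro holomorphic_intros R_holomorphic \<phi>)
    obtain B where B: "\<And>x. cmod (\<phi> x) \<le> norm x * B" "B > 0"
      using \<phi> bounded_linear.pos_bounded unfolding bounded_clinear_on_UNIV_iff by blast
    \<comment> \<open>The two vertices are put in order, as the scalar lemma is stated for
      \<open>c1 \<le> c2\<close>.\<close>
    define m where "m = min c 1"
    define n where "n = max c 1"
    have mn: "0 < m" "m \<le> n" using c by (auto simp: m_def n_def)
    have bd: "cmod (f (of_real r + of_real s * leg slope \<sigma>)) \<le>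
        exp (Re z * n) * ((1 + slope) * M / m * norm x * B) * exp (- e * s)"
      if r: "m \<le> r" "r \<le> n" "s > 0" "\<sigma> \<in> {1, -1}" for r s \<sigma>
    proof -
      let ?p = "of_real r + of_real s * leg slope \<sigma>"
      have r0: "r > 0" using r mn by simp
      have "norm (R ?p x) \<le> (1 + slope) * M / m * norm x"
        using R_on_leg[OF mn(1) r(1) _ r(4)] r by simp
      then have 1: "cmod (\<phi> (R ?p x)) \<le> (1 + slope) * M / m * norm x * B"
        using B(1)[of "R ?p x"] mult_right_mono[of _ _ B] B(2) by (meson less_imp_le order_trans)
      have "cmod (exp (z * ?p)) \<le> exp (Re z * r) * exp (- e * s)"
        unfolding e_def by (rule exp_on_leg) (use z r0 r in auto)
      also have "\<dots> \<le> exp (Re z * n) * exp (- e * s)"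
        using r sectorW_Re[OF z] by (intro mult_right_mono) (auto intro!: mult_left_mono)
      finally have "cmod (exp (z * ?p)) \<le> exp (Re z * n) * exp (- e * s)" .
      from mult_mono[OF this 1] show ?thesis by (simp add: f_def norm_mult mult_ac)
    qed
    have "\<phi> I' = \<phi> I''"
      if "wedge_has_integral slope m f (\<phi> I')" "wedge_has_integral slope n f (\<phi> I'')" for I' I''
      using wedge_integral_vertex_independent[OF slope mn hol e bd that] by blast
    then show "\<phi> I = \<phi> (S z x)"
      using J by (cases "c \<le> 1") (auto simp: m_def n_def min_def max_def dest!: sym)
  qed
  with I show ?thesis by simp
qed

end

lemma wedge_has_integral_diff:
  fixes f g :: "complex \<Rightarrow> 'x::complex_banach"
  assumes f: "wedge_has_integral a c f I" and g: "wedge_has_integral a c g I'"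
  shows "wedge_has_integral a c (\<lambda>l. f l - g l) (I - I')"
proof -
  have m: "(- 1) *\<^sub>C x = - x" for x :: 'x
    using complex_vector.scale_minus_left[of 1 x] by simp
  show ?thesis
    using wedge_has_integral_add[OF f wedge_has_integral_clinear[OF g bounded_clinear_scaleC[of "-1"]]]
    by (simp add: m)
qed

context sectorial
begin

lemma kernel_operator:
  assumes c: "c > 0" and e: "e > 0" and k: "kernel_bounded c K e k"
    and P: "\<And>x. wedge_has_integral slope c (\<lambda>l. k l *\<^sub>C R l x) (P x)"
  shows "bounded_clinear_on UNIV UNIV P" "norm (P x) \<le> resolvent_bound * K / (e * c) * norm x"
proof -
  show b: "norm (P x) \<le> resolvent_bound * K / (e * c) * norm x" for x
    using kernel_integral_exists[OF c e k, of x] P[of x] wedge_has_integral_unique by metis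
  have on: "of_real c + of_real s * leg slope \<sigma> \<in> \<Omega>" if "s > 0" "\<sigma> \<in> {1, -1}" for s \<sigma>
    using on_leg c that by auto
  show "bounded_clinear_on UNIV UNIV P"
  proof (rule bounded_clinear_onI)
    show "P (x + y) = P x + P y" for x y
      by (rule wedge_has_integral_unique[OF P],
          rule wedge_has_integral_cong[OF wedge_has_integral_add[OF P P]])
        (simp add: R_add on scaleC_add_right)
    show "P (\<alpha> *\<^sub>C x) = \<alpha> *\<^sub>C P x" for \<alpha> x
      by (rule wedge_has_integral_unique[OF P],
          rule wedge_has_integral_cong[OF wedge_has_integral_clinear[OF P bounded_clinear_scaleC]])
        (simp add: R_scaleC on scaleC_scaleC mult.commute)
  qed (rule b)
qed

definition S_const where "S_const = resolvent_bound * exp 1 / (slope / 2)"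

lemma S_const_pos: "S_const > 0"
  using resolvent_bound_pos slope by (simp add: S_const_def)

text \<open>With the vertex at \<open>1 / Re z\<close>, the factor \<open>exp (Re z * c)\<close>
  becomes \<open>exp 1\<close> and the product of decay rate and vertex becomes
  \<open>slope / 2\<close>, so one constant serves for all \<open>z\<close> in the sector.\<close>

lemma S_clinear: "z \<in> sectorW \<Longrightarrow> bounded_clinear_on UNIV UNIV (S z)"
  and S_bound: "z \<in> sectorW \<Longrightarrow> norm (S z x) \<le> S_const * norm x"
proof -
  assume z: "z \<in> sectorW"
  have r: "Re z > 0" by (rule sectorW_Re[OF z])
  define c where "c = 1 / Re z"
  have c: "c > 0" and e: "slope / 2 * Re z > 0" using r slope by (auto simp: c_def)
  note op = kernel_operator[OF c e kernel_exp[OF z c] S_at[OF z c]]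
  show "bounded_clinear_on UNIV UNIV (S z)" by (rule op)
  have "resolvent_bound * exp (Re z * c) / (slope / 2 * Re z * c) = S_const"
    using r by (simp add: c_def S_const_def)
  then show "norm (S z x) \<le> S_const * norm x" using op(2)[of x] by simp
qed

lemma kernel_exp_times:
  assumes z: "z \<in> sectorW"
  obtains K e where "e > 0" "kernel_bounded 1 K e (\<lambda>l. l * exp (z * l))"
proof
  define e where "e = slope / 2 * Re z"
  \<comment> \<open>Chosen so that the growth \<open>exp (\<eta> * (1 + slope) * s)\<close>, which
    pays for the factor \<open>l\<close>, consumes half of the decay \<open>e\<close>.\<close>
  define \<eta> where "\<eta> = e / (2 * (1 + slope))"
  have e: "e > 0" using sectorW_Re[OF z] slope by (simp add: e_def)
  have \<eta>: "\<eta> > 0" "\<eta> * (1 + slope) = e / 2" using e slope by (auto simp: \<eta>_def field_simps)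
  show "e / 2 > 0" using e by simp
  show "kernel_bounded 1 (1 / \<eta> * exp \<eta> * exp (Re z)) (e / 2) (\<lambda>l. l * exp (z * l))"
  proof (rule kernel_boundedI)
    fix s \<sigma> :: real assume s: "s > 0" "\<sigma> \<in> {1, -1}"
    let ?p = "of_real 1 + of_real s * leg slope \<sigma>"
    have "cmod ?p \<le> 1 / \<eta> * exp (\<eta> * cmod ?p)" by (rule le_exp_scaled) fact
    also have "\<dots> \<le> 1 / \<eta> * exp (\<eta> * (1 + (1 + slope) * s))"
      using norm_leg_upper[of 1 s \<sigma>] s \<eta> by (intro mult_left_mono) auto
    also have "\<dots> = 1 / \<eta> * exp (\<eta> + e / 2 * s)"
      by (simp only: \<eta>(2)[symmetric]) (simp add: algebra_simps)
    finally have 1: "cmod ?p \<le> 1 / \<eta> * exp (\<eta> + e / 2 * s)" .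
    have 2: "cmod (exp (z * ?p)) \<le> exp (Re z * 1) * exp (- e * s)"
      unfolding e_def by (rule exp_on_leg) (use z s in auto)
    have "cmod (?p * exp (z * ?p)) \<le> (1 / \<eta> * exp (\<eta> + e / 2 * s)) * (exp (Re z * 1) * exp (- e * s))"
      unfolding norm_mult by (intro mult_mono 1 2) (use \<eta> in auto)
    also have "\<dots> = 1 / \<eta> * exp \<eta> * exp (Re z) * exp (- (e / 2) * s)"
      by (simp add: exp_add[symmetric] field_simps)
    finally show "cmod (?p * exp (z * ?p)) \<le> 1 / \<eta> * exp \<eta> * exp (Re z) * exp (- (e / 2) * s)" .
  qed (auto intro!: continuous_intros)
qed

lemma S'_at:
  assumes z: "z \<in> sectorW"
  shows "wedge_has_integral slope 1 (\<lambda>l. (l * exp (z * l)) *\<^sub>C R l x) (S' z x)"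
proof -
  obtain K e where "e > 0" "kernel_bounded 1 K e (\<lambda>l. l * exp (z * l))"
    using kernel_exp_times[OF z] by blast
  then obtain I where "wedge_has_integral slope 1 (\<lambda>l. (l * exp (z * l)) *\<^sub>C R l x) I"
    using kernel_integral_exists[OF zero_less_one] by blast
  then show ?thesis unfolding S'_def by (metis theI wedge_has_integral_unique)
qed

lemma S'_clinear: "z \<in> sectorW \<Longrightarrow> bounded_clinear_on UNIV UNIV (S' z)"
proof -
  assume z: "z \<in> sectorW"
  obtain K e where "e > 0" "kernel_bounded 1 K e (\<lambda>l. l * exp (z * l))"
    using kernel_exp_times[OF z] by blast
  from kernel_operator(1)[OF zero_less_one this S'_at[OF z]] show ?thesis .
qed

text \<open>A remainder quadratic in \<open>h\<close> and linear in \<open>norm x\<close> gives the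
  derivative in operator norm. It is the integral of the kernel
  \<open>exp (z l) (exp (h l) - 1 - h l)\<close>.\<close>

lemma S_taylor:
  assumes z: "z \<in> sectorW"
  shows "\<exists>\<eta>>0. \<exists>C>0. \<forall>h x. cmod h \<le> \<eta> \<longrightarrow> z + h \<in> sectorW \<longrightarrow>
    norm (S (z + h) x - S z x - h *\<^sub>C S' z x) \<le> C * (cmod h)^2 * norm x"
proof -
  define e where "e = slope / 2 * Re z"
  \<comment> \<open>The square of \<open>l\<close> and the factor \<open>exp (cmod (h * l))\<close>
    each cost \<open>exp (\<eta> * cmod l)\<close>; with a quarter of \<open>e\<close> for each,
    half of the decay survives.\<close>
  define \<eta> where "\<eta> = e / (4 * (1 + slope))"
  have e: "e > 0" using sectorW_Re[OF z] slope by (simp add: e_def)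
  have \<eta>: "\<eta> > 0" "2 * \<eta> * (1 + slope) = e / 2" using e slope by (auto simp: \<eta>_def field_simps)
  define K where "K = 2 / \<eta>^2 * exp (2 * \<eta>) * exp (Re z)"
  have K: "K > 0" using \<eta> by (simp add: K_def)
  have "norm (S (z + h) x - S z x - h *\<^sub>C S' z x) \<le> (resolvent_bound * K / (e / 2)) * (cmod h)^2 * norm x"
    if h: "cmod h \<le> \<eta>" "z + h \<in> sectorW" for h x
  proof -
    define k where "k l = exp ((z + h) * l) - exp (z * l) - h * (l * exp (z * l))" for l
    have k_eq: "k l = exp (z * l) * (exp (h * l) - 1 - h * l)" for l
      by (simp add: k_def ring_distribs exp_add)
    have P: "wedge_has_integral slope 1 (\<lambda>l. k l *\<^sub>C R l x) (S (z + h) x - S z x - h *\<^sub>C S' z x)" for x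
      using wedge_has_integral_diff[OF wedge_has_integral_diff[OF S_at_1[OF h(2), of x] S_at_1[OF z, of x]]
          wedge_has_integral_clinear[OF S'_at[OF z, of x] bounded_clinear_scaleC[of h]]]
      by (simp add: k_def complex_vector.scale_left_diff_distrib scaleC_scaleC)
    have "kernel_bounded 1 (K * (cmod h)^2) (e / 2) k"
    proof (rule kernel_boundedI)
      show "continuous_on \<Omega> k" unfolding k_def by (intro continuous_intros)
      fix s \<sigma> :: real assume s: "s > 0" "\<sigma> \<in> {1, -1}"
      let ?p = "of_real 1 + of_real s * leg slope \<sigma>"
      have "cmod (exp (h * ?p) - 1 - h * ?p) \<le> (cmod (h * ?p))^2 * exp (cmod (h * ?p))"
        by (rule norm_exp_minus_linear_le)
      also have "\<dots> = (cmod h)^2 * ((cmod ?p)^2 * exp (cmod h * cmod ?p))"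
        by (simp add: norm_mult power_mult_distrib)
      also have "\<dots> \<le> (cmod h)^2 * ((2 / \<eta>^2 * exp (\<eta> * cmod ?p)) * exp (\<eta> * cmod ?p))"
        using \<eta> h by (intro mult_left_mono mult_mono square_le_exp_scaled) (auto intro!: mult_right_mono)
      also have "\<dots> = (cmod h)^2 * (2 / \<eta>^2 * exp (2 * \<eta> * cmod ?p))"
        by (simp add: exp_add[symmetric])
      also have "\<dots> \<le> (cmod h)^2 * (2 / \<eta>^2 * exp (2 * \<eta> * (1 + (1 + slope) * s)))"
        using norm_leg_upper[of 1 s \<sigma>] s \<eta> by (intro mult_left_mono) auto
      also have "2 * \<eta> * (1 + (1 + slope) * s) = 2 * \<eta> + e / 2 * s"
        by (simp only: \<eta>(2)[symmetric]) (simp add: algebra_simps)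
      finally have 1: "cmod (exp (h * ?p) - 1 - h * ?p) \<le> (cmod h)^2 * (2 / \<eta>^2 * exp (2 * \<eta> + e / 2 * s))" .
      have 2: "cmod (exp (z * ?p)) \<le> exp (Re z * 1) * exp (- e * s)"
        unfolding e_def by (rule exp_on_leg) (use z s in auto)
      have "cmod (k ?p) \<le> (exp (Re z * 1) * exp (- e * s)) * ((cmod h)^2 * (2 / \<eta>^2 * exp (2 * \<eta> + e / 2 * s)))"
        unfolding k_eq norm_mult by (intro mult_mono 1 2) auto
      also have "\<dots> = 2 / \<eta>^2 * (cmod h)^2 * (exp (Re z * 1) * exp (- e * s) * exp (2 * \<eta> + e / 2 * s))"
        by (simp only: mult_ac)
      also have "exp (Re z * 1) * exp (- e * s) * exp (2 * \<eta> + e / 2 * s) =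
          exp (2 * \<eta>) * exp (Re z) * exp (- (e / 2) * s)"
        by (simp add: exp_add[symmetric])
      finally show "cmod (k ?p) \<le> K * (cmod h)^2 * exp (- (e / 2) * s)"
        by (simp add: K_def mult_ac)
    qed simp
    from kernel_operator(2)[OF zero_less_one _ this P, of x] e show ?thesis
      by (simp add: mult_ac)
  qed
  then show ?thesis using \<eta>(1) K resolvent_bound_pos e
    by (intro exI[of _ \<eta>] exI[of _ "resolvent_bound * K / (e / 2)"] conjI) auto
qed

lemma S_operator_holomorphic: "operator_holomorphic_on UNIV S sectorW"
  unfolding operator_holomorphic_on_def
proof (intro conjI ballI)
  fix z assume z: "z \<in> sectorW"
  show "bounded_clinear_on UNIV UNIV (S z)" by (rule S_clinear[OF z])
  obtain \<eta> C where C: "\<eta> > 0" "C > 0" "\<And>h x. cmod h \<le> \<eta> \<Longrightarrow> z + h \<in> sectorW \<Longrightarrow>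
    norm (S (z + h) x - S z x - h *\<^sub>C S' z x) \<le> C * (cmod h)^2 * norm x"
    using S_taylor[OF z] by blast
  have "((\<lambda>w. onorm_on UNIV (\<lambda>x. inverse (w - z) *\<^sub>C (S w x - S z x) - S' z x)) \<longlongrightarrow> 0) (at z)"
  proof (rule Lim_null_comparison)
    have "\<forall>\<^sub>F w in at z. w \<in> sectorW"
      using open_sectorW z by (rule eventually_at_in_open')
    moreover have "\<forall>\<^sub>F w in at z. w \<in> ball z \<eta>"
      using C(1) by (intro eventually_at_in_open') auto
    moreover have "\<forall>\<^sub>F w in at z. w \<noteq> z" by (rule eventually_neq_at_within)
    ultimately show "\<forall>\<^sub>F w in at z. norm (onorm_on UNIV (\<lambda>x. inverse (w - z) *\<^sub>C (S w x - S z x) - S' z x))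
        \<le> C * cmod (w - z)"
    proof eventually_elim
      case (elim w)
      define Q where "Q x = inverse (w - z) *\<^sub>C (S w x - S z x) - S' z x" for x
      have lin: "S w (x + y) = S w x + S w y" "S z (x + y) = S z x + S z y" "S' z (x + y) = S' z x + S' z y"
        "S w (c *\<^sub>C x) = c *\<^sub>C S w x" "S z (c *\<^sub>C x) = c *\<^sub>C S z x" "S' z (c *\<^sub>C x) = c *\<^sub>C S' z x" for x y c
        using S_clinear[OF elim(1)] S_clinear[OF z] S'_clinear[OF z]
        by (auto simp: bounded_clinear_on_def clinear_on_def)
      have bd: "norm (Q x) \<le> C * cmod (w - z) * norm x" for x
      proof -
        have "Q x = inverse (w - z) *\<^sub>C (S (z + (w - z)) x - S z x - (w - z) *\<^sub>C S' z x)"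
          using elim(3) by (simp add: Q_def scaleC.diff_right scaleC_scaleC)
        then have "norm (Q x) = inverse (cmod (w - z)) * norm (S (z + (w - z)) x - S z x - (w - z) *\<^sub>C S' z x)"
          by (simp add: norm_scaleC norm_inverse)
        also have "\<dots> \<le> inverse (cmod (w - z)) * (C * (cmod (w - z))^2 * norm x)"
          using C(3)[of "w - z" x] elim by (intro mult_left_mono) (auto simp: dist_norm norm_minus_commute)
        also have "\<dots> = C * cmod (w - z) * norm x" using elim(3) by (simp add: power2_eq_square)
        finally show ?thesis .
      qed
      have Q: "bounded_clinear_on UNIV UNIV Q"
        by (rule bounded_clinear_onI[OF _ _ bd])
          (simp_all add: Q_def lin scaleC.diff_right scaleC_add_right scaleC_scaleC mult.commute)
      have "onorm_on UNIV Q \<le> C * cmod (w - z)"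
        using bd C(2) by (intro onorm_on_le) auto
      with onorm_on_nonneg[OF Q] show ?case unfolding Q_def by simp
    qed
    have "((\<lambda>w. C * cmod (w - z)) \<longlongrightarrow> C * cmod (z - z)) (at z)" by (intro tendsto_intros)
    then show "((\<lambda>w. C * cmod (w - z)) \<longlongrightarrow> 0) (at z)" by simp
  qed
  then show "\<exists>L. bounded_clinear_on UNIV UNIV L \<and>
      ((\<lambda>w. onorm_on UNIV (\<lambda>x. inverse (w - z) *\<^sub>C (S w x - S z x) - L x)) \<longlongrightarrow> 0) (at z)"
    using S'_clinear[OF z] by blast
qed

text \<open>The primitive \<open>exp (z l) / z\<close> vanishes at infinity along both legs, so each
  ray contributes the same value at the vertex and the difference is zero.\<close>

lemma wedge_integral_exp_0:
  assumes z: "z \<in> sectorW"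
  shows "wedge_has_integral slope 1 (\<lambda>l. exp (z * l)) 0"
proof -
  define e where "e = slope / 2 * Re z"
  have e: "e > 0" and z0: "z \<noteq> 0" using sectorW_Re[OF z] slope by (auto simp: e_def)
  have "ray_has_integral 1 (leg slope \<sigma>) (\<lambda>l. exp (z * l)) (- exp z / z)" if s: "\<sigma> \<in> {1, -1}" for \<sigma>
  proof -
    have b: "cmod (exp (z * (1 + of_real s * leg slope \<sigma>))) \<le> exp (Re z) * exp (- e * s)" if "s > 0" for s
      using exp_on_leg[OF z zero_less_one _ s, of s] that by (simp add: e_def)
    obtain L where L: "((\<lambda>s. exp (z * (1 + of_real s * leg slope \<sigma>)) / z) \<longlongrightarrow> L) at_top"
      "ray_has_integral 1 (leg slope \<sigma>) (\<lambda>l. exp (z * l)) (L - exp (z * 1) / z)"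
      by (rule primitive_ray_limit[of UNIV 1 "leg slope \<sigma>" "\<lambda>l. exp (z * l) / z" "\<lambda>l. exp (z * l)" e])
        (use z0 e b in \<open>auto intro!: derivative_eq_intros\<close>)
    have "((\<lambda>s. exp (z * (1 + of_real s * leg slope \<sigma>)) / z) \<longlongrightarrow> 0) at_top"
    proof (rule Lim_null_comparison)
      show "\<forall>\<^sub>F s in at_top. norm (exp (z * (1 + of_real s * leg slope \<sigma>)) / z)
          \<le> exp (Re z) / cmod z * exp (- e * s)"
        using eventually_gt_at_top[of 0]
      proof eventually_elim
        case (elim s)
        then show ?case using divide_right_mono[OF b[OF elim], of "cmod z"] by (simp add: norm_divide)
      qed
    qed (rule exp_decay_tendsto_0[OF e])
    with L show ?thesis using tendsto_unique[OF _ L(1)] by fastforce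
  qed
  then have "ray_has_integral 1 (leg slope 1) (\<lambda>l. exp (z * l)) (- exp z / z)"
    "ray_has_integral 1 (leg slope (-1)) (\<lambda>l. exp (z * l)) (- exp z / z)" by auto
  then show ?thesis unfolding wedge_has_integral_def by force
qed

section \<open>Evolution equation in resolvent form\<close>

lemma R_S:
  assumes z: "z \<in> sectorW" and m: "m \<in> \<Omega>"
  shows "R m (S z x) = S z (R m x)"
proof (rule wedge_has_integral_unique)
  show "wedge_has_integral slope 1 (\<lambda>l. exp (z * l) *\<^sub>C R l (R m x)) (S z (R m x))"
    by (rule S_at_1[OF z])
  show "wedge_has_integral slope 1 (\<lambda>l. exp (z * l) *\<^sub>C R l (R m x)) (R m (S z x))"
  proof (rule wedge_has_integral_cong[OF wedge_has_integral_clinear[OF S_at_1[OF z] clinear[OF m]]])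
    fix s \<sigma> :: real assume "s > 0" "\<sigma> \<in> {1, -1}"
    then have "of_real 1 + of_real s * leg slope \<sigma> \<in> \<Omega>" by (intro on_leg) auto
    then show "R m (exp (z * (of_real 1 + of_real s * leg slope \<sigma>)) *\<^sub>C R (of_real 1 + of_real s * leg slope \<sigma>) x) =
        exp (z * (of_real 1 + of_real s * leg slope \<sigma>)) *\<^sub>C R (of_real 1 + of_real s * leg slope \<sigma>) (R m x)"
      by (simp add: R_scaleC m R_commute)
  qed
qed

text \<open>Under the integral, \<open>l R(m) R(l) = m R(m) R(l) - R(l) + R(m)\<close>, and the term without
  \<open>R(l)\<close> integrates to zero: this is the evolution equation \<open>S' = G S\<close> in resolvent form.\<close>
lemma R_S':
  assumes z: "z \<in> sectorW" and m: "m \<in> \<Omega>"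
  shows "R m (S' z x) = m *\<^sub>C R m (S z x) - S z x"
proof (rule wedge_has_integral_unique)
  show "wedge_has_integral slope 1 (\<lambda>l. R m ((l * exp (z * l)) *\<^sub>C R l x)) (R m (S' z x))"
    by (rule wedge_has_integral_clinear[OF S'_at[OF z] clinear[OF m]])
  have *: "wedge_has_integral slope 1 (\<lambda>l. m *\<^sub>C R m (exp (z * l) *\<^sub>C R l x) - exp (z * l) *\<^sub>C R l x
      + exp (z * l) *\<^sub>C R m x) (m *\<^sub>C R m (S z x) - S z x + 0 *\<^sub>C R m x)"
    by (intro wedge_has_integral_add wedge_has_integral_diff S_at_1[OF z]
        wedge_has_integral_clinear[OF _ bounded_clinear_scaleC] wedge_has_integral_clinear[OF _ clinear[OF m]]
        wedge_has_integral_clinear[OF wedge_integral_exp_0[OF z] bounded_clinear_scaleC_left])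
  have "wedge_has_integral slope 1 (\<lambda>l. R m ((l * exp (z * l)) *\<^sub>C R l x))
      (m *\<^sub>C R m (S z x) - S z x + 0 *\<^sub>C R m x)"
  proof (rule wedge_has_integral_cong[OF *])
    fix s \<sigma> :: real assume "s > 0" "\<sigma> \<in> {1, -1}"
    define l where "l = of_real 1 + of_real s * leg slope \<sigma>"
    have l: "l \<in> \<Omega>" unfolding l_def by (rule on_leg) (use \<open>s > 0\<close> \<open>\<sigma> \<in> {1, -1}\<close> in auto)
    have "(l - m) *\<^sub>C R m (R l x) = R m x - R l x"
      using resolvent_identity[OF m l, of x] by simp
    then have "l *\<^sub>C R m (R l x) = m *\<^sub>C R m (R l x) - R l x + R m x"
      by (simp add: scaleC.diff_left algebra_simps)
    then have "exp (z * l) *\<^sub>C l *\<^sub>C R m (R l x) = exp (z * l) *\<^sub>C (m *\<^sub>C R m (R l x) - R l x + R m x)" by simp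
    then show "m *\<^sub>C R m (exp (z * l) *\<^sub>C R l x) - exp (z * l) *\<^sub>C R l x + exp (z * l) *\<^sub>C R m x =
        R m ((l * exp (z * l)) *\<^sub>C R l x)"
      by (simp add: R_scaleC m scaleC_add_right scaleC.diff_right scaleC_scaleC mult.commute)
  qed
  then show "wedge_has_integral slope 1 (\<lambda>l. R m ((l * exp (z * l)) *\<^sub>C R l x))
      (m *\<^sub>C R m (S z x) - S z x)" by simp
qed

text \<open>The evolution equation solved for \<open>S z x\<close>. The range of \<open>R m\<close>
  will be the domain of the generator, so \<open>S\<close> maps the whole space into that domain and
  preserves its closure.\<close>

lemma S_in_range:
  assumes z: "z \<in> sectorW" and m: "m \<in> \<Omega>"
  shows "S z x \<in> range (R m)"
proof -
  have "S z x = R m (m *\<^sub>C S z x - S' z x)"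
    by (simp add: R_diff m R_scaleC R_S'[OF z m])
  then show ?thesis by blast
qed

end

lemma has_vector_derivative_quadratic:
  fixes f :: "real \<Rightarrow> 'a::real_normed_vector"
  assumes "\<eta> > 0" and le: "\<And>h. \<bar>h\<bar> \<le> \<eta> \<Longrightarrow> norm (f (t + h) - f t - h *\<^sub>R D) \<le> C * h^2"
  shows "(f has_vector_derivative D) (at t)"
  unfolding has_vector_derivative_def has_derivative_at
proof
  show "(\<lambda>h. norm (f (t + h) - f t - h *\<^sub>R D) / norm h) \<midarrow>0\<rightarrow> 0"
  proof (rule Lim_null_comparison)
    have "\<forall>\<^sub>F h in at 0. h \<in> ball 0 \<eta>"
      using assms(1) by (intro eventually_at_in_open') auto
    then show "\<forall>\<^sub>F h in at 0. norm (norm (f (t + h) - f t - h *\<^sub>R D) / norm h) \<le> C * \<bar>h\<bar>"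
      using eventually_neq_at_within[of 0]
    proof eventually_elim
      case (elim h)
      then show ?case using le[of h] by (simp add: field_simps power2_eq_square abs_mult_self_eq)
    qed
    have "(\<lambda>h. C * \<bar>h\<bar>) \<midarrow>0\<rightarrow> C * \<bar>0\<bar>" by (intro tendsto_intros)
    then show "(\<lambda>h. C * \<bar>h\<bar>) \<midarrow>0\<rightarrow> 0" by simp
  qed
qed (rule bounded_linear_scaleR_left)

text \<open>The singularity at \<open>0\<close> is removable, so the quotient extends to an entire
  function with a primitive; adding a logarithm turns it into a primitive of
  \<open>exp (t l) / l\<close> on a slit plane.\<close>

lemma primitive_exp_minus_1_over:
  fixes t :: complex
  shows "\<exists>E. \<forall>l. l \<noteq> 0 \<longrightarrow> (E has_field_derivative (exp (t * l) - 1) / l) (at l)"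
proof -
  define g where "g l = (if l = 0 then t else (exp (t * l) - 1) / l)" for l
  have d: "(g has_field_derivative ((t * exp (t * l)) * l - (exp (t * l) - 1)) / (l * l)) (at l)"
    if "l \<noteq> 0" for l
  proof -
    have "((\<lambda>l. (exp (t * l) - 1) / l) has_field_derivative
        ((t * exp (t * l)) * l - (exp (t * l) - 1)) / (l * l)) (at l)"
      using that by (auto intro!: derivative_eq_intros)
    then show ?thesis
      by (rule has_field_derivative_transform_within_open[of _ _ _ "- {0}"])
        (use that in \<open>auto simp: g_def\<close>)
  qed
  have "((\<lambda>l. exp (t * l)) has_field_derivative t) (at 0)"
    by (auto intro!: derivative_eq_intros)
  then have "((\<lambda>l. (exp (t * l) - 1) / l) \<longlongrightarrow> t) (at 0)"
    by (simp add: has_field_derivative_iff)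
  then have "(g \<longlongrightarrow> t) (at 0)"
    by (rule Lim_transform_eventually) (auto simp: g_def eventually_at_filter)
  then have "(g \<longlongrightarrow> g 0) (at 0)" by (simp add: g_def)
  then have "isCont g l" for l
    using d[of l] DERIV_isCont by (cases "l = 0") (auto simp: isCont_def)
  then have "continuous_on UNIV g" by (simp add: continuous_on_eq_continuous_at)
  moreover have "g field_differentiable at l" if "l \<in> interior UNIV - {0}" for l
    using d[of l] that by (auto simp: field_differentiable_def)
  \<comment> \<open>\<open>0\<close> is listed as an exceptional point, at which continuity of
    \<open>g\<close> suffices.\<close>
  ultimately obtain E where "\<And>l. l \<in> UNIV \<Longrightarrow> (E has_field_derivative g l) (at l)"
    using holomorphic_convex_primitive[of UNIV "{0}" g] by auto
  then have "(E has_field_derivative (exp (t * l) - 1) / l) (at l)" if "l \<noteq> 0" for l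
    using that by (metis UNIV_I g_def)
  then show ?thesis by blast
qed

context sectorial
begin

text \<open>On the right the primitive of \<open>exp (t l) / l\<close> is \<open>E + Ln\<close>, far to the left it is
  \<open>E + Ln \<circ> uminus\<close>; the jump of the logarithm across the two legs gives \<open>2 pi i\<close>.\<close>
lemma wedge_integral_exp_over:
  fixes t c :: real
  assumes t: "t > 0" and c: "c > 0"
  shows "wedge_has_integral slope c (\<lambda>l. exp (of_real t * l) / l) 1"
proof -
  from primitive_exp_minus_1_over[of "of_real t"] obtain E where
    "\<forall>l::complex. l \<noteq> 0 \<longrightarrow> (E has_field_derivative (exp (t * l) - 1) / l) (at l)" ..
  then have E: "\<And>l::complex. l \<noteq> 0 \<Longrightarrow> (E has_field_derivative (exp (t * l) - 1) / l) (at l)" by simp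
  define F where "F l = E l + Ln l" for l :: complex
  define G where "G l = E l + Ln (- l)" for l :: complex
  have F: "(F has_field_derivative exp (of_real t * l) / l) (at l)" if "l \<in> - \<real>\<^sub>\<le>\<^sub>0" for l :: complex
  proof -
    have l: "l \<notin> \<real>\<^sub>\<le>\<^sub>0" "l \<noteq> 0" using that by auto
    have "(F has_field_derivative (exp (t * l) - 1) / l + inverse l) (at l)"
      unfolding F_def by (intro DERIV_add E has_field_derivative_Ln l)
    then show ?thesis using l by (simp add: field_simps)
  qed
  have G: "(G has_field_derivative exp (of_real t * l) / l) (at l)" if "Re l < 0" for l :: complex
  proof -
    have l: "- l \<notin> \<real>\<^sub>\<le>\<^sub>0" "l \<noteq> 0" using that by (auto simp: complex_nonpos_Reals_iff)
    have "((\<lambda>l. Ln (- l)) has_field_derivative inverse (- l) * (- 1)) (at l)"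
      by (rule DERIV_chain2[where f = Ln and g = uminus])
        (auto intro!: derivative_eq_intros has_field_derivative_Ln l)
    then have "(G has_field_derivative (exp (t * l) - 1) / l + inverse (- l) * (- 1)) (at l)"
      unfolding G_def by (intro DERIV_add E l)
    then show ?thesis using l by (simp add: field_simps)
  qed
  let ?p = "\<lambda>\<sigma> s. of_real c + of_real s * leg slope \<sigma>"
  define e where "e = slope / 2 * t"
  have e: "e > 0" using slope t by (simp add: e_def)
  have ray: "\<exists>L. ((\<lambda>s. F (?p \<sigma> s)) \<longlongrightarrow> L) at_top \<and>
      ray_has_integral c (leg slope \<sigma>) (\<lambda>l. exp (of_real t * l) / l) (L - F c)" if s: "\<sigma> \<in> {1, -1}" for \<sigma>
  proof -
    have b: "cmod (exp (t * ?p \<sigma> s) / ?p \<sigma> s) \<le> exp (t * c) / (c / (1 + slope)) * exp (- e * s)"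
      if "s > 0" for s
    proof -
      have "cmod (exp (t * ?p \<sigma> s)) \<le> exp (t * c) * exp (- e * s)"
        using exp_on_leg[OF real_in_sectorW[OF t] c _ s, of s] that by (simp add: e_def)
      moreover have "c / (1 + slope) \<le> cmod (?p \<sigma> s)"
        using norm_leg_ge[OF c _ s, of s] that by simp
      ultimately have "cmod (exp (t * ?p \<sigma> s)) / cmod (?p \<sigma> s) \<le> exp (t * c) * exp (- e * s) / (c / (1 + slope))"
        using c slope by (intro frac_le) auto
      moreover have "exp (t * c) * exp (- e * s) / (c / (1 + slope)) = exp (t * c) / (c / (1 + slope)) * exp (- e * s)"
        by simp
      ultimately show ?thesis by (simp only: norm_divide)
    qed
    have on: "?p \<sigma> s \<in> - \<real>\<^sub>\<le>\<^sub>0" if "s \<ge> 0" for s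
      using that c s by (cases "s = 0") (auto simp: complex_nonpos_Reals_iff leg_def)
    have op: "open (- \<real>\<^sub>\<le>\<^sub>0 :: complex set)" by (simp add: open_Compl)
    show ?thesis by (rule primitive_ray_limit[OF op on F e b]) auto
  qed
  then obtain L1 where L1: "((\<lambda>s. F (?p 1 s)) \<longlongrightarrow> L1) at_top"
    "ray_has_integral c (leg slope 1) (\<lambda>l. exp (of_real t * l) / l) (L1 - F c)"
    by auto
  obtain L2 where L2: "((\<lambda>s. F (?p (-1) s)) \<longlongrightarrow> L2) at_top"
    "ray_has_integral c (leg slope (-1)) (\<lambda>l. exp (of_real t * l) / l) (L2 - F c)"
    using ray[of "-1"] by auto
  have "((\<lambda>s. F (?p 1 s) - F (?p (-1) s)) \<longlongrightarrow> 2 * pi * \<i>) at_top"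
  proof (rule Lim_null_comparison[THEN Lim_null[THEN iffD2]])
    show "\<forall>\<^sub>F s in at_top. norm (F (?p 1 s) - F (?p (-1) s) - 2 * pi * \<i>) \<le> 2 / e * exp (t * c) * exp (- e * s)"
      using eventually_gt_at_top[of "(c + 1) / slope"] eventually_gt_at_top[of 0]
    proof eventually_elim
      fix s assume s: "(c + 1) / slope < s" "s > 0"
      have Re: "Re (?p 1 s) = c - slope * s" "Re (?p (-1) s) = c - slope * s" by (simp_all add: leg_def mult.commute)
      \<comment> \<open>So far out, both leg points lie on a vertical line left of
        \<open>- 1\<close>, where \<open>G\<close> is a primitive and
        \<open>cmod l \<ge> 1\<close>.\<close>
      have neg: "c - slope * s < - 1" using s slope by (simp add: field_simps)
      \<comment> \<open>The upper point contributes \<open>- \<i> * pi\<close> and the lower one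
        \<open>+ \<i> * pi\<close>; their difference is the residue term
        \<open>2 * pi * \<i>\<close>.\<close>
      have "Ln (- ?p 1 s) = Ln (?p 1 s) - \<i> * pi"
        by (subst Ln_minus) (use s in \<open>auto simp: leg_def complex_eq_iff\<close>)
      moreover have "Ln (- ?p (-1) s) = Ln (?p (-1) s) + \<i> * pi"
        by (subst Ln_minus) (use s in \<open>auto simp: leg_def complex_eq_iff\<close>)
      ultimately have FG: "F (?p 1 s) - F (?p (-1) s) - 2 * pi * \<i> = G (?p 1 s) - G (?p (-1) s)"
        by (simp add: F_def G_def)
      have "norm (G (?p 1 s) - G (?p (-1) s)) \<le> exp (t * (c - slope * s)) * norm (?p 1 s - ?p (-1) s)"
      proof (rule field_differentiable_bound[of "{l. Re l = c - slope * s}" G "\<lambda>l::complex. exp (of_real t * l) / l"])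
        show "convex {l. Re l = c - slope * s}"
          using convex_hyperplane[of "1::complex" "c - slope * s"] by (simp add: inner_complex_def)
        fix l assume "l \<in> {l. Re l = c - slope * s}"
        then have l: "Re l = c - slope * s" by simp
        show "(G has_field_derivative exp (of_real t * l) / l) (at l within {l. Re l = c - slope * s})"
          by (rule has_field_derivative_at_within[OF G]) (use l neg in simp)
        have "1 \<le> cmod l" using abs_Re_le_cmod[of l] l neg by simp
        then have "cmod (exp (t * l)) / cmod l \<le> cmod (exp (t * l)) / 1"
          by (intro divide_left_mono) auto
        then show "cmod (exp (of_real t * l) / l) \<le> exp (t * (c - slope * s))"
          using l by (simp add: norm_divide)
      qed (use Re in auto)
      also have "?p 1 s - ?p (-1) s = 2 * of_real s * \<i>"
        by (simp add: leg_def complex_eq_iff)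
      also have "norm (2 * of_real s * \<i>) = 2 * s" using s by (simp add: norm_mult)
      \<comment> \<open>The distance \<open>2 * s\<close> of the two points is absorbed by half of
        the decay.\<close>
      also have "exp (t * (c - slope * s)) * (2 * s) \<le> exp (t * (c - slope * s)) * (2 * (1 / e * exp (e * s)))"
        by (intro mult_left_mono le_exp_scaled e) auto
      also have "\<dots> = 2 / e * exp (t * c) * (exp (- (2 * e) * s) * exp (e * s))"
        by (simp add: e_def right_diff_distrib exp_diff exp_minus field_simps)
      also have "exp (- (2 * e) * s) * exp (e * s) = exp (- e * s)"
        by (simp add: exp_add[symmetric])
      finally show "norm (F (?p 1 s) - F (?p (-1) s) - 2 * pi * \<i>) \<le> 2 / e * exp (t * c) * exp (- e * s)"
        unfolding FG .
    qed
  qed (rule exp_decay_tendsto_0[OF e])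
  then have "L1 - L2 = 2 * pi * \<i>"
    using tendsto_unique[OF _ tendsto_diff[OF L1(1) L2(1)]] by simp
  then have "(L1 - F c) - (L2 - F c) = 2 * pi * \<i>" by simp
  then have "1 = inverse (2 * pi * \<i>) *\<^sub>C ((L1 - F c) - (L2 - F c))"
    by (simp only: scaleC_complex_def) (rule left_inverse[symmetric], simp)
  then show ?thesis using L1(2) L2(2) unfolding wedge_has_integral_def by blast
qed

text \<open>With \<open>u = R m x\<close> and \<open>y = m *\<^sub>C u - x\<close>, which is
  \<open>G u\<close> for the generator, one has \<open>R l u = (u + R l y) / l\<close>. The first
  term integrates to \<open>u\<close> exactly; the second, estimated with vertex
  \<open>1 / t\<close>, is of order \<open>t\<close>.\<close>

lemma S_R_minus_R_le:
  assumes m: "m \<in> \<Omega>"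
  shows "\<exists>K. \<forall>t>0. norm (S (of_real t) (R m x) - R m x) \<le> K * t"
proof (intro exI allI impI)
  fix t :: real assume t: "t > 0"
  define y where "y = m *\<^sub>C R m x - x"
  define c where "c = 1 / t"
  have c: "c > 0" using t by (simp add: c_def)
  have e: "slope / 2 * t > 0" using slope t by simp
  let ?p = "\<lambda>\<sigma> s. of_real c + of_real s * leg slope \<sigma>"
  have "kernel_bounded c (exp 1 * ((1 + slope) * t)) (slope / 2 * t) (\<lambda>l. exp (of_real t * l) / l)"
  proof (rule kernel_boundedI[OF c])
    show "continuous_on \<Omega> (\<lambda>l. exp (of_real t * l) / l)"
      using zero_notin by (auto intro!: continuous_intros)
    fix s \<sigma> :: real assume s: "s > 0" "\<sigma> \<in> {1, -1}"
    have "cmod (exp (t * ?p \<sigma> s)) \<le> exp (t * c) * exp (- (slope / 2 * t) * s)"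
      using exp_on_leg[OF real_in_sectorW[OF t] c _ s(2), of s] s by simp
    moreover have "c / (1 + slope) \<le> cmod (?p \<sigma> s)"
      using norm_leg_ge[OF c _ s(2), of s] s by simp
    ultimately have "cmod (exp (t * ?p \<sigma> s)) / cmod (?p \<sigma> s)
        \<le> exp (t * c) * exp (- (slope / 2 * t) * s) / (c / (1 + slope))"
      using c slope by (intro frac_le) auto
    then show "cmod (exp (t * ?p \<sigma> s) / ?p \<sigma> s) \<le> exp 1 * ((1 + slope) * t) * exp (- (slope / 2 * t) * s)"
      using t by (simp add: norm_divide c_def mult_ac)
  qed
  from kernel_integral_exists[OF c e this] obtain I where
    I: "wedge_has_integral slope c (\<lambda>l. (exp (of_real t * l) / l) *\<^sub>C R l y) I"
    and le: "norm I \<le> resolvent_bound * (exp 1 * ((1 + slope) * t)) / (slope / 2 * t * c) * norm y"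
    by blast
  have "wedge_has_integral slope c (\<lambda>l. (exp (of_real t * l) / l) *\<^sub>C R m x + (exp (of_real t * l) / l) *\<^sub>C R l y) (1 *\<^sub>C R m x + I)"
    by (intro wedge_has_integral_add I
        wedge_has_integral_clinear[OF wedge_integral_exp_over[OF t c] bounded_clinear_scaleC_left])
  then have "wedge_has_integral slope c (\<lambda>l. exp (t * l) *\<^sub>C R l (R m x)) (1 *\<^sub>C R m x + I)"
  proof (rule wedge_has_integral_cong)
    fix s \<sigma> :: real assume "s > 0" "\<sigma> \<in> {1, -1}"
    then have l: "?p \<sigma> s \<in> \<Omega>" using c by (intro on_leg) auto
    define l where "l = ?p \<sigma> s"
    have l: "l \<in> \<Omega>" "l \<noteq> 0" using l zero_notin by (auto simp: l_def)
    have "R l x - R m x = (m - l) *\<^sub>C R l (R m x)" using resolvent_identity[OF l(1) m] .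
    then have "R m x + R l y = l *\<^sub>C R l (R m x)"
      by (simp add: y_def R_diff R_scaleC l scaleC.diff_left algebra_simps)
    then show "(exp (of_real t * l) / l) *\<^sub>C R m x + (exp (of_real t * l) / l) *\<^sub>C R l y = exp (t * l) *\<^sub>C R l (R m x)"
      using l by (simp add: scaleC_add_right[symmetric] scaleC_scaleC)
  qed
  from wedge_has_integral_unique[OF S_at[OF real_in_sectorW[OF t] c] this]
  have "S t (R m x) - R m x = I" by simp
  then show "norm (S t (R m x) - R m x) \<le> (resolvent_bound * (exp 1 * (1 + slope)) / (slope / 2) * norm y) * t"
    using le t by (simp add: c_def mult_ac)
qed

lemma S_R_tendsto:
  assumes m: "m \<in> \<Omega>"
  shows "((\<lambda>t. S (of_real t) (R m x)) \<longlongrightarrow> R m x) (at_right 0)"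
proof -
  obtain K where K: "\<And>t. t > 0 \<Longrightarrow> norm (S (of_real t) (R m x) - R m x) \<le> K * t"
    using S_R_minus_R_le[OF m] by blast
  show ?thesis
  proof (rule Lim_null_comparison[THEN Lim_null[THEN iffD2]])
    show "\<forall>\<^sub>F t in at_right 0. norm (S (of_real t) (R m x) - R m x) \<le> K * t"
      using K by (auto simp: eventually_at_filter)
    have "((\<lambda>t. K * t) \<longlongrightarrow> K * 0) (at_right 0)" by (intro tendsto_intros)
    then show "((\<lambda>t. K * t) \<longlongrightarrow> 0) (at_right 0)" by simp
  qed
qed

lemma S_linear: "z \<in> sectorW \<Longrightarrow> bounded_linear (S z)"
  and S_scaleC: "z \<in> sectorW \<Longrightarrow> S z (c *\<^sub>C x) = c *\<^sub>C S z x"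
  using S_clinear by (auto simp: bounded_clinear_on_UNIV_iff)

lemma S_diff: "z \<in> sectorW \<Longrightarrow> S z (x - y) = S z x - S z y"
  using S_linear by (simp add: linear_diff bounded_linear.linear)

text \<open>Convergence on the range extends to its closure because \<open>S\<close> is bounded
  uniformly in time.\<close>

lemma S_tendsto:
  assumes m: "m \<in> \<Omega>" and x: "x \<in> closure (range (R m))"
  shows "((\<lambda>t. S (of_real t) x) \<longlongrightarrow> x) (at_right 0)"
proof (rule tendstoI)
  fix e :: real assume e: "e > 0"
  \<comment> \<open>The two approximation errors \<open>S_const * e'\<close> and \<open>e'\<close>
    together stay strictly below \<open>e\<close>, which leaves room for the convergence at
    \<open>R m y\<close>.\<close>
  define e' where "e' = e / (2 * (S_const + 2))"
  have e'0: "e' > 0" using e S_const_pos by (simp add: e'_def)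
  have "e = e' * (2 * (S_const + 2))" using S_const_pos by (simp add: e'_def)
  then have "e = 2 * (S_const * e') + 4 * e'" by (simp add: algebra_simps)
  moreover have "S_const * e' > 0" using e'0 S_const_pos by simp
  ultimately have "S_const * e' + e' < e" using e'0 by linarith
  note e' = e'0 this
  obtain y where y: "dist (R m y) x < e'"
    using x e' unfolding closure_approachable by blast
  have "\<forall>\<^sub>F t in at_right 0. dist (S (of_real t) (R m y)) (R m y) < e - (S_const * e' + e')"
    by (rule tendstoD[OF S_R_tendsto[OF m]]) (use e' in auto)
  moreover have "\<forall>\<^sub>F t::real in at_right 0. t > 0" by (simp add: eventually_at_filter)
  ultimately show "\<forall>\<^sub>F t in at_right 0. dist (S (of_real t) x) x < e"
  proof eventually_elim
    case (elim t)
    have "norm (S t (x - R m y)) \<le> S_const * norm (x - R m y)"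
      by (rule S_bound[OF real_in_sectorW[OF elim(2)]])
    also have "\<dots> \<le> S_const * e'"
      using y S_const_pos by (intro mult_left_mono) (auto simp: dist_norm norm_minus_commute)
    finally have "dist (S t x) (S t (R m y)) \<le> S_const * e'"
      by (simp add: dist_norm S_diff real_in_sectorW elim)
    then show ?case
      using y elim dist_triangle[of "S t x" x "S t (R m y)"] dist_triangle[of "S t (R m y)" x "R m y"]
      by linarith
  qed
qed

section \<open>Semigroup law and Laplace transform\<close>

lemma S_taylor_real:
  assumes t: "t > 0"
  shows "\<exists>\<eta>>0. \<exists>C>0. \<forall>h x. \<bar>h\<bar> \<le> \<eta> \<longrightarrow>
    norm (S (of_real (t + h)) x - S (of_real t) x - h *\<^sub>R S' (of_real t) x) \<le> C * h^2 * norm x"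
proof -
  obtain \<eta> C where C: "\<eta> > 0" "C > 0" "\<And>h x. cmod h \<le> \<eta> \<Longrightarrow> of_real t + h \<in> sectorW \<Longrightarrow>
    norm (S (of_real t + h) x - S (of_real t) x - h *\<^sub>C S' (of_real t) x) \<le> C * (cmod h)^2 * norm x"
    using S_taylor[OF real_in_sectorW[OF t]] by blast
  show ?thesis
  proof (rule exI[of _ "min \<eta> (t / 2)"], rule conjI, use C t in simp, rule exI[of _ C], intro conjI allI impI)
    fix h x assume h: "\<bar>h\<bar> \<le> min \<eta> (t / 2)"
    have "t + h > 0" using h t by (auto simp: abs_le_iff)
    then have "of_real t + of_real h \<in> sectorW"
      using real_in_sectorW[of "t + h"] by simp
    with C(3)[of "of_real h" x] h
    show "norm (S (of_real (t + h)) x - S (of_real t) x - h *\<^sub>R S' (of_real t) x) \<le> C * h^2 * norm x"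
      by (simp add: scaleC_of_real)
  qed (use C in auto)
qed

lemma S_has_vector_derivative:
  assumes t: "t > 0"
  shows "((\<lambda>t. S (of_real t) x) has_vector_derivative S' (of_real t) x) (at t)"
proof -
  obtain \<eta> C where "\<eta> > 0" "\<And>h x. \<bar>h\<bar> \<le> \<eta> \<Longrightarrow>
      norm (S (of_real (t + h)) x - S (of_real t) x - h *\<^sub>R S' (of_real t) x) \<le> C * h^2 * norm x"
    using S_taylor_real[OF t] by blast
  then show ?thesis
    by (intro has_vector_derivative_quadratic[where C = "C * norm x"]) (auto simp: mult_ac)
qed

text \<open>The product rule for \<open>S (u - r) (S r x)\<close> needs a bilinear operation, so the
  outer factor is taken as a bounded linear map under the operator norm; the reflection
  \<open>u - r\<close> produces the minus sign.\<close>

lemma Blinfun_S_reflected_has_vector_derivative: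
  assumes t: "t > 0"
  shows "((\<lambda>r. Blinfun (S (of_real (u - r)))) has_vector_derivative - Blinfun (S' (of_real t))) (at (u - t))"
proof -
  obtain \<eta> C where C: "\<eta> > 0" "C > 0" "\<And>h x. \<bar>h\<bar> \<le> \<eta> \<Longrightarrow>
      norm (S (of_real (t + h)) x - S (of_real t) x - h *\<^sub>R S' (of_real t) x) \<le> C * h^2 * norm x"
    using S_taylor_real[OF t] by blast
  have S': "bounded_linear (S' (of_real t))"
    using S'_clinear[OF real_in_sectorW[OF t]] by (simp add: bounded_clinear_on_UNIV_iff)
  show ?thesis
  proof (rule has_vector_derivative_quadratic[of "min \<eta> (t / 2)"])
    fix h assume h: "\<bar>h\<bar> \<le> min \<eta> (t / 2)"
    have *: "bounded_linear (S (of_real (t - h)))" "bounded_linear (S (of_real t))"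
      by (rule S_linear[OF real_in_sectorW]; use h t in linarith)+
    have "norm (Blinfun (S (of_real (t + - h))) - Blinfun (S (of_real t)) - (- h) *\<^sub>R Blinfun (S' (of_real t))) \<le> C * (- h)^2"
    proof (rule norm_blinfun_bound)
      fix x
      show "norm (blinfun_apply (Blinfun (S (of_real (t + - h))) - Blinfun (S (of_real t)) - (- h) *\<^sub>R Blinfun (S' (of_real t))) x)
          \<le> C * (- h)^2 * norm x"
        using C(3)[of "- h" x] h
        by (simp add: blinfun.bilinear_simps bounded_linear_Blinfun_apply * S' del: of_real_add of_real_diff)
    qed (use C in simp)
    then show "norm (Blinfun (S (of_real (u - (u - t + h)))) - Blinfun (S (of_real (u - (u - t))))
        - h *\<^sub>R (- Blinfun (S' (of_real t)))) \<le> C * h^2"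
      by (simp add: algebra_simps)
  qed (use C t in auto)
qed

text \<open>With \<open>u = t + s\<close>, the vector \<open>S (u - r) (S r x)\<close> does not
  depend on \<open>r\<close>: its derivative vanishes, as one sees after applying the injective
  \<open>R 1\<close>. The constant is found as \<open>r\<close> tends to \<open>0\<close>, again
  behind \<open>R 1\<close>, since \<open>S r\<close> converges to the identity on the range of
  \<open>R 1\<close>.\<close>

lemma S_semigroup:
  assumes t: "t > 0" and s: "s > 0"
  shows "S (of_real (t + s)) x = S (of_real t) (S (of_real s) x)"
proof -
  define u where "u = t + s"
  define v where "v r = S (of_real (u - r)) (S (of_real r) x)" for r
  have one: "(1::complex) \<in> \<Omega>" using pos_in[of 1] by simp
  have "\<exists>k. \<forall>r\<in>{0<..<u}. v r = k"
  proof -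
    have "(v has_vector_derivative 0) (at r within {0<..<u})" if r: "r \<in> {0<..<u}" for r
    proof -
      have ur: "u - r > 0" "r > 0" using r by auto
      note mem = real_in_sectorW[OF ur(1)] real_in_sectorW[OF ur(2)]
      define w where "w r = blinfun_apply (Blinfun (S (of_real (u - r)))) (S (of_real r) x)" for r
      have S': "bounded_linear (S' (of_real (u - r)))"
        using S'_clinear[OF mem(1)] by (simp add: bounded_clinear_on_UNIV_iff)
      have "((\<lambda>r. Blinfun (S (of_real (u - r)))) has_vector_derivative - Blinfun (S' (of_real (u - r)))) (at r)"
        using Blinfun_S_reflected_has_vector_derivative[OF ur(1), of u] by simp
      from bounded_bilinear.has_vector_derivative[OF bounded_bilinear_blinfun_apply this S_has_vector_derivative[OF ur(2), of x]]
      have "(w has_vector_derivative S (of_real (u - r)) (S' (of_real r) x) - S' (of_real (u - r)) (S (of_real r) x)) (at r)"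
        by (simp add: w_def[abs_def] bounded_linear_Blinfun_apply S' S_linear mem blinfun.bilinear_simps del: of_real_diff)
      moreover have "S (of_real (u - r)) (S' (of_real r) x) - S' (of_real (u - r)) (S (of_real r) x) = 0"
      proof (rule injective[OF one])
        show "R 1 (S (of_real (u - r)) (S' (of_real r) x) - S' (of_real (u - r)) (S (of_real r) x)) = 0"
          using R_S'[OF mem(1) one, of "S (of_real r) x"] R_S'[OF mem(2) one, of x]
          by (simp add: R_diff one R_S mem S_diff del: of_real_diff)
      qed
      ultimately have "(w has_vector_derivative 0) (at r)" by simp
      then have "(v has_vector_derivative 0) (at r)"
        by (rule has_vector_derivative_transform_within_open[of _ _ _ "{0<..<u}"])
          (use r in \<open>auto simp: w_def v_def bounded_linear_Blinfun_apply S_linear real_in_sectorW simp del: of_real_diff\<close>)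
      then show ?thesis by (rule has_vector_derivative_at_within)
    qed
    from has_vector_derivative_zero_constant[OF convex_real_interval(8) this] show ?thesis by metis
  qed
  then obtain k where k: "\<And>r. r \<in> {0<..<u} \<Longrightarrow> v r = k" by blast
  have u: "u > 0" using t s by (simp add: u_def)
  define y where "y = R 1 x"
  have lim: "((\<lambda>r. S (of_real (u - r)) (S (of_real r) y)) \<longlongrightarrow> S (of_real u) y) (at_right 0)"
  proof -
    \<comment> \<open>The uniform bound on \<open>S (u - r)\<close> carries the convergence of
      \<open>S r y - y\<close> to \<open>0\<close> through the outer factor.\<close>
    have "((\<lambda>r. S (of_real (u - r)) (S (of_real r) y - y)) \<longlongrightarrow> 0) (at_right 0)"
    proof (rule Lim_null_comparison)
      show "\<forall>\<^sub>F r in at_right 0. norm (S (of_real (u - r)) (S (of_real r) y - y)) \<le> S_const * norm (S (of_real r) y - y)"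
        using eventually_at_right_less[of 0] eventually_at_right_field[of _ "0::real"] u
        by (auto simp: eventually_at_right_field intro!: exI[of _ u] S_bound real_in_sectorW simp del: of_real_diff)
      show "((\<lambda>r. S_const * norm (S (of_real r) y - y)) \<longlongrightarrow> 0) (at_right 0)"
        using tendsto_mult[OF tendsto_const tendsto_norm[OF tendsto_diff[OF S_R_tendsto[OF one, of x] tendsto_const[of "R 1 x"]]], of S_const]
        by (simp add: y_def)
    qed
    moreover have "((\<lambda>r. S (of_real (u - r)) y) \<longlongrightarrow> S (of_real u) y) (at_right 0)"
    proof -
      have "isCont (\<lambda>t. S (of_real t) y) u"
        by (rule has_vector_derivative_continuous[OF S_has_vector_derivative[OF u]])
      moreover have "((\<lambda>r. u - r) \<longlongrightarrow> u) (at_right 0)"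
        by (auto intro!: tendsto_eq_intros)
      ultimately show ?thesis by (rule isCont_tendsto_compose)
    qed
    ultimately have "((\<lambda>r. S (of_real (u - r)) (S (of_real r) y - y) + S (of_real (u - r)) y) \<longlongrightarrow> 0 + S (of_real u) y) (at_right 0)"
      by (rule tendsto_add)
    then have "((\<lambda>r. S (of_real (u - r)) (S (of_real r) y - y) + S (of_real (u - r)) y) \<longlongrightarrow> S (of_real u) y) (at_right 0)"
      by simp
    then show ?thesis
    proof (rule Lim_transform_eventually)
      show "\<forall>\<^sub>F r in at_right 0. S (of_real (u - r)) (S (of_real r) y - y) + S (of_real (u - r)) y = S (of_real (u - r)) (S (of_real r) y)"
        using u by (auto simp: eventually_at_right_field S_diff real_in_sectorW intro!: exI[of _ u] simp del: of_real_diff)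
    qed
  qed
  have lim_k: "((\<lambda>r::real. R 1 k) \<longlongrightarrow> S (of_real u) y) (at_right 0)"
  proof (rule Lim_transform_eventually[OF lim])
    have "S (of_real (u - r)) (S (of_real r) y) = R 1 k" if "0 < r" "r < u" for r
      using that k[of r] by (simp add: v_def[symmetric] y_def R_S[symmetric] real_in_sectorW one del: of_real_diff)
    then show "\<forall>\<^sub>F r in at_right 0. S (of_real (u - r)) (S (of_real r) y) = R 1 k"
      using u by (auto simp: eventually_at_right_field intro!: exI[of _ u])
  qed
  have "R 1 k = R 1 (S (of_real u) x)"
    using tendsto_unique[OF _ tendsto_const lim_k] by (simp add: y_def R_S real_in_sectorW[OF u] one)
  then have "R 1 (k - S (of_real u) x) = 0" by (simp add: R_diff one)
  then have "k = S (of_real u) x" using injective[OF one] by fastforce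
  moreover have "v s = k" by (rule k) (use t s in \<open>auto simp: u_def\<close>)
  ultimately show ?thesis by (simp add: v_def u_def)
qed

text \<open>By the evolution equation \<open>- exp (- m t) R(m) S(t) x\<close> is a primitive of the
  integrand. It tends to \<open>- R(m) x\<close> at \<open>0\<close>, because \<open>R(m)\<close>
  commutes with \<open>S(t)\<close> and \<open>S(t)\<close> converges on the range of
  \<open>R(m)\<close>.\<close>

lemma S_laplace:
  assumes m: "m > 0"
  shows "((\<lambda>t. exp (- m * t) *\<^sub>R S (of_real t) x) has_integral R (of_real m) x) {0<..}"
proof -
  have mO: "of_real m \<in> \<Omega>" by (rule pos_in[OF m])
  define F where "F t = exp (- m * t) *\<^sub>R (- R (of_real m) (S (of_real t) x))" for t
  have 1: "(F has_vector_derivative exp (- m * t) *\<^sub>R S (of_real t) x) (at t)" if t: "t > 0" for t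
  proof -
    have "((\<lambda>t. - R (of_real m) (S (of_real t) x)) has_vector_derivative - R (of_real m) (S' (of_real t) x)) (at t)"
      by (intro has_vector_derivative_minus bounded_linear.has_vector_derivative[OF R_linear[OF mO]]
          S_has_vector_derivative t)
    moreover have "((\<lambda>t. exp (- m * t)) has_real_derivative - m * exp (- m * t)) (at t)"
      by (auto intro!: derivative_eq_intros)
    ultimately have "(F has_vector_derivative exp (- m * t) *\<^sub>R (- R (of_real m) (S' (of_real t) x))
        + (- m * exp (- m * t)) *\<^sub>R (- R (of_real m) (S (of_real t) x))) (at t)"
      unfolding F_def[abs_def] by (intro has_vector_derivative_scaleR)
    then show ?thesis
      by (simp add: R_S'[OF real_in_sectorW[OF t] mO] scaleC_of_real algebra_simps)
  qed
  have 2: "(F \<longlongrightarrow> exp (- m * 0) *\<^sub>R (- R (of_real m) x)) (at_right 0)"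
    unfolding F_def[abs_def]
  proof (intro tendsto_intros)
    show "((\<lambda>t. R (of_real m) (S (of_real t) x)) \<longlongrightarrow> R (of_real m) x) (at_right 0)"
      by (rule Lim_transform_eventually[OF S_R_tendsto[OF mO]])
        (auto simp: eventually_at_filter R_S real_in_sectorW mO)
  qed
  have 3: "(F \<longlongrightarrow> 0) at_top"
  proof (rule Lim_null_comparison)
    show "((\<lambda>t. (M / m * (S_const * norm x)) * exp (- m * t)) \<longlongrightarrow> 0) at_top"
      by (rule exp_decay_tendsto_0[OF m])
    show "\<forall>\<^sub>F t in at_top. norm (F t) \<le> (M / m * (S_const * norm x)) * exp (- m * t)"
      using eventually_gt_at_top[of 0]
    proof eventually_elim
      fix t :: real assume t: "t > 0"
      have "norm (R (of_real m) (S (of_real t) x)) \<le> M / m * norm (S (of_real t) x)"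
        using bound[OF mO, of "S (of_real t) x"] m by simp
      also have "\<dots> \<le> M / m * (S_const * norm x)"
        using M m by (intro mult_left_mono S_bound real_in_sectorW t) auto
      finally have "norm (R (of_real m) (S (of_real t) x)) \<le> M / m * (S_const * norm x)" .
      from mult_right_mono[OF this, of "exp (- m * t)"]
      show "norm (F t) \<le> (M / m * (S_const * norm x)) * exp (- m * t)"
        by (simp only: F_def norm_scaleR norm_minus_cancel abs_exp_cancel mult.commute[of "exp _"]) simp
    qed
  qed
  show ?thesis using has_integral_half_line[OF 1 2 3] by simp
qed

end

section \<open>Resolvent estimates for holomorphic semigroups\<close>

text \<open>Below \<open>pi / 2\<close> the polar sector of the definition is a cone bounded by two
  slopes; this lemma and the next pass between the two descriptions.\<close>

lemma in_sectorI:
  assumes "0 < \<theta>" "\<theta> < pi / 2" and Re: "Re z > 0" and Im: "\<bar>Im z\<bar> < tan \<theta> * Re z"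
  shows "z \<in> sector \<theta>"
proof -
  define \<phi> where "\<phi> = arctan (Im z / Re z)"
  have \<phi>: "- (pi / 2) < \<phi>" "\<phi> < pi / 2" unfolding \<phi>_def by (rule arctan_lbound arctan_ubound)+
  have cos: "cos \<phi> > 0" using \<phi> by (intro cos_gt_zero_pi)
  have "sin \<phi> / cos \<phi> = Im z / Re z" using tan_arctan[of "Im z / Re z"] by (simp add: \<phi>_def tan_def)
  then have "z = rcis (Re z / cos \<phi>) \<phi>"
    using cos Re by (simp add: complex_eq_iff field_simps)
  moreover have "\<bar>\<phi>\<bar> < \<theta>"
  proof -
    have "Im z / Re z < tan \<theta>" "tan (- \<theta>) < Im z / Re z" using Re Im by (auto simp: field_simps abs_less_iff)
    then have "\<phi> < arctan (tan \<theta>)" "arctan (tan (- \<theta>)) < \<phi>"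
      unfolding \<phi>_def by (simp_all only: arctan_less_iff)
    moreover have "arctan (tan \<theta>) = \<theta>" "arctan (tan (- \<theta>)) = - \<theta>"
      using assms(1,2) by (intro arctan_tan; simp)+
    ultimately show ?thesis by simp
  qed
  moreover have "0 < Re z / cos \<phi>" using cos Re by simp
  ultimately show ?thesis unfolding sector_def by blast
qed

lemma in_sector_arctanD:
  assumes "k > 0" and z: "z \<in> sector (arctan k)"
  shows "Re z > 0" "\<bar>Im z\<bar> < k * Re z"
proof -
  obtain r \<phi> where r: "z = rcis r \<phi>" "r > 0" "\<bar>\<phi>\<bar> < arctan k" using z by (auto simp: sector_def)
  have \<phi>: "- (pi / 2) < \<phi>" "\<phi> < pi / 2" using r(3) arctan_ubound[of k] by auto
  have cos: "cos \<phi> > 0" using \<phi> by (intro cos_gt_zero_pi)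
  then show Re: "Re z > 0" using r by simp
  have "tan \<phi> < tan (arctan k)" "tan (- arctan k) < tan \<phi>"
    using r(3) \<phi> arctan_ubound[of k] by (intro tan_monotone; simp)+
  then have "\<bar>tan \<phi>\<bar> < k" by (simp add: abs_less_iff tan_arctan)
  moreover have "Im z = tan \<phi> * Re z" using r cos by (simp add: tan_def)
  ultimately show "\<bar>Im z\<bar> < k * Re z" using Re by (simp add: abs_mult)
qed

section \<open>Laplace transform of a semigroup differentiable in real time\<close>

locale smooth_semigroup =
  fixes T T' :: "real \<Rightarrow> 'x::complex_banach \<Rightarrow> 'x" and \<omega> M :: real
  assumes T_clinear: "t > 0 \<Longrightarrow> bounded_clinear_on UNIV UNIV (T t)"
    and T'_clinear: "t > 0 \<Longrightarrow> bounded_clinear_on UNIV UNIV (T' t)"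
    and semigroup: "t > 0 \<Longrightarrow> s > 0 \<Longrightarrow> T (t + s) x = T t (T s x)"
    and derivative: "t > 0 \<Longrightarrow> ((\<lambda>t. T t x) has_vector_derivative T' t x) (at t)"
    and \<omega>: "\<omega> > 0" and M: "M > 0"
    and T_bound: "t > 0 \<Longrightarrow> norm (T t x) \<le> M * exp (\<omega> * t) * norm x"
begin

lemma T_linear: "t > 0 \<Longrightarrow> bounded_linear (T t)"
  and T'_linear: "t > 0 \<Longrightarrow> bounded_linear (T' t)"
  using T_clinear T'_clinear by (auto simp: bounded_clinear_on_UNIV_iff)

lemma shifted_derivative:
  assumes "t + s > 0"
  shows "((\<lambda>r. T (r + s) x) has_vector_derivative T' (t + s) x) (at t)"
proof -
  have "((\<lambda>r. r + s) has_vector_derivative 1) (at t)" by (auto intro!: derivative_eq_intros)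
  from vector_diff_chain_at[OF this derivative[OF assms]] show ?thesis by (simp add: o_def)
qed

text \<open>The semigroup law is differentiated in \<open>t\<close> twice over, with
  \<open>T s\<close> read as the inner and as the outer factor.\<close>

lemma T'_add:
  assumes "t > 0" "s > 0"
  shows "T' (t + s) x = T' t (T s x)" "T' (t + s) x = T s (T' t x)"
proof -
  have *: "((\<lambda>r. T (r + s) x) has_vector_derivative T' (t + s) x) (at t)"
    using assms by (intro shifted_derivative) simp
  have "((\<lambda>r. T (r + s) x) has_vector_derivative T' t (T s x)) (at t)"
    by (rule has_vector_derivative_transform_within_open[OF derivative[OF assms(1)], of "{0<..}"])
      (use assms in \<open>auto simp: semigroup\<close>)
  with * show "T' (t + s) x = T' t (T s x)" by (rule vector_derivative_unique_at)
  have "((\<lambda>r. T (r + s) x) has_vector_derivative T s (T' t x)) (at t)"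
    by (rule has_vector_derivative_transform_within_open[OF
          bounded_linear.has_vector_derivative[OF T_linear[OF assms(2)] derivative[OF assms(1)]], of "{0<..}"])
      (use assms semigroup[of s] in \<open>auto simp: add.commute\<close>)
  with * show "T' (t + s) x = T s (T' t x)" by (rule vector_derivative_unique_at)
qed

text \<open>The square of \<open>T' (t / 2)\<close>: a bound on \<open>T'\<close> of order
  \<open>1 / t\<close> then gives one on \<open>T''\<close> of order \<open>1 / t^2\<close>.\<close>

definition T'' where "T'' t x = T' (t / 2) (T' (t / 2) x)"

text \<open>For \<open>r > t / 2\<close> one has \<open>T' r = T' (t / 2) T (r - t / 2)\<close>,
  which can be differentiated once more in the inner factor.\<close>

lemma second_derivative:
  assumes t: "t > 0"
  shows "((\<lambda>t. T' t x) has_vector_derivative T'' t x) (at t)"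
proof -
  have t2: "t / 2 > 0" "t + - (t / 2) > 0" using t by auto
  have "((\<lambda>r. T' (t / 2) (T (r + - (t / 2)) x)) has_vector_derivative T' (t / 2) (T' (t + - (t / 2)) x)) (at t)"
    by (intro bounded_linear.has_vector_derivative[OF T'_linear[OF t2(1)]] shifted_derivative t2)
  then have "((\<lambda>r. T' (t / 2) (T (r + - (t / 2)) x)) has_vector_derivative T'' t x) (at t)"
    by (simp add: T''_def)
  then show ?thesis
  proof (rule has_vector_derivative_transform_within_open[of _ _ _ "{t / 2<..}"])
    fix r assume "r \<in> {t / 2<..}"
    then show "T' (t / 2) (T (r + - (t / 2)) x) = T' r x"
      using T'_add(1)[of "t / 2" "r + - (t / 2)" x] t2 by simp
  qed (use t in auto)
qed

lemma exp_T_bound: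
  assumes "t > 0"
  shows "norm (exp (- l * of_real t) *\<^sub>C T t x) \<le> M * norm x * exp (- (Re l - \<omega>) * t)"
proof -
  have "norm (exp (- l * of_real t) *\<^sub>C T t x) = exp (- Re l * t) * norm (T t x)"
    by (simp add: norm_scaleC)
  also have "\<dots> \<le> exp (- Re l * t) * (M * exp (\<omega> * t) * norm x)"
    using assms by (intro mult_left_mono T_bound) auto
  also have "\<dots> = M * norm x * (exp (- Re l * t) * exp (\<omega> * t))" by simp
  also have "exp (- Re l * t) * exp (\<omega> * t) = exp (- (Re l - \<omega>) * t)"
    by (simp add: exp_add[symmetric] algebra_simps)
  finally show ?thesis .
qed

lemma T_continuous: "continuous_on {0<..} (\<lambda>t. T t x)"
  using has_vector_derivative_continuous[OF derivative]
  by (intro continuous_at_imp_continuous_on) auto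

lemma exp_derivative:
  "((\<lambda>t. exp (a * of_real t)) has_vector_derivative a * exp (a * of_real t)) (at t)" for a :: complex
proof -
  have "((\<lambda>z. exp (a * z)) has_field_derivative exp (a * of_real t) * a) (at (of_real t))"
    by (auto intro!: derivative_eq_intros)
  moreover have "((\<lambda>t. complex_of_real t) has_vector_derivative 1) (at t)"
    using has_vector_derivative_of_real[of "\<lambda>t. t" 1] by simp
  ultimately show ?thesis
    using field_vector_diff_chain_at[of complex_of_real 1 t "\<lambda>z. exp (a * z)"]
    by (simp add: o_def mult.commute)
qed

definition Q where "Q l x = integral {0<..} (\<lambda>t. exp (- l * of_real t) *\<^sub>C T t x)"

lemma Q_integrable:
  assumes l: "Re l > \<omega>"
  shows "((\<lambda>t. exp (- l * of_real t) *\<^sub>C T t x) has_integral Q l x) {0<..}"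
proof -
  have "continuous_on {0<..} (\<lambda>t. exp (- l * of_real t) *\<^sub>C T t x)"
    by (intro scaleC.continuous_on continuous_intros T_continuous)
  from has_integral_half_line_exp[OF this _ exp_T_bound] l
  obtain I where "((\<lambda>t. exp (- l * of_real t) *\<^sub>C T t x) has_integral I) {0<..}"
    by (metis diff_gt_0_iff_gt)
  then show ?thesis unfolding Q_def by (metis integral_unique)
qed

lemma Q_add: "Re l > \<omega> \<Longrightarrow> Q l (x + y) = Q l x + Q l y"
  and Q_scaleC: "Re l > \<omega> \<Longrightarrow> Q l (c *\<^sub>C x) = c *\<^sub>C Q l x"
proof -
  assume l: "Re l > \<omega>"
  have "((\<lambda>t. exp (- l * of_real t) *\<^sub>C T t (x + y)) has_integral Q l x + Q l y) {0<..}"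
    by (rule has_integral_eq[OF _ has_integral_add[OF Q_integrable[OF l] Q_integrable[OF l]]])
      (simp add: linear_add[OF bounded_linear.linear[OF T_linear]] scaleC_add_right)
  with Q_integrable[OF l] show "Q l (x + y) = Q l x + Q l y" by (rule has_integral_unique)
  have "bounded_linear (\<lambda>x. c *\<^sub>C x :: 'x)" by (rule scaleC.bounded_linear_right)
  from has_integral_linear[OF Q_integrable[OF l, of x] this]
  have "((\<lambda>t. exp (- l * of_real t) *\<^sub>C T t (c *\<^sub>C x)) has_integral c *\<^sub>C Q l x) {0<..}"
    by (rule has_integral_eq[rotated])
      (use T_clinear in \<open>auto simp: bounded_clinear_on_UNIV_iff scaleC_scaleC mult.commute\<close>)
  with Q_integrable[OF l] show "Q l (c *\<^sub>C x) = c *\<^sub>C Q l x" by (rule has_integral_unique)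
qed

end

text \<open>The definition of a generator provides the Laplace formula at real points; one such
  point \<open>\<mu>\<close> with its resolvent \<open>R0\<close> is enough to reach the complex
  half plane.\<close>

locale smooth_semigroup_resolvent = smooth_semigroup +
  fixes R0 :: "'a \<Rightarrow> 'a" and \<mu> :: real
  assumes \<mu>: "\<mu> > \<omega>" and R0_clinear: "bounded_clinear_on UNIV UNIV R0"
    and R0_laplace: "((\<lambda>t. exp (- \<mu> * t) *\<^sub>R T t x) has_integral R0 x) {0<..}"
begin

lemma R0_linear: "bounded_linear R0" and R0_scaleC: "R0 (c *\<^sub>C x) = c *\<^sub>C R0 x"
  using R0_clinear by (auto simp: bounded_clinear_on_UNIV_iff)

lemma R0_scaleR: "R0 (c *\<^sub>R x) = c *\<^sub>R R0 x"
  using R0_linear by (simp add: linear_cmul bounded_linear.linear)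

lemma R0_T:
  assumes t: "t > 0" shows "R0 (T t x) = T t (R0 x)"
proof (rule has_integral_unique[OF R0_laplace])
  have "((\<lambda>s. T t (exp (- \<mu> * s) *\<^sub>R T s x)) has_integral T t (R0 x)) {0<..}"
    using has_integral_linear[OF R0_laplace T_linear[OF t]] by (simp add: o_def)
  then show "((\<lambda>s. exp (- \<mu> * s) *\<^sub>R T s (T t x)) has_integral T t (R0 x)) {0<..}"
  proof (rule has_integral_eq[rotated])
    fix s :: real assume "s \<in> {0<..}"
    then show "T t (exp (- \<mu> * s) *\<^sub>R T s x) = exp (- \<mu> * s) *\<^sub>R T s (T t x)"
      using semigroup[OF t, of s x] semigroup[of s, OF _ t, of x]
      by (simp add: linear_cmul[OF bounded_linear.linear[OF T_linear[OF t]]] add.commute)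
  qed
qed

lemma exp_decay: "((\<lambda>s. exp (- \<mu> * s) *\<^sub>R T (s + t) x) \<longlongrightarrow> 0) at_top" if "t \<ge> 0"
proof (rule Lim_null_comparison)
  show "((\<lambda>s. (M * exp (\<omega> * t) * norm x) * exp (- (\<mu> - \<omega>) * s)) \<longlongrightarrow> 0) at_top"
    using \<mu> by (intro exp_decay_tendsto_0) simp
  show "\<forall>\<^sub>F s in at_top. norm (exp (- \<mu> * s) *\<^sub>R T (s + t) x) \<le> (M * exp (\<omega> * t) * norm x) * exp (- (\<mu> - \<omega>) * s)"
    using eventually_gt_at_top[of 0]
  proof eventually_elim
    fix s :: real assume "s > 0"
    then have "norm (exp (- \<mu> * s) *\<^sub>R T (s + t) x) \<le> exp (- \<mu> * s) * (M * exp (\<omega> * (s + t)) * norm x)"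
      using that by (simp only: norm_scaleR abs_exp_cancel) (intro mult_left_mono T_bound, auto)
    also have "exp (\<omega> * (s + t)) = exp (\<omega> * t) * exp (\<omega> * s)"
      by (simp add: exp_add[symmetric] algebra_simps)
    also have "exp (- \<mu> * s) * (M * (exp (\<omega> * t) * exp (\<omega> * s)) * norm x) =
        (M * exp (\<omega> * t) * norm x) * (exp (- \<mu> * s) * exp (\<omega> * s))" by simp
    also have "exp (- \<mu> * s) * exp (\<omega> * s) = exp (- (\<mu> - \<omega>) * s)"
      by (simp add: exp_add[symmetric] algebra_simps)
    finally show "norm (exp (- \<mu> * s) *\<^sub>R T (s + t) x) \<le> (M * exp (\<omega> * t) * norm x) * exp (- (\<mu> - \<omega>) * s)" .
  qed
qed

text \<open>The relation \<open>T' = G T\<close> seen through \<open>R0\<close>. The offset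
  \<open>t > 0\<close> makes \<open>T (s + t) x\<close> differentiable up to \<open>s = 0\<close>,
  so the fundamental theorem applies even though \<open>T\<close> itself may have no limit at time
  0.\<close>

lemma R0_T':
  assumes t: "t > 0" shows "R0 (T' t x) = \<mu> *\<^sub>R R0 (T t x) - T t x"
proof -
  define F where "F s = exp (- \<mu> * s) *\<^sub>R T (s + t) x" for s
  have d: "(F has_vector_derivative exp (- \<mu> * s) *\<^sub>R T s (T' t x) - \<mu> *\<^sub>R exp (- \<mu> * s) *\<^sub>R T s (T t x)) (at s)"
    if s: "s > 0" for s
  proof -
    have "((\<lambda>s. exp (- \<mu> * s)) has_real_derivative - \<mu> * exp (- \<mu> * s)) (at s)"
      by (auto intro!: derivative_eq_intros)
    from has_vector_derivative_scaleR[OF this shifted_derivative[of s t x]] s t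
    have "(F has_vector_derivative exp (- \<mu> * s) *\<^sub>R T' (s + t) x + (- \<mu> * exp (- \<mu> * s)) *\<^sub>R T (s + t) x) (at s)"
      by (simp add: F_def[abs_def])
    then show ?thesis
      using T'_add(2)[OF t s, of x] semigroup[OF s t, of x] by (simp add: add.commute)
  qed
  have "isCont (\<lambda>s. T (s + t) x) 0"
    by (rule has_vector_derivative_continuous[OF shifted_derivative]) (use t in simp)
  then have "((\<lambda>s. T (s + t) x) \<longlongrightarrow> T (0 + t) x) (at_right 0)"
    unfolding isCont_def by (rule tendsto_within_subset) simp
  then have "(F \<longlongrightarrow> exp (- \<mu> * 0) *\<^sub>R T (0 + t) x) (at_right 0)"
    unfolding F_def[abs_def] by (intro tendsto_intros)
  then have 0: "(F \<longlongrightarrow> T t x) (at_right 0)" by simp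
  have top: "(F \<longlongrightarrow> 0) at_top"
    using exp_decay[of t x] t unfolding F_def[abs_def] by simp
  have "((\<lambda>s. exp (- \<mu> * s) *\<^sub>R T s (T' t x) - \<mu> *\<^sub>R exp (- \<mu> * s) *\<^sub>R T s (T t x)) has_integral (0 - T t x)) {0<..}"
    by (rule has_integral_half_line[OF d 0 top])
  moreover have "((\<lambda>s. exp (- \<mu> * s) *\<^sub>R T s (T' t x) - \<mu> *\<^sub>R exp (- \<mu> * s) *\<^sub>R T s (T t x)) has_integral
      (R0 (T' t x) - \<mu> *\<^sub>R R0 (T t x))) {0<..}"
    by (intro has_integral_diff has_integral_cmul R0_laplace)
  ultimately have "0 - T t x = R0 (T' t x) - \<mu> *\<^sub>R R0 (T t x)" by (rule has_integral_unique)
  then show ?thesis by (simp add: algebra_simps)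
qed

lemma R0_Q:
  assumes l: "Re l > \<omega>" shows "R0 (Q l x) = Q l (R0 x)"
proof (rule has_integral_unique)
  show "((\<lambda>t. R0 (exp (- l * of_real t) *\<^sub>C T t x)) has_integral R0 (Q l x)) {0<..}"
    using has_integral_linear[OF Q_integrable[OF l] R0_linear] by (simp add: o_def)
  show "((\<lambda>t. R0 (exp (- l * of_real t) *\<^sub>C T t x)) has_integral Q l (R0 x)) {0<..}"
    by (rule has_integral_eq[OF _ Q_integrable[OF l]]) (simp add: R0_scaleC R0_T)
qed

text \<open>Integrates the derivative of \<open>exp (- l t) R0 (T t x)\<close>. The delicate point
  is the boundary value: without strong continuity, convergence of \<open>R0 (T t x)\<close> to
  \<open>R0 x\<close> has to be earned. A Lipschitz bound gives some limit, and the case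
  \<open>l = \<mu>\<close> of the same integration identifies it.\<close>

lemma resolvent_equation:
  assumes l: "Re l > \<omega>"
  shows "Q l x = R0 x + (of_real \<mu> - l) *\<^sub>C R0 (Q l x)"
proof -
  define F where "F t = exp (- \<mu> * t) *\<^sub>R R0 (T t x)" for t
  have dR: "((\<lambda>t. R0 (T t x)) has_vector_derivative \<mu> *\<^sub>R R0 (T t x) - T t x) (at t)" if "t > 0" for t
    using bounded_linear.has_vector_derivative[OF R0_linear derivative[OF that]] by (simp add: R0_T' that)
  have d: "(F has_vector_derivative - (exp (- \<mu> * t) *\<^sub>R T t x)) (at t)" if t: "t > 0" for t
  proof -
    have "((\<lambda>t. exp (- \<mu> * t)) has_real_derivative - \<mu> * exp (- \<mu> * t)) (at t)"
      by (auto intro!: derivative_eq_intros)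
    from has_vector_derivative_scaleR[OF this dR[OF t]] show ?thesis
      by (simp add: F_def[abs_def] algebra_simps)
  qed
  have "norm (F t - F s) \<le> M * norm x * t - M * norm x * s" if st: "0 < s" "s \<le> t" for s t
  proof (rule vector_mean_value[OF d _ _ st])
    show "((\<lambda>t. M * norm x * t) has_real_derivative M * norm x) (at t)" for t
      by (auto intro!: derivative_eq_intros)
    fix t :: real assume t: "t > 0"
    have "norm (exp (- of_real \<mu> * of_real t) *\<^sub>C T t x) \<le> M * norm x * exp (- (Re (of_real \<mu>) - \<omega>) * t)"
      by (rule exp_T_bound[OF t])
    also have "\<dots> \<le> M * norm x * 1"
      using mult_pos_pos[of "\<mu> - \<omega>" t] \<mu> t M by (intro mult_left_mono) (auto simp: algebra_simps)
    finally show "norm (- (exp (- \<mu> * t) *\<^sub>R T t x)) \<le> M * norm x"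
      by (simp add: norm_scaleC)
  qed
  moreover have "((\<lambda>t. M * norm x * t) \<longlongrightarrow> M * norm x * 0) (at_right 0)" by (intro tendsto_intros)
  ultimately obtain k where k: "(F \<longlongrightarrow> k) (at_right 0)"
    by (rule limit_at_right_0_dominated)
  have "((\<lambda>t. R0 (exp (- \<mu> * t) *\<^sub>R T (t + 0) x)) \<longlongrightarrow> R0 0) at_top"
    by (intro bounded_linear.tendsto[OF R0_linear] exp_decay) simp
  then have top: "(F \<longlongrightarrow> 0) at_top"
    by (simp add: F_def[abs_def] R0_scaleR linear_0 bounded_linear.linear[OF R0_linear])
  have "((\<lambda>t. - (exp (- \<mu> * t) *\<^sub>R T t x)) has_integral (0 - k)) {0<..}"
    by (rule has_integral_half_line[OF d k top])
  with has_integral_neg[OF R0_laplace] have "- R0 x = 0 - k" by (rule has_integral_unique)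
  with k have F0: "(F \<longlongrightarrow> R0 x) (at_right 0)" by simp
  define H where "H t = exp ((of_real \<mu> - l) * of_real t) *\<^sub>C F t" for t
  have H_eq: "H t = exp (- l * of_real t) *\<^sub>C R0 (T t x)" for t
  proof -
    have "exp ((of_real \<mu> - l) * of_real t) * of_real (exp (- \<mu> * t)) = exp (- l * of_real t)"
      by (simp add: exp_of_real[symmetric] exp_add[symmetric] algebra_simps del: exp_of_real)
    then show ?thesis
      by (simp add: H_def F_def scaleC_of_real[symmetric] scaleC_scaleC)
  qed
  have dH: "(H has_vector_derivative (of_real \<mu> - l) *\<^sub>C R0 (exp (- l * of_real t) *\<^sub>C T t x)
      - exp (- l * of_real t) *\<^sub>C T t x) (at t)" if t: "t > 0" for t
  proof -
    have "(H has_vector_derivative exp (- l * of_real t) *\<^sub>C (\<mu> *\<^sub>R R0 (T t x) - T t x)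
        + (- l * exp (- l * of_real t)) *\<^sub>C R0 (T t x)) (at t)"
      unfolding H_eq[abs_def] by (rule scaleC.has_vector_derivative[OF exp_derivative dR[OF t]])
    then show ?thesis
      by (simp add: R0_scaleC scaleC_of_real[symmetric] scaleC_add_right scaleC.diff_right scaleC.diff_left
          scaleC_scaleC mult.commute algebra_simps)
  qed
  have "((\<lambda>t. exp ((of_real \<mu> - l) * of_real t)) \<longlongrightarrow> exp ((of_real \<mu> - l) * of_real 0)) (at_right 0)"
    by (intro tendsto_intros)
  from scaleC.tendsto[OF this F0] have H0: "(H \<longlongrightarrow> R0 x) (at_right 0)" by (simp add: H_def[abs_def])
  have "(H \<longlongrightarrow> 0) at_top"
  proof -
    have "((\<lambda>t. exp (- l * of_real t) *\<^sub>C T t x) \<longlongrightarrow> 0) at_top"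
    proof (rule Lim_null_comparison)
      show "\<forall>\<^sub>F t in at_top. norm (exp (- l * of_real t) *\<^sub>C T t x) \<le> M * norm x * exp (- (Re l - \<omega>) * t)"
        using eventually_gt_at_top[of 0] by eventually_elim (rule exp_T_bound)
    qed (use l in \<open>intro exp_decay_tendsto_0; simp\<close>)
    then have "((\<lambda>t. R0 (exp (- l * of_real t) *\<^sub>C T t x)) \<longlongrightarrow> R0 0) at_top"
      by (rule bounded_linear.tendsto[OF R0_linear])
    then show ?thesis
      by (simp add: H_eq[abs_def] R0_scaleC linear_0 bounded_linear.linear[OF R0_linear])
  qed
  from has_integral_half_line[OF dH H0 this]
  have 1: "((\<lambda>t. (of_real \<mu> - l) *\<^sub>C R0 (exp (- l * of_real t) *\<^sub>C T t x) - exp (- l * of_real t) *\<^sub>C T t x)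
      has_integral (0 - R0 x)) {0<..}" .
  have "((\<lambda>t. (of_real \<mu> - l) *\<^sub>C R0 (exp (- l * of_real t) *\<^sub>C T t x)) has_integral (of_real \<mu> - l) *\<^sub>C R0 (Q l x)) {0<..}"
    using has_integral_linear[OF Q_integrable[OF l]
        bounded_linear_compose[OF scaleC.bounded_linear_right R0_linear]] by (simp add: o_def)
  from has_integral_unique[OF 1 has_integral_diff[OF this Q_integrable[OF l]]]
  show ?thesis by (simp add: algebra_simps)
qed

end

text \<open>The rate \<open>1 / t\<close> of the derivative near time 0 is the trace of holomorphy
  on the real axis.\<close>

locale analytic_semigroup = smooth_semigroup +
  assumes T'_bound: "t > 0 \<Longrightarrow> norm (T' t x) \<le> M * exp (\<omega> * t) / t * norm x"
begin

lemma T''_bound: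
  assumes t: "t > 0"
  shows "norm (T'' t x) \<le> 4 * M^2 * exp (\<omega> * t) / t^2 * norm x"
proof -
  have "norm (T'' t x) \<le> M * exp (\<omega> * (t / 2)) / (t / 2) * norm (T' (t / 2) x)"
    unfolding T''_def using t by (intro T'_bound) simp
  also have "\<dots> \<le> M * exp (\<omega> * (t / 2)) / (t / 2) * (M * exp (\<omega> * (t / 2)) / (t / 2) * norm x)"
    using t M by (intro mult_left_mono T'_bound) auto
  also have "\<dots> = 4 * M^2 * (exp (\<omega> * (t / 2)) * exp (\<omega> * (t / 2))) / t^2 * norm x"
    using t by (simp add: power2_eq_square field_simps)
  also have "exp (\<omega> * (t / 2)) * exp (\<omega> * (t / 2)) = exp (\<omega> * t)"
    by (simp add: exp_add[symmetric])
  finally show ?thesis .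
qed

text \<open>Near \<open>0\<close> the integrand is bounded; beyond \<open>1 / |l|\<close> two integrations by parts turn
  the bounds on \<open>t T'\<close> and \<open>t^2 T''\<close> into decay in \<open>l\<close>.\<close>
lemma Q_bound:
  assumes l: "Re l > \<omega>"
  shows "norm (Q l x) \<le> (3 * M + 4 * M^2) / cmod l * norm x"
proof -
  have l0: "l \<noteq> 0" using l \<omega> by auto
  define a where "a = 1 / cmod l"
  have a: "a > 0" using l0 by (simp add: a_def)
  define f where "f t = exp (- l * of_real t) *\<^sub>C T t x" for t
  have "continuous_on {0<..} f"
    unfolding f_def by (intro scaleC.continuous_on continuous_intros T_continuous)
  then obtain F where F: "\<And>t. t > 0 \<Longrightarrow> (F has_vector_derivative f t) (at t)"
    using half_line_primitive by blast
  have decay: "exp (- Re l * t) * exp (\<omega> * t) \<le> 1" if "t > 0" for t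
  proof -
    have "exp (- Re l * t) * exp (\<omega> * t) = exp (- ((Re l - \<omega>) * t))"
      by (simp add: exp_add[symmetric] algebra_simps)
    also have "\<dots> \<le> 1" using l that by simp
    finally show ?thesis .
  qed
  have scale: "norm (exp (- l * of_real t) *\<^sub>C y) \<le> K" if "t > 0" "norm y \<le> K * exp (\<omega> * t)" "K \<ge> 0" for t y K
  proof -
    have "norm (exp (- l * of_real t) *\<^sub>C y) = exp (- Re l * t) * norm y" by (simp add: norm_scaleC)
    also have "\<dots> \<le> exp (- Re l * t) * (K * exp (\<omega> * t))" using that by (intro mult_left_mono) auto
    also have "\<dots> = K * (exp (- Re l * t) * exp (\<omega> * t))" by simp
    also have "\<dots> \<le> K * 1" by (intro mult_left_mono decay that)
    finally show ?thesis by simp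
  qed
  have fb: "norm (f t) \<le> M * norm x" if "t > 0" for t
    unfolding f_def using T_bound[OF that, of x] M that by (intro scale) (auto simp: mult_ac)
  have "norm (F t - F s) \<le> M * norm x * t - M * norm x * s" if "0 < s" "s \<le> t" for s t
    by (rule vector_mean_value[OF F _ fb that]) (auto intro!: derivative_eq_intros)
  moreover have "((\<lambda>t. M * norm x * t) \<longlongrightarrow> M * norm x * 0) (at_right 0)" by (intro tendsto_intros)
  ultimately obtain k where k: "(F \<longlongrightarrow> k) (at_right 0)" "\<And>t. t > 0 \<Longrightarrow> norm (F t - k) \<le> M * norm x * t - M * norm x * 0"
    by (rule limit_at_right_0_dominated) auto
  \<comment> \<open>Boundary terms of two integrations by parts, arranged so that
    \<open>F + p\<close> has the derivative \<open>g\<close>, of order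
    \<open>1 / (cmod l * t)^2\<close>.\<close>
  define p where "p t = exp (- l * of_real t) *\<^sub>C (inverse l *\<^sub>C T t x + inverse (l^2) *\<^sub>C T' t x)" for t
  define H where "H t = F t + p t" for t
  define g where "g t = exp (- l * of_real t) *\<^sub>C inverse (l^2) *\<^sub>C T'' t x" for t
  have H: "(H has_vector_derivative g t) (at t)" if t: "t > 0" for t
  proof -
    have "((\<lambda>t. inverse l *\<^sub>C T t x + inverse (l^2) *\<^sub>C T' t x) has_vector_derivative
        inverse l *\<^sub>C T' t x + inverse (l^2) *\<^sub>C T'' t x) (at t)"
      by (intro has_vector_derivative_add bounded_linear.has_vector_derivative[OF scaleC.bounded_linear_right]
          derivative second_derivative t)
    from scaleC.has_vector_derivative[OF exp_derivative[of "- l" t] this]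
    have "(H has_vector_derivative f t + (exp (- l * of_real t) *\<^sub>C (inverse l *\<^sub>C T' t x + inverse (l^2) *\<^sub>C T'' t x)
        + (- l * exp (- l * of_real t)) *\<^sub>C (inverse l *\<^sub>C T t x + inverse (l^2) *\<^sub>C T' t x))) (at t)"
      unfolding H_def[abs_def] p_def[abs_def] by (intro has_vector_derivative_add F t)
    moreover have "(- l * exp (- l * of_real t)) *\<^sub>C (inverse l *\<^sub>C T t x + inverse (l^2) *\<^sub>C T' t x) =
        exp (- l * of_real t) *\<^sub>C (- T t x - inverse l *\<^sub>C T' t x)"
    proof -
      have "(- l * exp (- l * of_real t)) *\<^sub>C (inverse l *\<^sub>C T t x + inverse (l^2) *\<^sub>C T' t x) =
          exp (- l * of_real t) *\<^sub>C ((- l * inverse l) *\<^sub>C T t x + (- l * inverse (l^2)) *\<^sub>C T' t x)"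
        by (simp only: scaleC_add_right scaleC_scaleC mult_ac)
      moreover have "- l * inverse l = - 1" "- l * inverse (l^2) = - inverse l"
        using l0 by (simp_all add: power2_eq_square)
      ultimately show ?thesis by (simp only:) (simp add: scaleC.minus_left)
    qed
    ultimately show ?thesis
      by (simp add: f_def g_def scaleC_add_right scaleC.diff_right scaleC.minus_right)
  qed
  define C where "C = 4 * M^2 * norm x / (cmod l)^2"
  have C: "C \<ge> 0" by (simp add: C_def)
  have gb: "norm (g t) \<le> C / t^2" if t: "t > 0" for t
    unfolding g_def
  proof (rule scale[OF t])
    show "norm (inverse (l^2) *\<^sub>C T'' t x) \<le> C / t^2 * exp (\<omega> * t)"
      using mult_left_mono[OF T''_bound[OF t, of x], of "inverse (cmod (l^2))"]
      by (simp add: norm_scaleC norm_inverse norm_power norm_divide C_def field_simps)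
  qed (use C in auto)
  have "norm (H t - H s) \<le> - C / t - - C / s" if "0 < s" "s \<le> t" for s t
    by (rule vector_mean_value[OF H _ gb that])
      (auto intro!: derivative_eq_intros simp: power2_eq_square field_simps)
  moreover have "((\<lambda>t. - C / t) \<longlongrightarrow> 0) at_top"
    by (intro tendsto_divide_0[OF tendsto_const] filterlim_at_top_imp_at_infinity filterlim_ident)
  ultimately obtain L where L: "(H \<longlongrightarrow> L) at_top" "\<And>t. t > 0 \<Longrightarrow> norm (L - H t) \<le> 0 - - C / t"
    by (rule limit_at_top_dominated) auto
  have pb: "norm (p t) \<le> (M / cmod l + M / ((cmod l)^2 * t)) * norm x * exp (- (Re l - \<omega>) * t)" if t: "t > 0" for t
  proof -
    have "norm (inverse l *\<^sub>C T t x + inverse (l^2) *\<^sub>C T' t x) \<le>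
        norm (inverse l *\<^sub>C T t x) + norm (inverse (l^2) *\<^sub>C T' t x)" by (rule norm_triangle_ineq)
    also have "\<dots> \<le> inverse (cmod l) * (M * exp (\<omega> * t) * norm x) + inverse ((cmod l)^2) * (M * exp (\<omega> * t) / t * norm x)"
      unfolding norm_scaleC norm_inverse norm_power
      by (intro add_mono mult_left_mono T_bound T'_bound t) auto
    also have "\<dots> = (M / cmod l + M / ((cmod l)^2 * t)) * norm x * exp (\<omega> * t)"
      using t l0 by (simp add: field_simps)
    finally have "exp (- Re l * t) * norm (inverse l *\<^sub>C T t x + inverse (l^2) *\<^sub>C T' t x) \<le>
        exp (- Re l * t) * ((M / cmod l + M / ((cmod l)^2 * t)) * norm x * exp (\<omega> * t))"
      by (intro mult_left_mono) auto
    also have "\<dots> = (M / cmod l + M / ((cmod l)^2 * t)) * norm x * (exp (- Re l * t) * exp (\<omega> * t))"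
      by (simp only: mult_ac)
    also have "exp (- Re l * t) * exp (\<omega> * t) = exp (- (Re l - \<omega>) * t)"
      by (simp add: exp_add[symmetric] algebra_simps)
    finally show ?thesis by (simp add: p_def norm_scaleC)
  qed
  have "(p \<longlongrightarrow> 0) at_top"
  proof (rule Lim_null_comparison)
    show "\<forall>\<^sub>F t in at_top. norm (p t) \<le> (M / cmod l + M / (cmod l)^2) * norm x * exp (- (Re l - \<omega>) * t)"
      using eventually_ge_at_top[of 1]
    proof eventually_elim
      fix t :: real assume t: "t \<ge> 1"
      have "(cmod l)^2 * 1 \<le> (cmod l)^2 * t" using t by (intro mult_left_mono) auto
      then have "M / ((cmod l)^2 * t) \<le> M / (cmod l)^2" using M l0 t by (intro divide_left_mono) auto
      then have "(M / cmod l + M / ((cmod l)^2 * t)) * norm x * exp (- (Re l - \<omega>) * t) \<le>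
          (M / cmod l + M / (cmod l)^2) * norm x * exp (- (Re l - \<omega>) * t)"
        by (intro mult_right_mono) auto
      with pb[of t] t show "norm (p t) \<le> (M / cmod l + M / (cmod l)^2) * norm x * exp (- (Re l - \<omega>) * t)" by simp
    qed
  qed (use l in \<open>intro exp_decay_tendsto_0; simp\<close>)
  from tendsto_diff[OF L(1) this] have top: "(F \<longlongrightarrow> L) at_top" by (simp add: H_def[abs_def])
  have "(f has_integral Q l x) {0<..}"
    using Q_integrable[OF l, of x] by (simp add: f_def[abs_def])
  from this has_integral_half_line[OF F k(1) top] have "Q l x = L - k"
    by (rule has_integral_unique)
  also have "norm (L - k) \<le> norm (L - H a) + norm (p a) + norm (F a - k)"
    using norm_triangle_ineq[of "L - H a" "p a + (F a - k)"] norm_triangle_ineq[of "p a" "F a - k"]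
    by (simp add: H_def)
  \<comment> \<open>With \<open>a = 1 / cmod l\<close> the three terms are, in multiples of
    \<open>norm x / cmod l\<close>, the tail \<open>4 * M^2\<close>, the boundary term
    \<open>2 * M\<close> and the initial piece \<open>M\<close>.\<close>
  also have "\<dots> \<le> C / a + (M / cmod l + M / ((cmod l)^2 * a)) * norm x + M * norm x * a"
  proof (intro add_mono)
    show "norm (L - H a) \<le> C / a" using L(2)[OF a] by simp
    show "norm (F a - k) \<le> M * norm x * a" using k(2)[OF a] by simp
    have "exp (- (Re l - \<omega>) * a) \<le> 1" using l a by (simp add: mult_nonpos_nonneg)
    then have "(M / cmod l + M / ((cmod l)^2 * a)) * norm x * exp (- (Re l - \<omega>) * a) \<le>
        (M / cmod l + M / ((cmod l)^2 * a)) * norm x * 1"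
      using M a by (intro mult_left_mono) auto
    with pb[OF a] show "norm (p a) \<le> (M / cmod l + M / ((cmod l)^2 * a)) * norm x" by simp
  qed
  also have "\<dots> = (3 * M + 4 * M^2) / cmod l * norm x"
    using l0 by (simp add: a_def C_def power2_eq_square field_simps)
  finally show ?thesis .
qed

end

text \<open>For \<open>G\<close> linear on a subspace \<open>E\<close> this amounts to
  \<open>l\<close> lying in the resolvent set with resolvent bounded by \<open>K\<close>.
  Solvability and the a priori bound stand side by side, so neither refers to an inverse.\<close>

definition resolvent_estimate ::
    "'x::complex_normed_vector set \<Rightarrow> ('x \<Rightarrow> 'x) \<Rightarrow> complex \<Rightarrow> real \<Rightarrow> bool" where
  "resolvent_estimate E G l K \<longleftrightarrow>
     (\<forall>y. \<exists>u\<in>E. l *\<^sub>C u - G u = y) \<and> (\<forall>u\<in>E. norm u \<le> K * norm (l *\<^sub>C u - G u))"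

section \<open>From a holomorphic extension to bounds in real time and resolvent estimates\<close>

lemma operator_derivative_pointwise:
  assumes hol: "operator_holomorphic_on UNIV S U" and z: "z \<in> U" and nhd: "open W" "z \<in> W" "W \<subseteq> U"
    and L: "bounded_clinear_on UNIV UNIV L"
      "((\<lambda>w. onorm_on UNIV (\<lambda>x. inverse (w - z) *\<^sub>C (S w x - S z x) - L x)) \<longlongrightarrow> 0) (at z)"
  shows "((\<lambda>w. inverse (w - z) *\<^sub>C (S w x - S z x)) \<longlongrightarrow> L x) (at z)"
proof (rule Lim_null_comparison[THEN Lim_null[THEN iffD2]])
  have "\<forall>\<^sub>F w in at z. w \<in> W" using nhd by (intro eventually_at_in_open')
  then show "\<forall>\<^sub>F w in at z. norm (inverse (w - z) *\<^sub>C (S w x - S z x) - L x) \<le>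
      onorm_on UNIV (\<lambda>x. inverse (w - z) *\<^sub>C (S w x - S z x) - L x) * norm x"
  proof eventually_elim
    case (elim w)
    have b: "bounded_clinear_on UNIV UNIV (S w)" "bounded_clinear_on UNIV UNIV (S z)"
      using hol elim nhd z by (auto simp: operator_holomorphic_on_def)
    have lin: "bounded_linear (S w)" "bounded_linear (S z)" "bounded_linear L"
      using b L by (auto simp: bounded_clinear_on_UNIV_iff)
    have "bounded_clinear_on UNIV UNIV (\<lambda>x. inverse (w - z) *\<^sub>C (S w x - S z x) - L x)"
      unfolding bounded_clinear_on_UNIV_iff
    proof
      show "bounded_linear (\<lambda>x. inverse (w - z) *\<^sub>C (S w x - S z x) - L x)"
        by (intro bounded_linear_sub lin bounded_linear_compose[OF scaleC.bounded_linear_right])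
      show "\<forall>c x. inverse (w - z) *\<^sub>C (S w (c *\<^sub>C x) - S z (c *\<^sub>C x)) - L (c *\<^sub>C x) =
          c *\<^sub>C (inverse (w - z) *\<^sub>C (S w x - S z x) - L x)"
        using b L by (auto simp: bounded_clinear_on_UNIV_iff scaleC.diff_right scaleC_scaleC mult.commute)
    qed
    then show ?case by (rule norm_le_onorm_on) simp
  qed
  show "((\<lambda>w. onorm_on UNIV (\<lambda>x. inverse (w - z) *\<^sub>C (S w x - S z x) - L x) * norm x) \<longlongrightarrow> 0) (at z)"
    using tendsto_mult[OF L(2) tendsto_const[of "norm x"]] by simp
qed

lemma complex_derivative_along_reals:
  fixes f :: "complex \<Rightarrow> 'x::complex_normed_vector"
  assumes "((\<lambda>w. inverse (w - of_real t) *\<^sub>C (f w - f (of_real t))) \<longlongrightarrow> D) (at (of_real t))"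
  shows "((\<lambda>t. f (of_real t)) has_vector_derivative D) (at t)"
proof -
  have "filterlim complex_of_real (at (of_real t)) (at t)"
    unfolding filterlim_at by (auto intro!: tendsto_intros simp: eventually_at_filter)
  from filterlim_compose[OF assms this]
  have "((\<lambda>s. (f (of_real s) - f (of_real t)) /\<^sub>R (s - t)) \<longlongrightarrow> D) (at t)"
    by (simp add: scaleR_scaleC)
  then have "((\<lambda>s. (f (of_real s) - f (of_real t)) /\<^sub>R (s - t) - D) \<longlongrightarrow> 0) (at t)"
    by (simp add: LIM_zero)
  \<comment> \<open>The factor \<open>sgn\<close> turns the divisor \<open>s - t\<close> into its
    absolute value, the form in which the derivative is defined.\<close>
  then have "((\<lambda>s. sgn (s - t) *\<^sub>R ((f (of_real s) - f (of_real t)) /\<^sub>R (s - t) - D)) \<longlongrightarrow> 0) (at t)"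
    by (rule tendsto_0_le[where K = 1]) (auto simp: abs_sgn_eq)
  then have "((\<lambda>s. (f (of_real s) - f (of_real t) - (s - t) *\<^sub>R D) /\<^sub>R \<bar>s - t\<bar>) \<longlongrightarrow> 0) (at t)"
  proof (rule Lim_transform_eventually)
    have *: "sgn h *\<^sub>R (y /\<^sub>R h - D) = (y - h *\<^sub>R D) /\<^sub>R \<bar>h\<bar>" if "h \<noteq> 0" for h :: real and y
      using that by (auto simp: sgn_if abs_if scaleR_diff_right)
    show "\<forall>\<^sub>F s in at t. sgn (s - t) *\<^sub>R ((f (of_real s) - f (of_real t)) /\<^sub>R (s - t) - D) =
        (f (of_real s) - f (of_real t) - (s - t) *\<^sub>R D) /\<^sub>R \<bar>s - t\<bar>"
      using eventually_neq_at_within[of t] by eventually_elim (rule *, simp)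
  qed
  then show ?thesis
    unfolding has_vector_derivative_def has_derivative_at_within
    by (simp add: bounded_linear_scaleR_left)
qed

text \<open>A radius proportional to \<open>t\<close> is what turns Cauchy's estimate into a bound
  of order \<open>1 / t\<close> for the derivative.\<close>

lemma ball_in_sector:
  assumes "0 < \<theta>"
  shows "\<exists>k>0. k \<le> 1 / 2 \<and> (\<forall>t>0. ball (of_real t) (k * t) \<subseteq> sector \<theta>)"
proof -
  \<comment> \<open>Capping the angle keeps \<open>tan \<psi>\<close> positive and finite also when
    \<open>\<theta>\<close> is \<open>pi / 2\<close>.\<close>
  define \<psi> where "\<psi> = min \<theta> (pi / 4)"
  have "\<psi> \<le> pi / 4" by (simp add: \<psi>_def)
  then have "\<psi> < pi / 2" using pi_gt_zero by linarith
  moreover have "0 < \<psi>" "\<psi> \<le> \<theta>" using assms by (auto simp: \<psi>_def)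
  ultimately have \<psi>: "0 < \<psi>" "\<psi> < pi / 2" "\<psi> \<le> \<theta>" by auto
  define k where "k = min (1 / 2) (tan \<psi> / 2)"
  have tan: "tan \<psi> > 0" using \<psi> by (intro tan_gt_zero) auto
  show ?thesis
  proof (intro exI[of _ k] conjI allI impI)
    show "0 < k" "k \<le> 1 / 2" using tan by (auto simp: k_def)
    fix t :: real assume t: "t > 0"
    show "ball (of_real t) (k * t) \<subseteq> sector \<theta>"
    proof
      fix z :: complex assume "z \<in> ball (of_real t) (k * t)"
      then have d: "cmod (z - of_real t) < k * t" by (simp add: dist_norm norm_minus_commute)
      have "k * t \<le> 1 / 2 * t" "k * t \<le> tan \<psi> / 2 * t"
        using t by (auto simp: k_def intro!: mult_right_mono)
      then have "k * t \<le> t / 2" "k * t \<le> tan \<psi> * (t / 2)" by simp_all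
      moreover have "\<bar>Re z - t\<bar> < k * t" "\<bar>Im z\<bar> < k * t"
        using d abs_Re_le_cmod[of "z - of_real t"] abs_Im_le_cmod[of "z - of_real t"] by auto
      ultimately have Re: "Re z > t / 2" and Im: "\<bar>Im z\<bar> < tan \<psi> * (t / 2)" by linarith+
      have "tan \<psi> * (t / 2) < tan \<psi> * Re z" using Re tan by (intro mult_strict_left_mono)
      with Re Im t have "z \<in> sector \<psi>" by (intro in_sectorI \<psi>) auto
      then show "z \<in> sector \<theta>" using \<psi>(3) unfolding sector_def by (auto intro: less_le_trans)
    qed
  qed
qed

lemma real_in_sector: "0 < \<theta> \<Longrightarrow> t > 0 \<Longrightarrow> of_real t \<in> sector \<theta>"
  unfolding sector_def using rcis_zero_arg[of t] by (metis (mono_tags, lifting) abs_zero mem_Collect_eq)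

text \<open>Up to time \<open>1 / 2\<close> the Cauchy discs lie in the unit disc, where the
  extension is bounded, and bound \<open>T'\<close> by a multiple of \<open>1 / t\<close>; later
  times are reduced to \<open>T' (1 / 2)\<close> by the semigroup law. The Laplace transform is then
  a two-sided inverse of \<open>l - G\<close> with the required bound.\<close>

lemma holomorphic_generator_half_plane:
  fixes T :: "real \<Rightarrow> 'x::complex_banach \<Rightarrow> 'x"
  assumes hol: "holomorphic_semigroup_on UNIV T" and gen: "generator_on UNIV E G T"
  shows "\<exists>\<omega>>0. \<exists>M>0. \<forall>l. Re l > \<omega> \<longrightarrow> resolvent_estimate E G l (M / cmod l)"
proof -
  obtain \<theta> S where *: "0 < \<theta> \<and> (\<forall>t>0. \<forall>x. S (of_real t) x = T t x) \<and>
      operator_holomorphic_on UNIV S (sector \<theta>) \<and>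
      (\<exists>C. \<forall>z\<in>sector \<theta> \<inter> cball 0 1. onorm_on UNIV (S z) \<le> C)"
    using hol unfolding holomorphic_semigroup_on_def by auto
  then have \<theta>: "0 < \<theta>" and ST: "\<And>t x. t > 0 \<Longrightarrow> S (of_real t) x = T t x"
    and op: "operator_holomorphic_on UNIV S (sector \<theta>)" by auto
  from * obtain C where C: "\<And>z. z \<in> sector \<theta> \<inter> cball 0 1 \<Longrightarrow> onorm_on UNIV (S z) \<le> C" by blast
  have sg: "\<And>t. t > 0 \<Longrightarrow> bounded_clinear_on UNIV UNIV (T t)"
    "\<And>t s x. t > 0 \<Longrightarrow> s > 0 \<Longrightarrow> T (t + s) x = T t (T s x)"
    using hol by (auto simp: holomorphic_semigroup_on_def semigroup_on_def)
  obtain \<omega>0 M0 where \<omega>0: "M0 > 0" "\<And>t. t > 0 \<Longrightarrow> onorm_on UNIV (T t) \<le> M0 * exp (\<omega>0 * t)"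
    and res: "\<And>\<mu>. \<mu> > \<omega>0 \<Longrightarrow> of_real \<mu> \<in> resolvent_set UNIV E G"
    and lap: "\<And>\<mu> x. \<mu> > \<omega>0 \<Longrightarrow> ((\<lambda>t. exp (- \<mu> * t) *\<^sub>R T t x) has_integral
                  resolvent E G (of_real \<mu>) x) {0<..}"
    using gen unfolding generator_on_def growth_bound_on_def by blast
  define \<omega>1 where "\<omega>1 = max \<omega>0 0"
  have Tb: "norm (T t x) \<le> M0 * exp (\<omega>1 * t) * norm x" if t: "t > 0" for t x
  proof -
    have "norm (T t x) \<le> onorm_on UNIV (T t) * norm x" by (rule norm_le_onorm_on[OF sg(1)[OF t]]) simp
    also have "\<dots> \<le> M0 * exp (\<omega>0 * t) * norm x" by (intro mult_right_mono \<omega>0 t) simp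
    also have "\<dots> \<le> M0 * exp (\<omega>1 * t) * norm x"
      using \<omega>0(1) t by (intro mult_right_mono mult_left_mono) (auto simp: \<omega>1_def)
    finally show ?thesis .
  qed
  have "\<forall>z\<in>sector \<theta>. \<exists>L. bounded_clinear_on UNIV UNIV L \<and>
        ((\<lambda>w. onorm_on UNIV (\<lambda>x. inverse (w - z) *\<^sub>C (S w x - S z x) - L x)) \<longlongrightarrow> 0) (at z)"
    using op unfolding operator_holomorphic_on_def by simp
  from bchoice[OF this] obtain L where "\<forall>z\<in>sector \<theta>. bounded_clinear_on UNIV UNIV (L z) \<and>
        ((\<lambda>w. onorm_on UNIV (\<lambda>x. inverse (w - z) *\<^sub>C (S w x - S z x) - L z x)) \<longlongrightarrow> 0) (at z)" ..
  then have L: "\<And>z. z \<in> sector \<theta> \<Longrightarrow> bounded_clinear_on UNIV UNIV (L z)"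
    "\<And>z. z \<in> sector \<theta> \<Longrightarrow>
        ((\<lambda>w. onorm_on UNIV (\<lambda>x. inverse (w - z) *\<^sub>C (S w x - S z x) - L z x)) \<longlongrightarrow> 0) (at z)"
    by simp_all
  obtain k where k: "0 < k" "k \<le> 1 / 2" "\<And>t. t > 0 \<Longrightarrow> ball (of_real t) (k * t) \<subseteq> sector \<theta>"
    using ball_in_sector[OF \<theta>] by blast
  have Ld: "((\<lambda>w. inverse (w - z) *\<^sub>C (S w x - S z x)) \<longlongrightarrow> L z x) (at z)"
    if "t > 0" "z \<in> ball (of_real t) (k * t)" for t z x
  proof -
    have z: "z \<in> sector \<theta>" using that k(3) by blast
    show ?thesis
      by (rule operator_derivative_pointwise[OF op z open_ball that(2) k(3)[OF that(1)] L(1)[OF z] L(2)[OF z]])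
  qed
  define T' where "T' t = L (of_real t)" for t
  have der: "((\<lambda>t. T t x) has_vector_derivative T' t x) (at t)" if t: "t > 0" for t x
  proof -
    have "((\<lambda>t. S (of_real t) x) has_vector_derivative T' t x) (at t)"
      unfolding T'_def by (rule complex_derivative_along_reals, rule Ld[OF t]) (use t k in simp)
    then show ?thesis
      by (rule has_vector_derivative_transform_within_open[of _ _ _ "{0<..}"]) (use t ST in auto)
  qed
  define C' where "C' = max C 1"
  have small: "norm (T' t x) \<le> 4 * C' / (k * t) * norm x" if t: "t > 0" "t \<le> 1 / 2" for t x
  proof -
    have "norm (L (of_real t) x) \<le> 4 * (C' * norm x) / (k * t)"
    proof (rule Cauchy_derivative_bound[where f = "\<lambda>z. S z x" and f' = "\<lambda>z. L z x"])
      show "k * t > 0" using k t by simp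
      fix w assume w: "w \<in> ball (complex_of_real t) (k * t)"
      show "((\<lambda>v. inverse (v - w) *\<^sub>C (S v x - S w x)) \<longlongrightarrow> L w x) (at w)" by (rule Ld[OF t(1) w])
      have "k * t \<le> 1 / 2 * t" using k t by (intro mult_right_mono) auto
      moreover have "cmod (w - of_real t) < k * t" using w by (simp add: dist_norm norm_minus_commute)
      moreover have "cmod w \<le> cmod (w - of_real t) + t"
        using norm_triangle_ineq[of "w - of_real t" "of_real t"] t by simp
      ultimately have "cmod w \<le> 1" using t by linarith
      then have "onorm_on UNIV (S w) \<le> C'" using C[of w] w k(3)[OF t(1)] by (auto simp: C'_def)
      moreover have "norm (S w x) \<le> onorm_on UNIV (S w) * norm x"
        using op w k(3)[OF t(1)] by (intro norm_le_onorm_on[of UNIV UNIV]) (auto simp: operator_holomorphic_on_def)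
      ultimately show "norm (S w x) \<le> C' * norm x"
        using mult_right_mono[of "onorm_on UNIV (S w)" C' "norm x"] by simp
    qed
    then show ?thesis by (simp add: T'_def)
  qed
  \<comment> \<open>The extra unit of growth absorbs a factor \<open>t\<close>, since
    \<open>t \<le> exp t\<close>.\<close>
  define \<omega> where "\<omega> = \<omega>1 + 1"
  \<comment> \<open>The three entries serve \<open>T\<close>, \<open>T'\<close> at times up to
    \<open>1 / 2\<close>, and \<open>T'\<close> at later times.\<close>
  define M where "M = max M0 (max (4 * C' / k) (8 * C' / k * M0))"
  have M_ge: "M > 0" "M0 \<le> M" "4 * C' / k \<le> M" "8 * C' / k * M0 \<le> M" using \<omega>0 by (auto simp: M_def)
  have \<omega>: "\<omega> > 0" by (simp add: \<omega>_def \<omega>1_def)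
  interpret smooth_semigroup T T' \<omega> M
  proof
    show "bounded_clinear_on UNIV UNIV (T' t)" if "t > 0" for t
      unfolding T'_def by (rule L(1)[OF real_in_sector[OF \<theta> that]])
    show "norm (T t x) \<le> M * exp (\<omega> * t) * norm x" if "t > 0" for t x
    proof -
      have "M0 * exp (\<omega>1 * t) * norm x \<le> M * exp (\<omega> * t) * norm x"
        using M_ge that by (intro mult_right_mono mult_mono) (auto simp: \<omega>_def)
      with Tb[OF that, of x] show ?thesis by simp
    qed
  qed (use sg der \<omega> M_ge in auto)
  have "norm (T' t x) \<le> M * exp (\<omega> * t) / t * norm x" if t: "t > 0" for t x
  proof (cases "t \<le> 1 / 2")
    case True
    have "norm (T' t x) \<le> 4 * C' / (k * t) * norm x" by (rule small[OF t True])
    also have "4 * C' / (k * t) = (4 * C' / k) * 1 / t" by simp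
    also have "(4 * C' / k) * 1 / t * norm x \<le> M * exp (\<omega> * t) / t * norm x"
      using M_ge \<omega> t by (intro mult_right_mono divide_right_mono mult_mono) auto
    finally show ?thesis .
  next
    case False
    have C'0: "8 * C' / k \<ge> 0" using k by (simp add: C'_def)
    have "T' t x = T' (1 / 2) (T (t - 1 / 2) x)"
      using T'_add(1)[of "1 / 2" "t - 1 / 2" x] False by simp
    then have "norm (T' t x) \<le> 8 * C' / k * norm (T (t - 1 / 2) x)"
      using small[of "1 / 2" "T (t - 1 / 2) x"] by simp
    also have "\<dots> \<le> 8 * C' / k * (M0 * exp (\<omega>1 * (t - 1 / 2)) * norm x)"
      using C'0 False by (intro mult_left_mono Tb) auto
    also have "\<dots> = (8 * C' / k * M0) * exp (\<omega>1 * (t - 1 / 2)) * norm x" by simp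
    also have "\<dots> \<le> M * (exp (\<omega> * t) / t) * norm x"
    proof (intro mult_right_mono mult_mono)
      have "t \<le> exp t" using exp_ge_add_one_self[of t] by linarith
      have "exp (\<omega>1 * (t - 1 / 2)) * t \<le> exp (\<omega>1 * t) * exp t"
        using \<open>t \<le> exp t\<close> t by (intro mult_mono) (auto simp: \<omega>1_def intro!: mult_left_mono)
      also have "\<dots> = exp (\<omega> * t)" by (simp add: \<omega>_def exp_add[symmetric] algebra_simps)
      finally show "exp (\<omega>1 * (t - 1 / 2)) \<le> exp (\<omega> * t) / t" using t by (simp add: field_simps)
    qed (use M_ge in auto)
    finally show ?thesis by simp
  qed
  then interpret analytic_semigroup T T' \<omega> M by unfold_locales
  \<comment> \<open>Beyond both thresholds: the Laplace formula of the generator holds above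
    \<open>\<omega>0\<close>, and the locale asks for a point above \<open>\<omega>\<close>.\<close>
  define \<mu> where "\<mu> = \<omega> + 1"
  have \<mu>: "\<mu> > \<omega>" "\<mu> > \<omega>0" by (auto simp: \<mu>_def \<omega>_def \<omega>1_def)
  define R0 where "R0 = resolvent E G (of_real \<mu>)"
  have bij: "bij_betw (\<lambda>u. of_real \<mu> *\<^sub>C u - G u) E UNIV" and R0c: "bounded_clinear_on UNIV UNIV R0"
    using res[OF \<mu>(2)] by (auto simp: resolvent_set_def R0_def)
  have R0_in: "R0 y \<in> E" and R0_eq: "of_real \<mu> *\<^sub>C R0 y - G (R0 y) = y" for y
    unfolding R0_def resolvent_def using bij
    by (auto simp: bij_betw_def intro!: inv_into_into f_inv_into_f[of y "\<lambda>u. of_real \<mu> *\<^sub>C u - G u" E])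
  have R0_inv: "R0 (of_real \<mu> *\<^sub>C u - G u) = u" if "u \<in> E" for u
    unfolding R0_def resolvent_def
    using inv_into_f_f[OF bij_betw_imp_inj_on[OF bij] that] .
  interpret smooth_semigroup_resolvent T T' \<omega> M R0 \<mu>
    by unfold_locales (use \<mu> R0c lap[OF \<mu>(2)] in \<open>auto simp: R0_def\<close>)
  have add: "R0 (x + y) = R0 x + R0 y" for x y
    using R0c by (simp add: bounded_clinear_on_def clinear_on_def)
  show ?thesis
  proof (rule exI[of _ \<omega>], rule conjI[OF \<omega>], rule exI[of _ "3 * M + 4 * M^2"], intro conjI allI impI)
    show "3 * M + 4 * M\<^sup>2 > 0" using M_ge(1) by (simp add: add_pos_nonneg)
    fix l assume l: "Re l > \<omega>"
    show "resolvent_estimate E G l ((3 * M + 4 * M\<^sup>2) / cmod l)"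
      unfolding resolvent_estimate_def
    proof (intro conjI allI ballI)
      fix y
      have q: "Q l y = R0 (y + (of_real \<mu> - l) *\<^sub>C Q l y)"
        using resolvent_equation[OF l, of y] by (simp add: add R0_scaleC)
      have "of_real \<mu> *\<^sub>C Q l y - G (Q l y) = y + (of_real \<mu> - l) *\<^sub>C Q l y"
        using R0_eq[of "y + (of_real \<mu> - l) *\<^sub>C Q l y"] by (simp flip: q)
      then have "l *\<^sub>C Q l y - G (Q l y) = y" by (simp add: scaleC.diff_left algebra_simps)
      moreover have "Q l y \<in> E" by (subst q) (rule R0_in)
      ultimately show "\<exists>u\<in>E. l *\<^sub>C u - G u = y" by blast
    next
      fix u assume u: "u \<in> E"
      define x where "x = of_real \<mu> *\<^sub>C u - G u"
      have ux: "u = R0 x" using R0_inv[OF u] by (simp add: x_def)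
      \<comment> \<open>Left inverse: since \<open>Q l\<close> commutes with \<open>R0\<close>,
        applying it to \<open>l u - G u\<close> with \<open>u = R0 x\<close> reproduces the
        resolvent equation.\<close>
      have "l *\<^sub>C u - G u = x + (l - of_real \<mu>) *\<^sub>C R0 x"
        by (simp add: x_def ux[unfolded x_def, symmetric] scaleC.diff_left)
      then have "Q l (l *\<^sub>C u - G u) = Q l x + (l - of_real \<mu>) *\<^sub>C R0 (Q l x)"
        by (simp add: Q_add Q_scaleC l R0_Q)
      also have "\<dots> = u"
        using resolvent_equation[OF l, of x] by (simp add: ux scaleC.diff_left algebra_simps)
      finally show "norm u \<le> (3 * M + 4 * M\<^sup>2) / cmod l * norm (l *\<^sub>C u - G u)"
        using Q_bound[OF l, of "l *\<^sub>C u - G u"] by simp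
    qed
  qed
qed

section \<open>Generation from resolvent estimates\<close>

text \<open>Neumann series as a Banach fixed point. The contraction lives on a closed set
  \<open>V\<close>, because \<open>\<Phi>\<close> acts on a closed subspace rather than on the whole
  space.\<close>

lemma contraction_fixed_point:
  fixes K :: "'x::complex_banach \<Rightarrow> 'x"
  assumes V: "closed V" and y: "y \<in> V"
    and K: "\<And>x. x \<in> V \<Longrightarrow> K x \<in> V" and add: "\<And>x x'. x \<in> V \<Longrightarrow> x' \<in> V \<Longrightarrow> x + x' \<in> V"
    and half: "\<And>x x'. x \<in> V \<Longrightarrow> x' \<in> V \<Longrightarrow> norm (K x - K x') \<le> 1 / 2 * norm (x - x')"
  obtains u where "u \<in> V" "u = y + K u"
proof -
  have "\<exists>!u\<in>V. y + K u = u"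
  proof (rule Banach_fix)
    show "complete V" using V by (simp add: complete_eq_closed)
    show "(\<lambda>u. y + K u) ` V \<subseteq> V" using y K add by auto
    show "dist (y + K x) (y + K x') \<le> 1 / 2 * dist x x'" if "x \<in> V" "x' \<in> V" for x x'
      using half[OF that] by (simp add: dist_norm)
  qed (use y in auto)
  then show ?thesis using that by metis
qed

text \<open>With \<open>u = R v\<close>, where \<open>R\<close> solves the equation at
  \<open>l\<close>, the equation at \<open>m\<close> becomes \<open>v = y + (l - m) R v\<close>, a
  contraction by one half. The a priori bound absorbs the same half, which doubles
  \<open>K\<close>.\<close>

lemma resolvent_estimate_perturb:
  fixes E :: "'x::complex_banach set"
  assumes E: "complex_vector.subspace E" and G: "clinear_on E UNIV G"
    and l: "resolvent_estimate E G l K" and m: "cmod (m - l) * K \<le> 1 / 2" and K: "K \<ge> 0"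
  shows "resolvent_estimate E G m (2 * K)"
  unfolding resolvent_estimate_def
proof (intro conjI allI ballI)
  have ex: "\<exists>u\<in>E. l *\<^sub>C u - G u = y" and le: "u \<in> E \<Longrightarrow> norm u \<le> K * norm (l *\<^sub>C u - G u)" for y u
    using l by (auto simp: resolvent_estimate_def)
  define R where "R y = (SOME u. u \<in> E \<and> l *\<^sub>C u - G u = y)" for y
  have R: "R y \<in> E" "l *\<^sub>C R y - G (R y) = y" for y
    using someI_ex[of "\<lambda>u. u \<in> E \<and> l *\<^sub>C u - G u = y"] ex[of y] unfolding R_def by auto
  have sub: "a - b \<in> E" if "a \<in> E" "b \<in> E" for a b
    using complex_vector.subspace_diff[OF E that] .
  have G_diff: "G (a - b) = G a - G b" if "a \<in> E" "b \<in> E" for a b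
  proof -
    have "G ((a - b) + b) = G (a - b) + G b"
      using G sub[OF that] that unfolding clinear_on_def by blast
    then show ?thesis by simp
  qed
  have R_diff: "norm (R a - R b) \<le> K * norm (a - b)" for a b
  proof -
    have "l *\<^sub>C (R a - R b) - G (R a - R b) = a - b"
      using R[of a] R[of b] by (simp add: G_diff scaleC.diff_right algebra_simps)
    then show ?thesis using le[OF sub[OF R(1) R(1)]] by metis
  qed
  fix y
  obtain v where v: "v = y + (l - m) *\<^sub>C R v"
  proof (rule contraction_fixed_point[of UNIV y "\<lambda>v. (l - m) *\<^sub>C R v"])
    fix a b :: 'x
    have "norm ((l - m) *\<^sub>C R a - (l - m) *\<^sub>C R b) = cmod (m - l) * norm (R a - R b)"
      by (simp add: norm_scaleC norm_minus_commute flip: scaleC.diff_right)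
    also have "\<dots> \<le> cmod (m - l) * (K * norm (a - b))" by (intro mult_left_mono R_diff) simp
    also have "\<dots> = (cmod (m - l) * K) * norm (a - b)" by simp
    also have "\<dots> \<le> 1 / 2 * norm (a - b)" by (intro mult_right_mono m) simp
    finally show "norm ((l - m) *\<^sub>C R a - (l - m) *\<^sub>C R b) \<le> 1 / 2 * norm (a - b)" .
  qed auto
  have "m *\<^sub>C R v - G (R v) = v + (m - l) *\<^sub>C R v"
    using R(2)[of v] by (simp add: scaleC.diff_left algebra_simps)
  also have "\<dots> = y" using v by (simp add: scaleC.diff_left algebra_simps)
  finally show "\<exists>u\<in>E. m *\<^sub>C u - G u = y" using R(1) by blast
next
  fix u assume u: "u \<in> E"
  have "norm u \<le> K * norm (l *\<^sub>C u - G u)" using l u by (auto simp: resolvent_estimate_def)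
  also have "l *\<^sub>C u - G u = (m *\<^sub>C u - G u) - (m - l) *\<^sub>C u" by (simp add: scaleC.diff_left)
  also have "K * norm \<dots> \<le> K * (norm (m *\<^sub>C u - G u) + cmod (m - l) * norm u)"
    using norm_triangle_ineq4[of "m *\<^sub>C u - G u" "(m - l) *\<^sub>C u"] K
    by (intro mult_left_mono) (simp_all add: norm_scaleC)
  also have "\<dots> = K * norm (m *\<^sub>C u - G u) + (cmod (m - l) * K) * norm u" by (simp add: algebra_simps)
  also have "\<dots> \<le> K * norm (m *\<^sub>C u - G u) + 1 / 2 * norm u"
    by (intro add_left_mono mult_right_mono m) simp
  finally show "norm u \<le> 2 * K * norm (m *\<^sub>C u - G u)" by simp
qed

lemma resolvent_estimate_mono: "resolvent_estimate E G l K \<Longrightarrow> K \<le> K' \<Longrightarrow> resolvent_estimate E G l K'"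
  unfolding resolvent_estimate_def by (meson mult_right_mono norm_ge_zero order_trans)

text \<open>Around a point near the imaginary axis the estimate persists on a disc of radius
  proportional to the height, so a fixed slope \<open>d\<close> is gained. The constant doubles once
  in the perturbation and once in replacing \<open>\<bar>Im l\<bar>\<close> by
  \<open>cmod l\<close>.\<close>

lemma half_plane_to_wedge:
  fixes E :: "'x::complex_banach set"
  assumes E: "complex_vector.subspace E" and G: "clinear_on E UNIV G" and M: "M > 0"
    and est: "\<And>l. Re l > 0 \<Longrightarrow> resolvent_estimate E G l (M / cmod l)"
  shows "\<exists>d>0. \<exists>M'>0. \<forall>l\<in>wedge_domain d. resolvent_estimate E G l (M' / cmod l)"
proof -
  \<comment> \<open>\<open>d \<le> 1 / (4 * M)\<close> makes the perturbation a contraction;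
    \<open>d \<le> 1\<close> bounds \<open>cmod l\<close> by twice
    \<open>\<bar>Im l\<bar>\<close>.\<close>
  define d where "d = min 1 (1 / (4 * M))"
  have d: "d > 0" "d \<le> 1" "d \<le> 1 / (4 * M)" using M by (auto simp: d_def)
  show ?thesis
  proof (rule exI[of _ d], rule conjI[OF d(1)], rule exI[of _ "4 * M"], intro conjI ballI)
    fix l assume l: "l \<in> wedge_domain d"
    show "resolvent_estimate E G l (4 * M / cmod l)"
    proof (cases "Re l > 0")
      case True
      show ?thesis
        by (rule resolvent_estimate_mono[OF est[OF True]]) (use M in \<open>auto intro: divide_right_mono\<close>)
    next
      case False
      define n where "n = \<bar>Im l\<bar>"
      have "- d * n < Re l" using l by (simp add: wedge_domain_def n_def)
      then have n: "n > 0" using False d by (cases "n = 0") (auto simp: n_def)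
      \<comment> \<open>The comparison point has the same height as \<open>l\<close> and lies just
        right of the imaginary axis, at distance at most \<open>2 * d * n\<close>.\<close>
      define l0 where "l0 = Complex (d * n) (Im l)"
      have Re0: "Re l0 > 0" using d n by (simp add: l0_def)
      have n0: "n \<le> cmod l0" using abs_Im_le_cmod[of l0] by (simp add: l0_def n_def)
      have "l - l0 = of_real (Re l - d * n)" by (simp add: l0_def complex_eq_iff)
      then have "cmod (l - l0) = \<bar>Re l - d * n\<bar>" by (simp del: of_real_diff)
      also have "\<dots> \<le> 2 * d * n" using False \<open>- d * n < Re l\<close> d n by simp
      finally have dl: "cmod (l - l0) \<le> 2 * d * n" .
      have "cmod (l - l0) * (M / n) \<le> (2 * d * n) * (M / n)" using dl M n by (intro mult_right_mono) auto
      also have "\<dots> = 2 * d * M" using n by simp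
      also have "\<dots> \<le> 2 * (1 / (4 * M)) * M" using d M by (intro mult_right_mono mult_left_mono) auto
      also have "\<dots> = 1 / 2" using M by simp
      finally have small: "cmod (l - l0) * (M / n) \<le> 1 / 2" .
      have "resolvent_estimate E G l0 (M / n)"
        by (rule resolvent_estimate_mono[OF est[OF Re0]]) (use M n n0 in \<open>auto intro!: divide_left_mono mult_pos_pos\<close>)
      from resolvent_estimate_perturb[OF E G this small] have "resolvent_estimate E G l (2 * (M / n))"
        using M n by simp
      moreover have "2 * (M / n) \<le> 4 * M / cmod l"
      proof -
        have "d * n \<le> n" using mult_right_mono[OF d(2), of n] n by linarith
        then have "\<bar>Re l\<bar> \<le> n" using False \<open>- d * n < Re l\<close> by linarith
        then have "cmod l \<le> 2 * n" using cmod_le[of l] by (simp add: n_def)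
        moreover have "cmod l > 0" using n by (auto simp: n_def)
        ultimately have "4 * M / (2 * n) \<le> 4 * M / cmod l" using M n by (intro divide_left_mono) auto
        then show ?thesis by simp
      qed
      ultimately show ?thesis by (rule resolvent_estimate_mono)
    qed
  qed (use d M in auto)
qed

text \<open>The a priori bound makes \<open>l u - G u\<close> injective in \<open>u\<close>, so that
  \<open>resolvent\<close>, defined by \<open>inv_into\<close>, is a genuine inverse. This is the
  passage from estimates to the operators in the definition of a generator.\<close>

lemma resolvent_estimate_resolvent:
  fixes E :: "'x::complex_banach set"
  assumes E: "complex_vector.subspace E" and G: "clinear_on E UNIV G"
    and est: "resolvent_estimate E G l K"
  shows "l \<in> resolvent_set UNIV E G" "resolvent E G l y \<in> E"
    "l *\<^sub>C resolvent E G l y - G (resolvent E G l y) = y"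
    "u \<in> E \<Longrightarrow> resolvent E G l (l *\<^sub>C u - G u) = u"
    "norm (resolvent E G l y) \<le> K * norm y"
    "bounded_clinear_on UNIV UNIV (resolvent E G l)"
proof -
  define h where "h u = l *\<^sub>C u - G u" for u
  have ex: "\<exists>u\<in>E. h u = y" and le: "u \<in> E \<Longrightarrow> norm u \<le> K * norm (h u)" for y u
    using est by (auto simp: resolvent_estimate_def h_def)
  have G_add: "G (a + b) = G a + G b" and G_sc: "G (c *\<^sub>C a) = c *\<^sub>C G a" if "a \<in> E" "b \<in> E" for a b c
    using G that by (auto simp: clinear_on_def)
  have h_add: "h (a + b) = h a + h b" and h_sc: "h (c *\<^sub>C a) = c *\<^sub>C h a" if "a \<in> E" "b \<in> E" for a b c
    using G_add[OF that] G_sc[OF that]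
    by (simp_all add: h_def scaleC_add_right scaleC.diff_right scaleC_scaleC mult.commute)
  have inj: "inj_on h E"
  proof (rule inj_onI)
    fix a b assume ab: "a \<in> E" "b \<in> E" "h a = h b"
    have mE: "(-1) *\<^sub>C b \<in> E" using E ab by (intro complex_vector.subspace_scale)
    then have "a + (-1) *\<^sub>C b \<in> E" using E ab by (intro complex_vector.subspace_add)
    moreover have "h (a + (-1) *\<^sub>C b) = 0"
      by (simp only: h_add[OF ab(1) mE] h_sc[OF ab(2) ab(2)] ab(3)) (simp add: complex_vector.scale_minus_left)
    ultimately have "a + (-1) *\<^sub>C b = 0" using le[of "a + (-1) *\<^sub>C b"] by simp
    then show "a = b" by (simp add: complex_vector.scale_minus_left)
  qed
  have bij: "bij_betw h E UNIV" using inj ex unfolding bij_betw_def by (auto simp: image_iff) (metis ex)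
  have res: "resolvent E G l = inv_into E h" by (simp add: resolvent_def h_def[abs_def])
  have 1: "resolvent E G l y \<in> E" "h (resolvent E G l y) = y" for y
    using bij by (auto simp: res bij_betw_def inv_into_into f_inv_into_f)
  have 2: "resolvent E G l (h u) = u" if "u \<in> E" for u
    using inv_into_f_f[OF inj that] by (simp add: res)
  have 3: "norm (resolvent E G l y) \<le> K * norm y" for y using le[OF 1(1)[of y]] 1(2)[of y] by simp
  have 4: "bounded_clinear_on UNIV UNIV (resolvent E G l)"
  proof (rule bounded_clinear_onI[OF _ _ 3])
    show "resolvent E G l (x + y) = resolvent E G l x + resolvent E G l y" for x y
      using 2[of "resolvent E G l x + resolvent E G l y"] 1[of x] 1[of y] h_add[OF 1(1)[of x] 1(1)[of y]] E
      by (simp add: complex_vector.subspace_add)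
    show "resolvent E G l (c *\<^sub>C x) = c *\<^sub>C resolvent E G l x" for c x
      using 2[of "c *\<^sub>C resolvent E G l x"] 1[of x] h_sc[OF 1(1)[of x] 1(1)[of x]] E
      by (simp add: complex_vector.subspace_scale)
  qed
  show "l \<in> resolvent_set UNIV E G" using bij 4 by (simp add: resolvent_set_def h_def[abs_def])
  show "resolvent E G l y \<in> E" "norm (resolvent E G l y) \<le> K * norm y"
    "bounded_clinear_on UNIV UNIV (resolvent E G l)" by (fact 1 3 4)+
  show "l *\<^sub>C resolvent E G l y - G (resolvent E G l y) = y" using 1(2)[of y] by (simp add: h_def)
  show "resolvent E G l (l *\<^sub>C u - G u) = u" if "u \<in> E" using 2[OF that] by (simp add: h_def)
qed

lemma sectorial_resolvent:
  fixes E :: "'x::complex_banach set"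
  assumes E: "complex_vector.subspace E" and G: "clinear_on E UNIV G" and "d > 0" "M > 0"
    and est: "\<And>l. l \<in> wedge_domain d \<Longrightarrow> resolvent_estimate E G l (M / cmod l)"
  shows "sectorial (resolvent E G) d M"
proof
  note R = resolvent_estimate_resolvent[OF E G est]
  show "resolvent E G l x - resolvent E G m x = (m - l) *\<^sub>C resolvent E G l (resolvent E G m x)"
    if l: "l \<in> wedge_domain d" and m: "m \<in> wedge_domain d" for l m x
  proof -
    define u where "u = resolvent E G m x"
    have u: "u \<in> E" "m *\<^sub>C u - G u = x" using R(2,3)[OF m] by (auto simp: u_def)
    have "x = (l *\<^sub>C u - G u) + (m - l) *\<^sub>C u" using u(2) by (simp add: scaleC.diff_left algebra_simps)
    then have "resolvent E G l x = resolvent E G l (l *\<^sub>C u - G u) + (m - l) *\<^sub>C resolvent E G l u"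
      using R(6)[OF l] by (simp add: bounded_clinear_on_def clinear_on_def)
    then show ?thesis using R(4)[OF l u(1)] by (simp add: u_def)
  qed
  show "x = 0" if "l \<in> wedge_domain d" "resolvent E G l x = 0" for l x
  proof -
    have "G 0 = 0" using G complex_vector.subspace_0[OF E] unfolding clinear_on_def
      by (metis complex_vector.scale_zero_left)
    then show ?thesis using R(3)[OF that(1), of x] that(2) by simp
  qed
qed (use assms resolvent_estimate_resolvent[OF E G est] in auto)

text \<open>One extension \<open>S\<close> on the whole space serves every closed invariant subspace
  \<open>V\<close>, in particular the whole space and the closure of the domain. The derivative of
  \<open>S\<close> leaves \<open>V\<close> invariant as well, being a pointwise limit of difference
  quotients in the closed \<open>V\<close>.\<close>

lemma holomorphic_semigroup_onI:
  fixes T :: "real \<Rightarrow> 'x::complex_banach \<Rightarrow> 'x"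
  assumes V: "complex_vector.subspace V" "closed V"
    and \<theta>: "0 < \<theta>" "\<theta> \<le> pi / 2"
    and ST: "\<And>t x. t > 0 \<Longrightarrow> S (of_real t) x = T t x"
    and W: "open W" "sector \<theta> \<subseteq> W"
    and op: "operator_holomorphic_on UNIV S W"
    and VS: "\<And>z x. z \<in> W \<Longrightarrow> x \<in> V \<Longrightarrow> S z x \<in> V"
    and bound: "\<And>z x. z \<in> W \<Longrightarrow> norm (S z x) \<le> C * exp (\<omega> * cmod z) * norm x" "C > 0" "\<omega> \<ge> 0"
    and cont: "\<And>x. x \<in> V \<Longrightarrow> continuous_on {0<..} (\<lambda>t. T t x)"
    and semigroup: "\<And>t s x. t > 0 \<Longrightarrow> s > 0 \<Longrightarrow> T (t + s) x = T t (T s x)"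
    and nondeg: "\<And>x. x \<in> V \<Longrightarrow> (\<And>t. t > 0 \<Longrightarrow> T t x = 0) \<Longrightarrow> x = 0"
  shows "holomorphic_semigroup_on V T"
proof -
  have V0: "V \<noteq> {}" using complex_vector.subspace_0[OF V(1)] by auto
  have clin: "bounded_clinear_on V V (S z)" if z: "z \<in> W" for z
  proof -
    have "bounded_clinear_on UNIV UNIV (S z)" using op z by (auto simp: operator_holomorphic_on_def)
    then show ?thesis using VS[OF z] by (auto simp: bounded_clinear_on_def clinear_on_def)
  qed
  have mem: "of_real t \<in> W" if "t > 0" for t using real_in_sector[OF \<theta>(1) that] W by blast
  have onorm: "onorm_on V (S z) \<le> C * exp (\<omega> * cmod z)" if "z \<in> W" for z
    using bound that V0 by (intro onorm_on_le) auto
  have opV: "operator_holomorphic_on V S (sector \<theta>)"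
    unfolding operator_holomorphic_on_def
  proof (intro conjI ballI)
    fix z assume "z \<in> sector \<theta>"
    then have z: "z \<in> W" using W by blast
    show "bounded_clinear_on V V (S z)" by (rule clin[OF z])
    obtain L where L: "bounded_clinear_on UNIV UNIV L"
      "((\<lambda>w. onorm_on UNIV (\<lambda>x. inverse (w - z) *\<^sub>C (S w x - S z x) - L x)) \<longlongrightarrow> 0) (at z)"
      using op z unfolding operator_holomorphic_on_def by blast
    have ev: "\<forall>\<^sub>F w in at z. w \<in> W" using W z by (intro eventually_at_in_open')
    have LV: "L x \<in> V" if x: "x \<in> V" for x
    proof (rule Lim_in_closed_set[OF V(2) _ _ operator_derivative_pointwise[OF op z W(1) z order_refl L]])
      show "\<forall>\<^sub>F w in at z. inverse (w - z) *\<^sub>C (S w x - S z x) \<in> V"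
        using ev by eventually_elim
          (intro complex_vector.subspace_scale[OF V(1)] complex_vector.subspace_diff[OF V(1)] VS z x)
    qed simp
    have "bounded_clinear_on V V L"
      using L(1) LV by (auto simp: bounded_clinear_on_def clinear_on_def)
    moreover have "((\<lambda>w. onorm_on V (\<lambda>x. inverse (w - z) *\<^sub>C (S w x - S z x) - L x)) \<longlongrightarrow> 0) (at z)"
    proof (rule Lim_null_comparison[OF _ L(2)])
      show "\<forall>\<^sub>F w in at z. norm (onorm_on V (\<lambda>x. inverse (w - z) *\<^sub>C (S w x - S z x) - L x))
          \<le> onorm_on UNIV (\<lambda>x. inverse (w - z) *\<^sub>C (S w x - S z x) - L x)"
        using ev
      proof eventually_elim
        case (elim w)
        let ?Q = "\<lambda>x. inverse (w - z) *\<^sub>C (S w x - S z x) - L x"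
        have b: "bounded_clinear_on UNIV UNIV (S w)" "bounded_clinear_on UNIV UNIV (S z)"
          using op elim z by (auto simp: operator_holomorphic_on_def)
        have "bounded_linear ?Q"
          using b L(1) unfolding bounded_clinear_on_UNIV_iff
          by (intro bounded_linear_sub bounded_linear_compose[OF scaleC.bounded_linear_right]) auto
        then have Q: "bounded_clinear_on UNIV UNIV ?Q"
          using b L(1) by (auto simp: bounded_clinear_on_UNIV_iff scaleC.diff_right scaleC_scaleC mult.commute)
        then have QV: "bounded_clinear_on V UNIV ?Q"
          by (auto simp: bounded_clinear_on_def clinear_on_def)
        have "onorm_on V ?Q \<le> onorm_on UNIV ?Q"
          using V0 onorm_on_nonneg[OF Q] norm_le_onorm_on[OF Q] by (intro onorm_on_le) auto
        with onorm_on_nonneg[OF QV V0] show ?case by simp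
      qed
    qed
    ultimately show "\<exists>L. bounded_clinear_on V V L \<and>
        ((\<lambda>w. onorm_on V (\<lambda>x. inverse (w - z) *\<^sub>C (S w x - S z x) - L x)) \<longlongrightarrow> 0) (at z)" by blast
  qed
  have S_eq: "S (of_real t) = T t" if "t > 0" for t using ST[OF that] by auto
  have growth: "growth_bound_on V T \<omega>"
    unfolding growth_bound_on_def
  proof (intro exI[of _ C] conjI allI impI bound)
    fix t :: real assume t: "t > 0"
    show "onorm_on V (T t) \<le> C * exp (\<omega> * t)" using onorm[OF mem[OF t]] S_eq[OF t] t by simp
  qed
  have "semigroup_on V T"
    unfolding semigroup_on_def
  proof (intro conjI allI impI ballI)
    show "bounded_clinear_on V V (T t)" if "t > 0" for t using clin[OF mem[OF that]] S_eq[OF that] by simp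
    show "\<exists>\<omega>. growth_bound_on V T \<omega>" using growth by blast
  qed (use V cont semigroup nondeg in auto)
  moreover have "onorm_on V (S z) \<le> C * exp \<omega>" if "z \<in> sector \<theta> \<inter> cball 0 1" for z
  proof -
    have "onorm_on V (S z) \<le> C * exp (\<omega> * cmod z)" using that W by (intro onorm) auto
    also have "\<dots> \<le> C * exp (\<omega> * 1)"
      using that bound(2) mult_left_mono[OF _ bound(3), of "cmod z" 1] by (intro mult_left_mono) auto
    finally show ?thesis by simp
  qed
  ultimately show ?thesis
    unfolding holomorphic_semigroup_on_def using \<theta> ST opV by blast
qed

lemma closure_csubspace:
  fixes E :: "'x::complex_normed_vector set"
  assumes E: "complex_vector.subspace E"
  shows "complex_vector.subspace (closure E)"
  unfolding complex_vector.subspace_def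
proof (intro conjI ballI allI)
  show "0 \<in> closure E" using complex_vector.subspace_0[OF E] closure_subset by blast
  fix x assume "x \<in> closure E"
  then obtain X where X: "\<And>n. X n \<in> E" "X \<longlonglongrightarrow> x" by (auto simp: closure_sequential)
  show "c *\<^sub>C x \<in> closure E" for c
    using X complex_vector.subspace_scale[OF E]
    by (auto simp: closure_sequential intro!: exI[of _ "\<lambda>n. c *\<^sub>C X n"] scaleC.tendsto tendsto_const)
  fix y assume "y \<in> closure E"
  then obtain Y where Y: "\<And>n. Y n \<in> E" "Y \<longlonglongrightarrow> y" by (auto simp: closure_sequential)
  show "x + y \<in> closure E"
    using X Y complex_vector.subspace_add[OF E]
    by (auto simp: closure_sequential intro!: exI[of _ "\<lambda>n. X n + Y n"] tendsto_add)
qed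

text \<open>A product rule in operator norm; it serves to undo a shift of the generator by a
  multiple of the identity.\<close>

lemma operator_holomorphic_exp_scale:
  assumes op: "operator_holomorphic_on UNIV S W"
    and L: "\<And>z. z \<in> W \<Longrightarrow> bounded_clinear_on UNIV UNIV (S z)" and W: "open W"
  shows "operator_holomorphic_on UNIV (\<lambda>z x. exp (a * z) *\<^sub>C S z x) W"
  unfolding operator_holomorphic_on_def
proof (intro conjI ballI)
  have scale: "bounded_clinear_on UNIV UNIV (\<lambda>x. c *\<^sub>C F x)"
    if "bounded_clinear_on UNIV UNIV F" for c and F :: "'x \<Rightarrow> 'x::complex_banach"
    using that bounded_linear_compose[OF scaleC.bounded_linear_right]
    by (auto simp: bounded_clinear_on_UNIV_iff scaleC_scaleC mult.commute)
  have add: "bounded_clinear_on UNIV UNIV (\<lambda>x. F x + H x)"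
    if "bounded_clinear_on UNIV UNIV F" "bounded_clinear_on UNIV UNIV H" for F H :: "'x \<Rightarrow> 'x::complex_banach"
    using that by (auto simp: bounded_clinear_on_UNIV_iff scaleC_add_right intro: bounded_linear_add)
  show "bounded_clinear_on UNIV UNIV (\<lambda>x. exp (a * z) *\<^sub>C S z x)" if "z \<in> W" for z
    by (rule scale[OF L[OF that]])
  fix z assume z: "z \<in> W"
  obtain D where D: "bounded_clinear_on UNIV UNIV D"
    "((\<lambda>w. onorm_on UNIV (\<lambda>x. inverse (w - z) *\<^sub>C (S w x - S z x) - D x)) \<longlongrightarrow> 0) (at z)"
    using op z unfolding operator_holomorphic_on_def by blast
  define e where "e w = exp (a * w)" for w
  define q where "q w = (e w - e z) / (w - z) - a * e z" for w
  define QS where "QS w x = inverse (w - z) *\<^sub>C (S w x - S z x) - D x" for w x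
  have "(e has_field_derivative a * e z) (at z)"
    unfolding e_def[abs_def] by (auto intro!: derivative_eq_intros)
  then have q0: "(q \<longlongrightarrow> 0) (at z)" and e0: "((\<lambda>w. e w - e z) \<longlongrightarrow> 0) (at z)"
    by (auto simp: q_def[abs_def] has_field_derivative_iff LIM_zero
        dest!: DERIV_isCont[unfolded isCont_def, THEN LIM_zero, rotated] intro: LIM_zero)
       (simp add: e_def, intro LIM_zero tendsto_intros)
  define L' where "L' x = e z *\<^sub>C D x + (a * e z) *\<^sub>C S z x" for x
  have "bounded_clinear_on UNIV UNIV L'"
    unfolding L'_def[abs_def] by (intro add scale D L z)
  moreover have "((\<lambda>w. onorm_on UNIV (\<lambda>x. inverse (w - z) *\<^sub>C (e w *\<^sub>C S w x - e z *\<^sub>C S z x) - L' x)) \<longlongrightarrow> 0) (at z)"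
  proof (rule Lim_null_comparison)
    let ?b = "\<lambda>w. cmod (e w) * onorm_on UNIV (QS w) + cmod (e w - e z) * onorm_on UNIV D
        + cmod (q w) * onorm_on UNIV (S z)"
    have "\<forall>\<^sub>F w in at z. w \<in> W" using W z by (intro eventually_at_in_open')
    then show "\<forall>\<^sub>F w in at z. norm (onorm_on UNIV (\<lambda>x. inverse (w - z) *\<^sub>C (e w *\<^sub>C S w x - e z *\<^sub>C S z x) - L' x)) \<le> ?b w"
      using eventually_neq_at_within[of z]
    proof eventually_elim
      case (elim w)
      define Q where "Q x = inverse (w - z) *\<^sub>C (e w *\<^sub>C S w x - e z *\<^sub>C S z x) - L' x" for x
      have QS: "bounded_clinear_on UNIV UNIV (QS w)"
        using add[OF scale[OF add[OF L[OF elim(1)] scale[OF L[OF z], of "-1"]], of "inverse (w - z)"] scale[OF D(1), of "-1"]]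
        by (simp add: QS_def[abs_def] scaleC.minus_left)
      \<comment> \<open>The product rule splits into the error of \<open>S\<close>, the increment of
        the exponential against \<open>D\<close>, and the error of the exponential against
        \<open>S z\<close>.\<close>
      have Q_eq: "Q x = e w *\<^sub>C QS w x + (e w - e z) *\<^sub>C D x + q w *\<^sub>C S z x" for x
        using elim(2)
        by (simp add: Q_def QS_def L'_def q_def scaleC.diff_right scaleC.diff_left scaleC_add_left scaleC_scaleC
            divide_inverse algebra_simps)
      have Q: "bounded_clinear_on UNIV UNIV Q"
        unfolding Q_eq[abs_def] by (intro add scale QS D L z)
      have "norm (Q x) \<le> ?b w * norm x" for x
      proof -
        have "norm (Q x) \<le> cmod (e w) * norm (QS w x) + cmod (e w - e z) * norm (D x) + cmod (q w) * norm (S z x)"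
          unfolding Q_eq norm_scaleC[symmetric] by (intro order_trans[OF norm_triangle_ineq] add_mono order_refl)
        also have "\<dots> \<le> cmod (e w) * (onorm_on UNIV (QS w) * norm x) + cmod (e w - e z) * (onorm_on UNIV D * norm x)
            + cmod (q w) * (onorm_on UNIV (S z) * norm x)"
          by (intro add_mono mult_left_mono norm_le_onorm_on[OF QS] norm_le_onorm_on[OF D(1)]
              norm_le_onorm_on[OF L[OF z]]) auto
        finally show ?thesis by (simp add: algebra_simps)
      qed
      moreover have "?b w \<ge> 0"
        using onorm_on_nonneg[OF QS] onorm_on_nonneg[OF D(1)] onorm_on_nonneg[OF L[OF z]] by simp
      ultimately have "onorm_on UNIV Q \<le> ?b w" by (intro onorm_on_le) auto
      with onorm_on_nonneg[OF Q] show ?case by (simp add: Q_def[abs_def])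
    qed
    have "((\<lambda>w. cmod (e w)) \<longlongrightarrow> cmod (e z)) (at z)"
      unfolding e_def by (intro tendsto_intros)
    from tendsto_add[OF tendsto_add[OF tendsto_mult[OF this D(2)]
        tendsto_mult[OF tendsto_norm_zero[OF e0] tendsto_const[of "onorm_on UNIV D"]]]
        tendsto_mult[OF tendsto_norm_zero[OF q0] tendsto_const[of "onorm_on UNIV (S z)"]]]
    show "(?b \<longlongrightarrow> 0) (at z)" by (simp add: QS_def[abs_def])
  qed
  ultimately show "\<exists>L. bounded_clinear_on UNIV UNIV L \<and>
      ((\<lambda>w. onorm_on UNIV (\<lambda>x. inverse (w - z) *\<^sub>C (exp (a * w) *\<^sub>C S w x - exp (a * z) *\<^sub>C S z x) - L x)) \<longlongrightarrow> 0) (at z)"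
    unfolding e_def by blast
qed

lemma sectorial_generation:
  fixes E :: "'x::complex_banach set"
  assumes E: "complex_vector.subspace E" and G: "clinear_on E UNIV G" and \<omega>: "\<omega> > 0" and M: "M > 0"
    and est: "\<And>l. Re l > \<omega> \<Longrightarrow> resolvent_estimate E G l (M / cmod l)"
  shows "\<exists>T. holomorphic_semigroup_on UNIV T \<and> generator_on UNIV E G T \<and>
    holomorphic_semigroup_on (closure E) T \<and> strongly_continuous_on (closure E) T"
proof -
  \<comment> \<open>The shift by \<open>\<omega>\<close> moves the half plane of the estimate to
    \<open>Re l > 0\<close>, where the passage to a wedge applies.\<close>
  define H where "H u = G u - of_real \<omega> *\<^sub>C u" for u
  have H: "clinear_on E UNIV H"
    using G by (auto simp: clinear_on_def H_def scaleC_add_right scaleC.diff_right scaleC_scaleC mult.commute)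
  have shift: "l *\<^sub>C u - H u = (l + of_real \<omega>) *\<^sub>C u - G u" for l u
    by (simp add: H_def scaleC_add_left)
  have estH: "resolvent_estimate E H l (M / cmod l)" if l: "Re l > 0" for l
  proof -
    have "cmod l \<le> cmod (l + of_real \<omega>)"
      using power_mono[of "Re l" "Re l + \<omega>" 2] l \<omega> by (simp add: cmod_def)
    moreover have "cmod l > 0" using l by auto
    ultimately have "M / cmod (l + of_real \<omega>) \<le> M / cmod l"
      using M by (intro divide_left_mono mult_pos_pos) (linarith+)
    then have "resolvent_estimate E G (l + of_real \<omega>) (M / cmod l)"
      using l by (intro resolvent_estimate_mono[OF est]) auto
    then show ?thesis by (simp add: resolvent_estimate_def shift)
  qed
  obtain d M' where dM: "d > 0" "M' > 0"
    "\<And>l. l \<in> wedge_domain d \<Longrightarrow> resolvent_estimate E H l (M' / cmod l)"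
    using half_plane_to_wedge[OF E H M estH] by blast
  interpret sectorial "resolvent E H" d M' by (rule sectorial_resolvent[OF E H dM])
  note R = resolvent_estimate_resolvent[OF E H dM(3)]
  have one: "(1::complex) \<in> wedge_domain d" using pos_in[of 1] by simp
  \<comment> \<open>This identifies the closure on which \<open>S_tendsto\<close> gives strong
    continuity as \<open>closure E\<close>.\<close>
  have range: "range (resolvent E H 1) = E"
    using R(2,4)[OF one] by (auto simp: image_iff) metis
  define U where "U z x = exp (of_real \<omega> * z) *\<^sub>C S z x" for z x
  define T where "T t = U (of_real t)" for t
  define \<theta> where "\<theta> = arctan (slope / 2)"
  have \<theta>: "0 < \<theta>" "\<theta> \<le> pi / 2" using slope arctan_ubound[of "slope / 2"] by (auto simp: \<theta>_def zero_less_arctan_iff)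
  have sub: "sector \<theta> \<subseteq> sectorW"
    using in_sector_arctanD[of "slope / 2"] slope by (auto simp: \<theta>_def sectorW_def)
  have opU: "operator_holomorphic_on UNIV U sectorW"
    unfolding U_def[abs_def] by (rule operator_holomorphic_exp_scale[OF S_operator_holomorphic S_clinear open_sectorW])
  have T_eq: "T t x = exp (\<omega> * t) *\<^sub>R S (of_real t) x" for t x
    by (simp add: T_def U_def scaleR_scaleC flip: of_real_mult exp_of_real)
  have UE: "U z x \<in> E" if "z \<in> sectorW" for z x
    using S_in_range[OF that one, of x] complex_vector.subspace_scale[OF E] by (simp add: U_def range)
  have bound: "norm (U z x) \<le> S_const * exp (\<omega> * cmod z) * norm x" if z: "z \<in> sectorW" for z x
  proof -
    have "norm (U z x) = exp (\<omega> * Re z) * norm (S z x)" by (simp add: U_def norm_scaleC)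
    also have "\<dots> \<le> exp (\<omega> * cmod z) * (S_const * norm x)"
      using \<omega> by (intro mult_mono S_bound z) (auto intro!: mult_left_mono complex_Re_le_cmod)
    finally show ?thesis by (simp add: mult_ac)
  qed
  have cont: "continuous_on {0<..} (\<lambda>t. T t x)" for x
    unfolding T_eq
    by (intro continuous_intros continuous_at_imp_continuous_on ballI
        has_vector_derivative_continuous[OF S_has_vector_derivative]) auto
  have semi: "T (t + s) x = T t (T s x)" if ts: "t > 0" "s > 0" for t s x
  proof -
    have "S (of_real t) (exp (\<omega> * s) *\<^sub>R S (of_real s) x) = exp (\<omega> * s) *\<^sub>R S (of_real t) (S (of_real s) x)"
      using S_linear[OF real_in_sectorW[OF ts(1)]] by (simp add: linear_cmul bounded_linear.linear)
    then show ?thesis using S_semigroup[OF ts, of x]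
      by (simp add: T_eq exp_add[symmetric] algebra_simps)
  qed
  \<comment> \<open>A vanishing orbit has vanishing Laplace transform \<open>R(1) x\<close>, and the
    resolvent is injective.\<close>
  have nondeg: "x = 0" if x: "\<And>t. t > 0 \<Longrightarrow> T t x = 0" for x
  proof -
    have "S (of_real t) x = 0" if "t > 0" for t using x[OF that] by (simp add: T_eq)
    then have "((\<lambda>t. exp (- 1 * t) *\<^sub>R S (of_real t) x) has_integral 0) {0<..}"
      by (intro has_integral_is_0) auto
    from has_integral_unique[OF S_laplace[OF zero_less_one] this] have "resolvent E H 1 x = 0" by simp
    then show ?thesis by (rule injective[OF one])
  qed
  have hol: "holomorphic_semigroup_on V T"
    if V: "complex_vector.subspace V" "closed V" "E \<subseteq> V" for V
  proof (rule holomorphic_semigroup_onI[OF V(1,2) \<theta> _ open_sectorW sub opU _ bound S_const_pos])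
    show "U z x \<in> V" if "z \<in> sectorW" for z x using UE[OF that] V(3) by blast
  qed (use \<omega> cont semi nondeg in \<open>auto simp: T_def\<close>)
  have "generator_on UNIV E G T"
    unfolding generator_on_def
  proof (intro conjI exI[of _ \<omega>] allI impI ballI)
    show "unbounded_operator_on UNIV E G" using E G by (simp add: unbounded_operator_on_def)
    show "growth_bound_on UNIV T \<omega>"
      unfolding growth_bound_on_def
    proof (intro exI[of _ S_const] conjI allI impI S_const_pos)
      fix t :: real assume t: "t > 0"
      show "onorm_on UNIV (T t) \<le> S_const * exp (\<omega> * t)"
        using bound[OF real_in_sectorW[OF t]] t S_const_pos
        by (intro onorm_on_le) (auto simp: T_def)
    qed
    fix \<mu> assume \<mu>: "\<mu> > \<omega>"
    show "complex_of_real \<mu> \<in> resolvent_set UNIV E G"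
      by (rule resolvent_estimate_resolvent(1)[OF E G est]) (use \<mu> in simp)
    fix x
    have "resolvent E G (of_real \<mu>) x = resolvent E H (of_real (\<mu> - \<omega>)) x"
      by (simp add: resolvent_def shift)
    moreover have "exp (- (\<mu> - \<omega>) * t) *\<^sub>R S (of_real t) x = exp (- \<mu> * t) *\<^sub>R T t x" for t
      by (simp add: T_eq exp_add[symmetric] algebra_simps)
    ultimately show "((\<lambda>t. exp (- \<mu> * t) *\<^sub>R T t x) has_integral resolvent E G (complex_of_real \<mu>) x) {0<..}"
      using S_laplace[of "\<mu> - \<omega>" x] \<mu> by simp
  qed
  moreover have "strongly_continuous_on (closure E) T"
    unfolding strongly_continuous_on_def
  proof
    fix x assume "x \<in> closure E"
    then have "((\<lambda>t. S (of_real t) x) \<longlongrightarrow> x) (at_right 0)"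
      using S_tendsto[OF one, of x] by (simp add: range)
    then have "((\<lambda>t. exp (\<omega> * t) *\<^sub>R S (of_real t) x) \<longlongrightarrow> exp (\<omega> * 0) *\<^sub>R x) (at_right 0)"
      by (intro tendsto_intros)
    then show "((\<lambda>t. T t x) \<longlongrightarrow> x) (at_right 0)" by (simp add: T_eq)
  qed
  moreover have "holomorphic_semigroup_on UNIV T" by (rule hol) auto
  moreover have "holomorphic_semigroup_on (closure E) T"
    by (rule hol) (use closure_csubspace[OF E] closure_subset in auto)
  ultimately show ?thesis by blast
qed

section \<open>Perturbation of the boundary condition\<close>

text \<open>Baire's theorem yields a ball in the closure of the image of a bounded set. Differences
  of two points in that image approximate a scaled \<open>y\<close> up to half its norm, and
  iterating on the error produces an exact preimage as a geometrically convergent series.\<close>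

lemma open_mapping_bounded_preimage:
  fixes B :: "'d::banach \<Rightarrow> 'b::banach"
  assumes B: "bounded_linear B" and surj: "surj B"
  shows "\<exists>c>0. \<forall>g. \<exists>d. B d = g \<and> norm d \<le> c * norm g"
proof -
  interpret B: bounded_linear B by fact
  have "\<exists>n::nat. interior (closure (B ` ball 0 (real n))) \<noteq> {}"
  proof (rule ccontr)
    assume "\<not> ?thesis"
    then have int: "interior (closure (B ` ball 0 (real n))) = {}" for n by blast
    have "(euclidean :: 'b topology) interior_of (\<Union>n. closure (B ` ball 0 (real n))) = {}"
      by (rule Baire_category_alt)
        (use int in \<open>auto simp del: closure_approachable intro: completely_metrizable_space_euclidean\<close>)
    then have "interior (\<Union>n. closure (B ` ball 0 (real n))) = {}" by simp
    moreover have "(\<Union>n. closure (B ` ball 0 (real n))) = UNIV"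
    proof (intro equalityI subsetI UNIV_I)
      fix g :: 'b
      obtain d where d: "B d = g" using surj by (metis surjD)
      obtain n where "norm d < real n" using reals_Archimedean2 by blast
      then have "g \<in> B ` ball 0 (real n)" using d by auto
      then show "g \<in> (\<Union>n. closure (B ` ball 0 (real n)))"
        by (intro UN_I[of n] subsetD[OF closure_subset]) auto
    qed
    ultimately show False by simp
  qed
  then obtain n :: nat and x where "x \<in> interior (closure (B ` ball 0 (real n)))" by blast
  then obtain r where r: "r > 0" "ball x r \<subseteq> closure (B ` ball 0 (real n))"
    by (meson mem_interior)
  \<comment> \<open>\<open>4 * real n / r\<close> is the cost of a difference of two preimages; the
    summand \<open>1\<close> secures positivity without a look at \<open>n\<close>.\<close>
  define c where "c = 4 * real n / r + 1"
  have c: "c > 0" using r by (simp add: c_def add_nonneg_pos)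
  have approx: "\<exists>d. norm d \<le> c * norm y \<and> norm (y - B d) \<le> norm y / 2" for y
  proof (cases "y = 0")
    case True
    then show ?thesis by (auto intro!: exI[of _ 0] simp: B.zero)
  next
    case False
    \<comment> \<open>Scales \<open>y\<close> to length \<open>r / 2\<close>, so that
      \<open>x + s y\<close> stays in the ball; two errors of \<open>r / 8\<close> then amount to
      half of \<open>s * norm y\<close>.\<close>
    define s where "s = r / (2 * norm y)"
    have s: "s > 0" using False r by (simp add: s_def)
    have "norm (s *\<^sub>R y) = r / 2" using r False by (simp add: s_def)
    then have in_cl: "x \<in> closure (B ` ball 0 (real n))" "x + s *\<^sub>R y \<in> closure (B ` ball 0 (real n))"
      using r by (auto simp: subset_iff dist_norm)
    have "r / 8 > 0" using r by simp
    then have "\<exists>z\<in>B ` ball 0 (real n). dist z x < r / 8"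
      "\<exists>z\<in>B ` ball 0 (real n). dist z (x + s *\<^sub>R y) < r / 8"
      using in_cl unfolding closure_approachable by blast+
    then obtain d1 d2 where d1: "norm d1 < real n" "norm (B d1 - x) < r / 8"
      and d2: "norm d2 < real n" "norm (B d2 - (x + s *\<^sub>R y)) < r / 8"
      unfolding dist_norm by (metis imageE mem_ball_0)
    define d where "d = (d2 - d1) /\<^sub>R s"
    have "norm (d2 - d1) \<le> 2 * real n" using d1 d2 norm_triangle_ineq4[of d2 d1] by simp
    then have "norm (d2 - d1) / s \<le> 2 * real n / s" using s by (intro divide_right_mono) auto
    moreover have "norm d = norm (d2 - d1) / s" using s by (simp add: d_def divide_inverse mult.commute)
    ultimately have "norm d \<le> 2 * real n / s" by simp
    also have "\<dots> = 4 * real n / r * norm y" using r False by (simp add: s_def)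
    also have "\<dots> \<le> c * norm y" unfolding c_def by (intro mult_right_mono) auto
    finally have 1: "norm d \<le> c * norm y" .
    have "s *\<^sub>R (y - B d) = (B d1 - x) - (B d2 - (x + s *\<^sub>R y))"
      using s by (simp add: d_def B.scaleR B.diff algebra_simps)
    then have "s * norm (y - B d) = norm ((B d1 - x) - (B d2 - (x + s *\<^sub>R y)))" using s by (metis abs_of_pos norm_scaleR)
    also have "\<dots> \<le> r / 4" using norm_triangle_ineq4[of "B d1 - x" "B d2 - (x + s *\<^sub>R y)"] d1 d2 by linarith
    finally have "s * norm (y - B d) \<le> s * (norm y / 2)" using False by (simp add: s_def)
    then have "norm (y - B d) \<le> norm y / 2" using s by simp
    with 1 show ?thesis by blast
  qed
  then obtain p where p: "\<And>y. norm (p y) \<le> c * norm y" "\<And>y. norm (y - B (p y)) \<le> norm y / 2" by metis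
  have "\<exists>d. B d = g \<and> norm d \<le> 2 * c * norm g" for g
  proof -
    \<comment> \<open>\<open>y k\<close> is the error left after \<open>k\<close> corrections, and
      \<open>p (y k)\<close> is the next summand of the preimage.\<close>
    define y where "y k = ((\<lambda>y. y - B (p y)) ^^ k) g" for k :: nat
    have y0: "y 0 = g" and yS: "y (Suc k) = y k - B (p (y k))" for k by (simp_all add: y_def)
    have yb: "norm (y k) \<le> norm g * (1 / 2) ^ k" for k
    proof (induction k)
      case (Suc k)
      then show ?case using p(2)[of "y k"] by (simp add: yS)
    qed (simp add: y0)
    have pb: "norm (p (y k)) \<le> c * norm g * (1 / 2) ^ k" for k
      using order_trans[OF p(1)[of "y k"] mult_left_mono[OF yb[of k], of c]] c by (simp add: mult_ac)
    have geo: "(\<lambda>k. c * norm g * (1 / 2) ^ k) sums (c * norm g * 2)"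
      using sums_mult[OF geometric_sums[of "1 / 2 :: real"], of "c * norm g"] by simp
    have sm: "summable (\<lambda>k. norm (p (y k)))"
      by (rule summable_comparison_test'[OF sums_summable[OF geo]]) (use pb in simp)
    define d where "d = (\<Sum>k. p (y k))"
    have "norm d \<le> (\<Sum>k. norm (p (y k)))" unfolding d_def by (rule summable_norm[OF sm])
    also have "\<dots> \<le> c * norm g * 2"
      using suminf_le[OF pb sm sums_summable[OF geo]] sums_unique[OF geo] by simp
    finally have "norm d \<le> 2 * c * norm g" by simp
    moreover have "B d = g"
    proof -
      have "(\<lambda>k. norm g * (1 / 2) ^ k) \<longlonglongrightarrow> norm g * 0"
        by (intro tendsto_mult tendsto_const LIMSEQ_power_zero) simp
      then have "y \<longlonglongrightarrow> 0" by (intro Lim_null_comparison[of y]) (use yb in auto)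
      then have "(\<lambda>k. y k - y (Suc k)) sums (y 0 - 0)" by (rule telescope_sums')
      moreover have "(\<lambda>k. B (p (y k))) sums B d"
        unfolding d_def by (intro B.sums summable_sums summable_norm_cancel[OF sm])
      ultimately show ?thesis using sums_unique2 by (fastforce simp: yS y0)
    qed
    ultimately show ?thesis by blast
  qed
  then show ?thesis using c by (intro exI[of _ "2 * c"]) auto
qed

text \<open>Assumption (c) of the theorem is present as \<open>estimate\<close>, the half-plane
  bound for \<open>A\<close> on the kernel of \<open>B\<close>, and as \<open>V_kernel\<close>, the
  equality of the closures.\<close>

locale boundary_perturbation =
  fixes J :: "'d::complex_banach \<Rightarrow> 'x::complex_banach"
    and A :: "'d \<Rightarrow> 'x"
    and B :: "'d \<Rightarrow> 'b::complex_banach"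
    and \<Phi> :: "'x \<Rightarrow> 'b"
    and V :: "'x set" and \<omega> M :: real
  assumes J: "bounded_clinear_on UNIV UNIV J" "inj J"
    and A: "bounded_clinear_on UNIV UNIV A"
    and B: "bounded_clinear_on UNIV UNIV B" "surj B"
    and V_def: "V = closure (range J)"
    and \<Phi>: "bounded_clinear_on V UNIV \<Phi>"
    and \<Phi>_compact: "compact (closure (\<Phi> ` (V \<inter> cball 0 1)))"
    and V_kernel: "V = closure (J ` {u. B u = 0})"
    and \<omega>: "\<omega> > 0" and M: "M > 0"
    and estimate: "Re l > \<omega> \<Longrightarrow> resolvent_estimate (J ` {u. B u = 0}) (A \<circ> inv J) l (M / cmod l)"
begin

lemma linear_simps:
  "J (u + v) = J u + J v" "J (u - v) = J u - J v" "J (c *\<^sub>C u) = c *\<^sub>C J u"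
  "A (u + v) = A u + A v" "A (u - v) = A u - A v" "A (c *\<^sub>C u) = c *\<^sub>C A u"
  "B (u + v) = B u + B v" "B (u - v) = B u - B v" "B (c *\<^sub>C u) = c *\<^sub>C B u"
proof -
  interpret J: bounded_linear J using J(1) by (simp add: bounded_clinear_on_UNIV_iff)
  interpret A: bounded_linear A using A by (simp add: bounded_clinear_on_UNIV_iff)
  interpret B: bounded_linear B using B(1) by (simp add: bounded_clinear_on_UNIV_iff)
  show "J (u + v) = J u + J v" "J (u - v) = J u - J v" "A (u + v) = A u + A v" "A (u - v) = A u - A v"
    "B (u + v) = B u + B v" "B (u - v) = B u - B v"
    by (fact J.add J.diff A.add A.diff B.add B.diff)+
  show "J (c *\<^sub>C u) = c *\<^sub>C J u" "A (c *\<^sub>C u) = c *\<^sub>C A u" "B (c *\<^sub>C u) = c *\<^sub>C B u"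
    using J(1) A B(1) by (simp_all add: bounded_clinear_on_UNIV_iff)
qed

lemma inv_J: "inv J (J u) = u"
  using J(2) by simp

section \<open>The Dirichlet problem for \<open>A\<close> and \<open>B\<close>\<close>

lemma solvable:
  assumes "Re l > \<omega>" obtains p where "B p = 0" "l *\<^sub>C J p - A p = y"
proof -
  obtain u where "u \<in> J ` {u. B u = 0}" "l *\<^sub>C u - (A \<circ> inv J) u = y"
    using estimate[OF assms] unfolding resolvent_estimate_def by blast
  then show ?thesis using that by (auto simp: inv_J)
qed

lemma kernel_bound:
  assumes "Re l > \<omega>" "B p = 0"
  shows "norm (J p) \<le> M / cmod l * norm (l *\<^sub>C J p - A p)"
proof -
  have "norm (J p) \<le> M / cmod l * norm (l *\<^sub>C J p - (A \<circ> inv J) (J p))"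
    using estimate[OF assms(1)] assms(2) unfolding resolvent_estimate_def by blast
  then show ?thesis by (simp add: inv_J)
qed

text \<open>Any preimage \<open>d\<close> of \<open>g\<close> is corrected by the \<open>p\<close>
  in the kernel of \<open>B\<close> with \<open>(l - A) p = (l - A) d\<close>; uniqueness is the a
  priori bound on that kernel.\<close>

lemma dirichlet_ex1:
  assumes l: "Re l > \<omega>"
  shows "\<exists>!d. B d = g \<and> A d = l *\<^sub>C J d"
proof -
  obtain d where d: "B d = g" using B(2) by (metis surjD)
  obtain p where p: "B p = 0" "l *\<^sub>C J p - A p = l *\<^sub>C J d - A d" by (rule solvable[OF l])
  show ?thesis
  proof (rule ex1I[of _ "d - p"])
    show "B (d - p) = g \<and> A (d - p) = l *\<^sub>C J (d - p)"
      using p by (simp add: linear_simps d scaleC.diff_right algebra_simps)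
    fix d' assume d': "B d' = g \<and> A d' = l *\<^sub>C J d'"
    have "norm (J (d' - (d - p))) \<le> M / cmod l * norm (l *\<^sub>C J (d' - (d - p)) - A (d' - (d - p)))"
      by (rule kernel_bound[OF l]) (use d' d p in \<open>simp add: linear_simps\<close>)
    moreover have "l *\<^sub>C J (d' - (d - p)) - A (d' - (d - p)) = 0"
      using d' p by (simp add: linear_simps scaleC.diff_right algebra_simps)
    ultimately have "J (d' - (d - p)) = 0" by simp
    then show "d' = d - p" using J(2) by (simp add: linear_simps(1,2)) (metis add.commute diff_add_cancel injD linear_simps(1) eq_iff_diff_eq_0 linear_simps(2))
  qed
qed

definition D where "D l g = (THE d. B d = g \<and> A d = l *\<^sub>C J d)"

lemma D: "Re l > \<omega> \<Longrightarrow> B (D l g) = g" "Re l > \<omega> \<Longrightarrow> A (D l g) = l *\<^sub>C J (D l g)"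
  using theI'[OF dirichlet_ex1[of l g]] by (auto simp: D_def)

lemma D_eqI: "Re l > \<omega> \<Longrightarrow> B d = g \<Longrightarrow> A d = l *\<^sub>C J d \<Longrightarrow> D l g = d"
  unfolding D_def by (rule the1_equality[OF dirichlet_ex1]) auto

lemma D_diff: "Re l > \<omega> \<Longrightarrow> D l (g - h) = D l g - D l h"
  by (rule D_eqI) (simp_all add: linear_simps D scaleC.diff_right)

lemma D_scaleC: "Re l > \<omega> \<Longrightarrow> D l (c *\<^sub>C g) = c *\<^sub>C D l g"
  by (rule D_eqI) (simp_all add: linear_simps D scaleC_scaleC mult.commute)

text \<open>In \<open>d - p\<close> the correction \<open>p\<close> costs \<open>M / cmod l\<close>
  times the norm of \<open>l J d - A d\<close>: the factor \<open>l\<close> cancels for the first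
  term, and \<open>cmod l \<ge> \<omega>\<close> handles the second. The open mapping theorem
  provides a \<open>d\<close> whose norm is of the order of \<open>norm g\<close>.\<close>

lemma D_bound:
  obtains C where "C > 0" "\<And>l g. Re l > \<omega> \<Longrightarrow> norm (J (D l g)) \<le> C * norm g"
proof -
  have Bl: "bounded_linear B" and Jl: "bounded_linear J" and Al: "bounded_linear A"
    using J(1) A B(1) by (auto simp: bounded_clinear_on_UNIV_iff)
  obtain c where c: "c > 0" "\<And>g. \<exists>d. B d = g \<and> norm d \<le> c * norm g"
    using open_mapping_bounded_preimage[OF Bl B(2)] by blast
  obtain KJ where KJ: "KJ > 0" "\<And>d. norm (J d) \<le> norm d * KJ" using bounded_linear.pos_bounded[OF Jl] by blast
  obtain KA where KA: "KA > 0" "\<And>d. norm (A d) \<le> norm d * KA" using bounded_linear.pos_bounded[OF Al] by blast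
  define C where "C = ((1 + M) * KJ + M / \<omega> * KA) * c"
  have "norm (J (D l g)) \<le> C * norm g" if l: "Re l > \<omega>" for l g
  proof -
    have l0: "cmod l \<ge> \<omega>" "cmod l > 0" using l \<omega> complex_Re_le_cmod[of l] by auto
    obtain d where d: "B d = g" "norm d \<le> c * norm g" using c by blast
    obtain p where p: "B p = 0" "l *\<^sub>C J p - A p = l *\<^sub>C J d - A d" by (rule solvable[OF l])
    have eq: "D l g = d - p"
      using p by (intro D_eqI l) (simp_all add: linear_simps d scaleC.diff_right algebra_simps)
    have "norm (J p) \<le> M / cmod l * norm (l *\<^sub>C J d - A d)" using kernel_bound[OF l p(1)] p(2) by simp
    also have "\<dots> \<le> M / cmod l * (cmod l * norm (J d) + norm (A d))"
      using norm_triangle_ineq4[of "l *\<^sub>C J d" "A d"] M by (intro mult_left_mono) (auto simp: norm_scaleC)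
    also have "\<dots> = M * norm (J d) + M / cmod l * norm (A d)" using l0 by (simp add: field_simps)
    also have "\<dots> \<le> M * norm (J d) + M / \<omega> * norm (A d)"
      using l0 M \<omega> by (intro add_left_mono mult_right_mono divide_left_mono mult_pos_pos) auto
    finally have "norm (J (D l g)) \<le> (1 + M) * norm (J d) + M / \<omega> * norm (A d)"
      using norm_triangle_ineq4[of "J d" "J p"] by (simp add: eq linear_simps algebra_simps)
    also have "\<dots> \<le> (1 + M) * (norm d * KJ) + M / \<omega> * (norm d * KA)"
      using M \<omega> by (intro add_mono mult_left_mono KJ KA) auto
    also have "\<dots> = ((1 + M) * KJ + M / \<omega> * KA) * norm d" by (simp add: algebra_simps)
    also have "\<dots> \<le> ((1 + M) * KJ + M / \<omega> * KA) * (c * norm g)"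
      using M \<omega> KJ(1) KA(1) by (intro mult_left_mono d) (auto intro!: add_nonneg_nonneg mult_nonneg_nonneg)
    finally show ?thesis by (simp add: C_def mult_ac)
  qed
  moreover have "C > 0" unfolding C_def using M \<omega> KJ(1) KA(1) c(1)
    by (intro mult_pos_pos add_pos_pos divide_pos_pos) auto
  ultimately show ?thesis using that by blast
qed

text \<open>The Dirichlet solution is \<open>d - R(l)(l - A) d\<close> for any \<open>d\<close> with \<open>B d = g\<close>; it is small
  because \<open>J d\<close> lies in the closure of \<open>ker B\<close>, where \<open>l R(l)\<close> tends to the identity.\<close>
lemma D_tendsto_0:
  assumes e: "e > 0"
  shows "\<exists>K. \<forall>l. Re l > \<omega> \<longrightarrow> cmod l > K \<longrightarrow> norm (J (D l g)) \<le> e"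
proof -
  obtain d where d: "B d = g" using B(2) by (metis surjD)
  \<comment> \<open>\<open>e'\<close> and \<open>M * e'\<close> together make up
    \<open>e / 2\<close>; the other half is left for the term with \<open>A\<close>.\<close>
  define e' where "e' = e / (2 * (1 + M))"
  have e': "e' > 0" "(1 + M) * e' = e / 2" using e M by (auto simp: e'_def field_simps)
  have "J d \<in> closure (J ` {u. B u = 0})" using V_kernel V_def closure_subset[of "range J"] by auto
  then obtain q where q: "B q = 0" "norm (J d - J q) < e'"
    using e'(1) unfolding closure_approachable by (auto simp: dist_norm norm_minus_commute)
  define K where "K = 2 * M * norm (A (d - q)) / e"
  show ?thesis
  proof (intro exI allI impI)
    fix l assume l: "Re l > \<omega>" and lK: "cmod l > K"
    have l0: "cmod l > 0" using l \<omega> by auto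
    obtain p where p: "B p = 0" "l *\<^sub>C J p - A p = l *\<^sub>C J d - A d" by (rule solvable[OF l])
    have eq: "D l g = d - p"
      using p by (intro D_eqI l) (simp_all add: linear_simps d scaleC.diff_right algebra_simps)
    \<comment> \<open>\<open>p - q\<close> solves the resolvent equation on the kernel of
      \<open>B\<close> with data from \<open>d - q\<close>: its \<open>J\<close>-part is small in
      \<open>X\<close>, its \<open>A\<close>-part is fixed and gets divided by
      \<open>cmod l\<close>.\<close>
    have "l *\<^sub>C J (p - q) - A (p - q) = l *\<^sub>C J (d - q) - A (d - q)"
      using p(2) by (simp add: linear_simps scaleC.diff_right algebra_simps)
    then have "norm (J (p - q)) \<le> M / cmod l * norm (l *\<^sub>C J (d - q) - A (d - q))"
      using kernel_bound[OF l, of "p - q"] p q by (simp add: linear_simps(8))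
    also have "\<dots> \<le> M / cmod l * (cmod l * norm (J (d - q)) + norm (A (d - q)))"
      using norm_triangle_ineq4[of "l *\<^sub>C J (d - q)" "A (d - q)"] M
      by (intro mult_left_mono) (auto simp: norm_scaleC)
    also have "\<dots> = M * norm (J (d - q)) + M * norm (A (d - q)) / cmod l" using l0 by (simp add: field_simps)
    also have "\<dots> \<le> M * e' + e / 2"
    proof (intro add_mono mult_left_mono)
      have "2 * M * norm (A (d - q)) \<le> cmod l * e" using lK e by (simp add: K_def field_simps)
      then show "M * norm (A (d - q)) / cmod l \<le> e / 2" using l0 by (simp add: field_simps)
    qed (use q M in \<open>auto simp: linear_simps\<close>)
    finally have "norm (J (p - q)) \<le> M * e' + e / 2" .
    moreover have "norm (J (D l g)) \<le> norm (J d - J q) + norm (J (p - q))"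
      using norm_triangle_ineq4[of "J d - J q" "J (p - q)"] by (simp add: eq linear_simps)
    ultimately show "norm (J (D l g)) \<le> e" using q(2) e'(2) by (simp add: algebra_simps)
  qed
qed

lemma J_0: "J 0 = 0" and B_0: "B 0 = 0"
  using linear_simps(2,8)[of 0 0] by simp_all

lemma V_subspace: "complex_vector.subspace V"
  unfolding V_def
proof (rule closure_csubspace)
  show "complex_vector.subspace (range J)"
    unfolding complex_vector.subspace_def
  proof (intro conjI ballI allI)
    show "0 \<in> range J" using J_0 by (metis rangeI)
    fix x assume "x \<in> range J"
    then obtain u where u: "x = J u" by auto
    show "c *\<^sub>C x \<in> range J" for c unfolding u by (rule range_eqI[of _ _ "c *\<^sub>C u"]) (simp add: linear_simps)
    fix y assume "y \<in> range J"
    then obtain v where v: "y = J v" by auto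
    show "x + y \<in> range J" unfolding u v by (rule range_eqI[of _ _ "u + v"]) (simp add: linear_simps)
  qed
qed

lemma J_in_V: "J d \<in> V"
  unfolding V_def by (rule subsetD[OF closure_subset]) simp

lemma \<Phi>_linear: "x \<in> V \<Longrightarrow> y \<in> V \<Longrightarrow> \<Phi> (x + y) = \<Phi> x + \<Phi> y" "x \<in> V \<Longrightarrow> \<Phi> (c *\<^sub>C x) = c *\<^sub>C \<Phi> x"
  using \<Phi> by (auto simp: bounded_clinear_on_def clinear_on_def)

lemma \<Phi>_diff: "x \<in> V \<Longrightarrow> y \<in> V \<Longrightarrow> \<Phi> (x - y) = \<Phi> x - \<Phi> y"
  using \<Phi>_linear(1)[of "x - y" y] complex_vector.subspace_diff[OF V_subspace] by simp

text \<open>The image of the unit ball under \<open>\<Phi>\<close> has a finite net; pointwise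
  convergence is uniform on the net, and the uniform bound \<open>C\<close> controls the distance to
  it.\<close>

lemma D_\<Phi>_small:
  assumes e: "e > 0"
  shows "\<exists>K. \<forall>l x. Re l > \<omega> \<longrightarrow> cmod l > K \<longrightarrow> x \<in> V \<longrightarrow> norm (J (D l (\<Phi> x))) \<le> e * norm x"
proof -
  obtain C where C: "C > 0" "\<And>l g. Re l > \<omega> \<Longrightarrow> norm (J (D l g)) \<le> C * norm g" by (rule D_bound) blast
  have "e / (2 * C) > 0" using e C by simp
  then obtain F where F: "finite F" "closure (\<Phi> ` (V \<inter> cball 0 1)) \<subseteq> (\<Union>g\<in>F. ball g (e / (2 * C)))"
    using \<Phi>_compact unfolding compact_eq_totally_bounded by meson
  have "\<forall>g. \<exists>K. \<forall>l. Re l > \<omega> \<longrightarrow> cmod l > K \<longrightarrow> norm (J (D l g)) \<le> e / 2"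
    using D_tendsto_0[of "e / 2"] e by simp
  then obtain \<kappa> where \<kappa>: "\<And>g l. Re l > \<omega> \<Longrightarrow> cmod l > \<kappa> g \<Longrightarrow> norm (J (D l g)) \<le> e / 2" by metis
  \<comment> \<open>Inserting \<open>0\<close> keeps \<open>Max\<close> meaningful for an empty
    net.\<close>
  define K where "K = Max (insert 0 (\<kappa> ` F))"
  have K: "\<kappa> g \<le> K" if "g \<in> F" for g using that F(1) by (simp add: K_def)
  have unit: "norm (J (D l (\<Phi> x))) \<le> e" if l: "Re l > \<omega>" "cmod l > K" and x: "x \<in> V" "norm x \<le> 1" for l x
  proof -
    have "\<Phi> x \<in> closure (\<Phi> ` (V \<inter> cball 0 1))" using x by (intro subsetD[OF closure_subset]) auto
    then obtain g where g: "g \<in> F" "norm (\<Phi> x - g) < e / (2 * C)"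
      using F(2) by (auto simp: dist_norm norm_minus_commute)
    have "norm (J (D l (\<Phi> x))) \<le> norm (J (D l (\<Phi> x - g))) + norm (J (D l g))"
      using norm_triangle_ineq[of "J (D l (\<Phi> x - g))" "J (D l g)"] by (simp add: D_diff l linear_simps)
    also have "norm (J (D l (\<Phi> x - g))) \<le> C * norm (\<Phi> x - g)" by (rule C(2)[OF l(1)])
    also have "C * norm (\<Phi> x - g) \<le> C * (e / (2 * C))" using g C(1) by (intro mult_left_mono) auto
    also have "\<dots> = e / 2" using C(1) by simp
    also have "norm (J (D l g)) \<le> e / 2" using \<kappa>[of l g] K[OF g(1)] l by simp
    finally show ?thesis by simp
  qed
  have "norm (J (D l (\<Phi> x))) \<le> e * norm x" if l: "Re l > \<omega>" "cmod l > K" and x: "x \<in> V" for l x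
  proof (cases "x = 0")
    case True
    have "\<Phi> x = 0" using \<Phi>_linear(2)[OF x, of 0] True by simp
    then show ?thesis using C(2)[OF l(1), of 0] by (simp add: True)
  next
    case False
    define c where "c = complex_of_real (1 / norm x)"
    have "c *\<^sub>C x \<in> V" using V_subspace x by (rule complex_vector.subspace_scale)
    moreover have "norm (c *\<^sub>C x) \<le> 1" using False by (simp add: c_def norm_scaleC norm_divide)
    ultimately have "norm (J (D l (\<Phi> (c *\<^sub>C x)))) \<le> e" by (rule unit[OF l])
    also have "\<Phi> (c *\<^sub>C x) = c *\<^sub>C \<Phi> x" by (rule \<Phi>_linear(2)[OF x])
    also have "J (D l (c *\<^sub>C \<Phi> x)) = c *\<^sub>C J (D l (\<Phi> x))" by (simp add: D_scaleC l linear_simps)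
    finally show ?thesis using False by (simp add: c_def norm_scaleC norm_divide field_simps)
  qed
  then show ?thesis by blast
qed

section \<open>Domain and resolvent of the perturbed operator\<close>

definition E where "E = J ` {u. B u = \<Phi> (J u)}"

lemma E_iff: "J u \<in> E \<longleftrightarrow> B u = \<Phi> (J u)"
  using J(2) by (auto simp: E_def inj_eq)

lemma E_cases:
  assumes "x \<in> E"
  obtains u where "x = J u" "B u = \<Phi> (J u)"
proof -
  obtain u where "u \<in> {u. B u = \<Phi> (J u)}" "x = J u" using assms unfolding E_def by (rule imageE)
  then show ?thesis by (intro that) simp_all
qed

lemma E_subspace: "complex_vector.subspace E"
  unfolding complex_vector.subspace_def
proof (intro conjI ballI allI)
  have "\<Phi> (J 0) = 0" using \<Phi>_diff[OF J_in_V J_in_V, of 0 0] J_0 by simp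
  then have "J 0 \<in> E" unfolding E_iff by (simp add: B_0)
  then show "0 \<in> E" by (simp add: J_0)
  fix x assume "x \<in> E"
  then obtain u where u: "x = J u" "B u = \<Phi> (J u)" by (rule E_cases)
  have "J (c *\<^sub>C u) \<in> E" for c unfolding E_iff by (simp add: linear_simps \<Phi>_linear J_in_V u)
  then show "c *\<^sub>C x \<in> E" for c by (simp add: linear_simps u)
  fix y assume "y \<in> E"
  then obtain v where v: "y = J v" "B v = \<Phi> (J v)" by (rule E_cases)
  have "J (u + v) \<in> E" unfolding E_iff by (simp add: linear_simps \<Phi>_linear J_in_V u v)
  then show "x + y \<in> E" by (simp add: linear_simps u v)
qed

lemma G_clinear: "clinear_on E UNIV (A \<circ> inv J)"
  unfolding clinear_on_def
proof (intro conjI ballI allI)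
  fix x assume "x \<in> E"
  then obtain u where u: "x = J u" by (rule E_cases)
  have "(A \<circ> inv J) (J (c *\<^sub>C u)) = c *\<^sub>C (A \<circ> inv J) (J u)" for c by (simp add: inv_J linear_simps(6))
  then show "(A \<circ> inv J) (c *\<^sub>C x) = c *\<^sub>C (A \<circ> inv J) x" for c by (simp only: linear_simps u)
  fix y assume "y \<in> E"
  then obtain v where v: "y = J v" by (rule E_cases)
  have "(A \<circ> inv J) (J (u + v)) = (A \<circ> inv J) (J u) + (A \<circ> inv J) (J v)" by (simp add: inv_J linear_simps(4))
  then show "(A \<circ> inv J) (x + y) = (A \<circ> inv J) x + (A \<circ> inv J) y" by (simp only: linear_simps u v)
qed simp

text \<open>The fixed point is sought in \<open>V\<close>, where \<open>\<Phi>\<close> is defined;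
  the equation itself exhibits it as \<open>J d\<close>, so the solution gains the regularity of the
  domain.\<close>

lemma fixed_point:
  assumes l: "Re l > \<omega>" and small: "\<And>x. x \<in> V \<Longrightarrow> norm (J (D l (\<Phi> x))) \<le> 1 / 2 * norm x"
  obtains d where "B d = B p + \<Phi> (J d)" "d = p + D l (\<Phi> (J d))"
proof -
  obtain u where u: "u \<in> V" "u = J p + J (D l (\<Phi> u))"
  proof (rule contraction_fixed_point[of V "J p" "\<lambda>u. J (D l (\<Phi> u))"])
    show "closed V" by (simp add: V_def)
    show "x + x' \<in> V" if "x \<in> V" "x' \<in> V" for x x'
      using that V_subspace by (rule complex_vector.subspace_add[rotated 1])
    fix x x' assume x: "x \<in> V" "x' \<in> V"
    show "norm (J (D l (\<Phi> x)) - J (D l (\<Phi> x'))) \<le> 1 / 2 * norm (x - x')"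
      using small[OF complex_vector.subspace_diff[OF V_subspace x]]
      by (simp add: \<Phi>_diff x D_diff l linear_simps)
  qed (auto intro: J_in_V)
  define d where "d = p + D l (\<Phi> u)"
  have "J d = u" using u(2) by (simp add: d_def linear_simps)
  then show ?thesis by (intro that[of d]) (simp_all add: d_def linear_simps D l)
qed

text \<open>\<open>D l\<close> has values in the kernel of \<open>l - A\<close>, so passing from
  \<open>d\<close> to \<open>d - D l (\<Phi> (J d))\<close> leaves the right-hand side unchanged and
  exchanges the condition \<open>B d = \<Phi> (J d)\<close> for a zero boundary value. Absorbing the
  half doubles \<open>M\<close>.\<close>

lemma perturbed_estimate:
  assumes l: "Re l > \<omega>" and small: "\<And>x. x \<in> V \<Longrightarrow> norm (J (D l (\<Phi> x))) \<le> 1 / 2 * norm x"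
  shows "resolvent_estimate E (A \<circ> inv J) l (2 * M / cmod l)"
  unfolding resolvent_estimate_def
proof (intro conjI allI ballI)
  fix y
  obtain p where p: "B p = 0" "l *\<^sub>C J p - A p = y" by (rule solvable[OF l])
  obtain d where d: "B d = B p + \<Phi> (J d)" "d = p + D l (\<Phi> (J d))" using fixed_point[OF l small] by blast
  have "l *\<^sub>C J d - A d = l *\<^sub>C J p - A p"
    by (subst (1 2) d(2)) (simp add: linear_simps D l scaleC_add_right)
  then show "\<exists>u\<in>E. l *\<^sub>C u - (A \<circ> inv J) u = y"
    unfolding E_def using d(1) p by (auto simp: inv_J intro!: bexI[of _ "J d"])
next
  fix u assume "u \<in> E"
  then obtain d where d: "u = J d" "B d = \<Phi> (J d)" by (auto simp: E_def)
  define q where "q = d - D l (\<Phi> u)"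
  have q: "B q = 0" "l *\<^sub>C J q - A q = l *\<^sub>C J d - A d"
    using d by (simp_all add: q_def linear_simps D l scaleC.diff_right)
  have "norm u \<le> norm (J q) + norm (J (D l (\<Phi> u)))"
    using norm_triangle_ineq[of "J q" "J (D l (\<Phi> u))"] by (simp add: d q_def linear_simps)
  also have "norm (J (D l (\<Phi> u))) \<le> 1 / 2 * norm u" by (rule small) (simp add: d J_in_V)
  finally have "norm u \<le> 2 * norm (J q)" by simp
  also have "\<dots> \<le> 2 * (M / cmod l * norm (l *\<^sub>C J d - A d))"
    using kernel_bound[OF l q(1)] q(2) by simp
  finally show "norm u \<le> 2 * M / cmod l * norm (l *\<^sub>C u - (A \<circ> inv J) u)" by (simp add: d inv_J)
qed

text \<open>An element \<open>J p\<close> with \<open>B p = 0\<close> is approximated by the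
  \<open>J d\<close> from \<open>fixed_point\<close>, which lies in \<open>E\<close>; the difference
  is \<open>J (D l (\<Phi> (J d)))\<close>, small for large \<open>l\<close>.\<close>

lemma closure_E: "closure E = V"
proof
  show "closure E \<subseteq> V" unfolding V_def E_def by (intro closure_mono) auto
  have "J ` {u. B u = 0} \<subseteq> closure E"
  proof
    fix v assume "v \<in> J ` {u. B u = 0}"
    then obtain p where p: "v = J p" "B p = 0" by auto
    show "v \<in> closure E"
      unfolding closure_approachable
    proof (intro allI impI)
      fix e :: real assume e: "e > 0"
      \<comment> \<open>The entry \<open>1 / 2\<close> gives the contraction and with it
        \<open>norm (J d) \<le> 2 * norm v\<close>; the other one then makes the error at most
        \<open>e / 2\<close>, its summand \<open>1\<close> avoiding a division by zero.\<close>
      define \<eta> where "\<eta> = min (1 / 2) (e / (4 * (norm v + 1)))"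
      have \<eta>_le: "\<eta> \<le> 1 / 2" "\<eta> \<le> e / (4 * (norm v + 1))"
        unfolding \<eta>_def by (rule min.cobounded1 min.cobounded2)+
      have \<eta>: "\<eta> > 0" using e by (simp add: \<eta>_def add_nonneg_pos)
      obtain K where K: "\<And>l x. Re l > \<omega> \<Longrightarrow> cmod l > K \<Longrightarrow> x \<in> V \<Longrightarrow> norm (J (D l (\<Phi> x))) \<le> \<eta> * norm x"
        using D_\<Phi>_small[OF \<eta>] by blast
      define l where "l = complex_of_real (max \<omega> \<bar>K\<bar> + 1)"
      have l: "Re l > \<omega>" "cmod l > K" using \<omega> by (auto simp: l_def simp del: of_real_add)
      have small: "norm (J (D l (\<Phi> x))) \<le> 1 / 2 * norm x" if "x \<in> V" for x
      proof -
        have "\<eta> * norm x \<le> 1 / 2 * norm x" by (intro mult_right_mono \<eta>_le) simp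
        with K[OF l that] show ?thesis by simp
      qed
      obtain d where d: "B d = B p + \<Phi> (J d)" "d = p + D l (\<Phi> (J d))"
        using fixed_point[OF l(1) small] by blast
      have eq: "J d - v = J (D l (\<Phi> (J d)))" by (subst d(2)) (simp add: linear_simps p)
      have "norm (J d) \<le> norm v + norm (J d - v)" using norm_triangle_ineq[of v "J d - v"] by simp
      also have "norm (J d - v) \<le> 1 / 2 * norm (J d)" unfolding eq by (rule small[OF J_in_V])
      finally have nd: "norm (J d) \<le> 2 * norm v" by simp
      have "norm (J d - v) \<le> \<eta> * norm (J d)" unfolding eq by (rule K[OF l J_in_V])
      also have "\<dots> \<le> \<eta> * (2 * norm v)" using \<eta> nd by (intro mult_left_mono) auto
      also have "\<dots> \<le> e / (4 * (norm v + 1)) * (2 * (norm v + 1))"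
        using e by (intro mult_mono \<eta>_le) auto
      also have "\<dots> = e / 2"
        using norm_ge_zero[of v] by (simp add: divide_simps del: norm_ge_zero)
      also have "\<dots> < e" using e by simp
      finally have "dist (J d) v < e" by (simp add: dist_norm)
      moreover have "J d \<in> E" using d(1) p(2) by (auto simp: E_def)
      ultimately show "\<exists>y\<in>E. dist y v < e" by blast
    qed
  qed
  then show "V \<subseteq> closure E" unfolding V_kernel by (rule closure_minimal) simp
qed

lemma perturbed_generation:
  "\<exists>T. holomorphic_semigroup_on UNIV T \<and> generator_on UNIV E (A \<circ> inv J) T \<and>
    holomorphic_semigroup_on V T \<and> strongly_continuous_on V T"
proof -
  have "(1 / 2 :: real) > 0" by simp
  from D_\<Phi>_small[OF this] obtain K where K:
    "\<And>l x. Re l > \<omega> \<Longrightarrow> cmod l > K \<Longrightarrow> x \<in> V \<Longrightarrow> norm (J (D l (\<Phi> x))) \<le> 1 / 2 * norm x" by blast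
  \<comment> \<open>A half plane beyond \<open>K\<close> lies in the region
    \<open>cmod l > K\<close>, where the contraction holds.\<close>
  define \<omega>' where "\<omega>' = max \<omega> K"
  have est: "resolvent_estimate E (A \<circ> inv J) l (2 * M / cmod l)" if l: "Re l > \<omega>'" for l
  proof (rule perturbed_estimate)
    show lw: "Re l > \<omega>" using l by (simp add: \<omega>'_def)
    have lK: "cmod l > K" using l complex_Re_le_cmod[of l] by (simp add: \<omega>'_def)
    show "norm (J (D l (\<Phi> x))) \<le> 1 / 2 * norm x" if "x \<in> V" for x by (rule K[OF lw lK that])
  qed
  have \<omega>': "\<omega>' > 0" using \<omega> by (simp add: \<omega>'_def)
  have M2: "2 * M > 0" using M by simp
  show ?thesis using sectorial_generation[OF E_subspace G_clinear \<omega>' M2 est] by (simp only: closure_E)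
qed

end

theorem theorem3p2:
  fixes J :: "'d::complex_banach \<Rightarrow> 'x::complex_banach"
    and A :: "'d \<Rightarrow> 'x"
    and B :: "'d \<Rightarrow> 'b::complex_banach"
    and \<Phi> :: "'x \<Rightarrow> 'b"
  assumes embedding: "bounded_clinear_on UNIV UNIV J" "inj J"
    and A: "bounded_clinear_on UNIV UNIV A"
    and B: "bounded_clinear_on UNIV UNIV B"
    and \<Phi>: "bounded_clinear_on (closure (range J)) UNIV \<Phi>"
    and B_surj: "surj B"
    and \<Phi>_compact: "compact_operator_on (closure (range J)) \<Phi>"
    and A0_generates: "\<exists>T0. holomorphic_semigroup_on UNIV T0 \<and>
          generator_on UNIV (J ` {u. B u = 0}) (A \<circ> inv J) T0"
    and A0_closure: "closure (J ` {u. B u = 0}) = closure (range J)"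
  shows "\<exists>T. holomorphic_semigroup_on UNIV T \<and>
           generator_on UNIV (J ` {u. B u = \<Phi> (J u)}) (A \<circ> inv J) T \<and>
           holomorphic_semigroup_on (closure (range J)) T \<and>
           strongly_continuous_on (closure (range J)) T"
proof -
  \<comment> \<open>From here on the semigroup of \<open>A\<^sub>0\<close> is represented by its
    resolvent estimate.\<close>
  obtain \<omega> M where est: "\<omega> > 0" "M > 0" "\<And>l. Re l > \<omega> \<Longrightarrow>
      resolvent_estimate (J ` {u. B u = 0}) (A \<circ> inv J) l (M / cmod l)"
    using A0_generates holomorphic_generator_half_plane by metis
  interpret boundary_perturbation J A B \<Phi> "closure (range J)" \<omega> M
  proof
    show "compact (closure (\<Phi> ` (closure (range J) \<inter> cball 0 1)))"
      using \<Phi>_compact by (simp add: compact_operator_on_def)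
    show "closure (range J) = closure (J ` {u. B u = 0})" using A0_closure by simp
  qed (fact refl embedding A B \<Phi> B_surj est)+
  show ?thesis using perturbed_generation unfolding E_def .
qed

end
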